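(* Let $I\subset R=\mathbb{K}[x_1,\ldots,x_n]$ be a proper, homogeneous, geometrically vertex decomposable ideal. Then $a(R/I)\le 0$. Consequently, $HF_{R/I}(t)=HP_{R/I}(t)$ for all integers $t\ge1$.
   Context: $\mathbb{K}$ is an algebraically closed field of characteristic $0$ and $R=\mathbb{K}[x_1,\ldots,x_n]$ has the standard grading. Fix a variable $y=x_j$. A nonzero $f\in R$ is written $f=\sum_{i=0}^d\alpha_i y^i$ with $\alpha_i\in\mathbb{K}[x_1,\ldots,\widehat{x_j},\ldots,x_n]$ and $\alpha_d\ne0$; its initial $y$-form is $\mathrm{in}_y(f)=\alpha_d y^d$. For an ideal $J$, $\mathrm{in}_y(J)=\langle \mathrm{in}_y(f) : f\in J\rangle$. A monomial order $<$ is $y$-compatible if $\mathrm{in}_<(\mathrm{in}_y(f))=\mathrm{in}_<(f)$ for all $f\in R$. Given an ideal $I$ and a Gröbner basis $\{g_1,\ldots,g_m\}$ of $I$ with respect to a $y$-compatible order, write $g_i=y^{d_i}q_i+r_i$ with $\mathrm{in}_y(g_i)=y^{d_i}q_i$ and $y$ not dividing any term of $q_i$. Put $C_{y,I}=\langle q_1,\ldots,q_m\rangle$ and $N_{y,I}=\langle q_i : d_i=0\rangle$ (independent of choices). If $\mathrm{in}_y(I)=C_{y,I}\cap(N_{y,I}+\langle y\rangle)$, this is called a geometric vertex decomposition of $I$ with respect to $y$. An ideal $I$ is unmixed if $\dim(R/I)=\dim(R/P)$ for all associated primes $P$ of $R/I$. An ideal $I\subseteq\mathbb{K}[x_1,\ldots,x_n]$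 is geometrically vertex decomposable if $I$ is unmixed and either (1) $I=\langle1\rangle$ or $I$ is generated by a (possibly empty) subset of the variables, or (2) there is a variable $y=x_j$ and a $y$-compatible monomial order giving a geometric vertex decomposition $\mathrm{in}_y(I)=C_{y,I}\cap(N_{y,I}+\langle y\rangle)$ such that the contractions of $C_{y,I}$ and $N_{y,I}$ to $\mathbb{K}[x_1,\ldots,\widehat{x_j},\ldots,x_n]$ are geometrically vertex decomposable. The $a$-invariant of a finitely generated graded module $M$ of dimension $d$ with Hilbert series $h_M(t)/(1-t)^d$ is $a(M)=\deg h_M(t)-d$. $HF_{R/I}(t)=\dim_{\mathbb{K}}(R/I)_t$ is the Hilbert function and $HP_{R/I}$ is the Hilbert polynomial of $R/I$. *)

theory Defs
  imports
    "HOL-Algebra.QuotRing"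
    "HOL-Algebra.Embedded_Algebras"
    "HOL-Library.Poly_Mapping"
    "HOL-Library.Extended_Nat"
    "HOL-Computational_Algebra.Polynomial_FPS"
begin

section \<open>The rings \<open>\<bbbK>[X]\<close>\<close>

text \<open>
  Monomials are finitely supported exponent vectors (the variables are natural numbers), and
  polynomials are finitely supported functions from monomials to coefficients. The polynomial ring
  in the variables \<open>X\<close> is a subring of this type, so that \<open>\<bbbK>[X - {y}]\<close> is literally
  contained in \<open>\<bbbK>[X]\<close>.
\<close>

type_synonym monom = "nat \<Rightarrow>\<^sub>0 nat"

type_synonym 'k mpoly = "monom \<Rightarrow>\<^sub>0 'k"

definition monomials :: "nat set \<Rightarrow> monom set" where
  "monomials X = {m. Poly_Mapping.keys m \<subseteq> X}"

definition poly_ring :: "nat set \<Rightarrow> ('k::field) mpoly ring" where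
  "poly_ring X = \<lparr>carrier = {f. Poly_Mapping.keys f \<subseteq> monomials X},
     monoid.mult = (*), one = 1, zero = 0, add = (+)\<rparr>"

definition const :: "'k::field \<Rightarrow> 'k mpoly" where
  "const c = Poly_Mapping.single 0 c"

definition var :: "nat \<Rightarrow> ('k::field) mpoly" where
  "var j = Poly_Mapping.single (Poly_Mapping.single j 1) 1"

lemma poly_ring_cring: "cring (poly_ring X :: ('k::field) mpoly ring)"
proof (rule cringI)
  show "abelian_group (poly_ring X :: 'k mpoly ring)"
  proof (rule abelian_groupI)
    fix f g :: "'k mpoly"
    assume "f \<in> carrier (poly_ring X)" "g \<in> carrier (poly_ring X)"
    then show "f \<oplus>\<^bsub>poly_ring X\<^esub> g \<in> carrier (poly_ring X)"
      using Poly_Mapping.keys_add[of f g] by (auto simp: poly_ring_def)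
  next
    fix f :: "'k mpoly"
    assume "f \<in> carrier (poly_ring X)"
    then show "\<exists>g\<in>carrier (poly_ring X). g \<oplus>\<^bsub>poly_ring X\<^esub> f = \<zero>\<^bsub>poly_ring X\<^esub>"
      by (intro bexI[of _ "- f"]) (auto simp: poly_ring_def)
  qed (auto simp: poly_ring_def algebra_simps)
  show "Group.comm_monoid (poly_ring X :: 'k mpoly ring)"
  proof (rule comm_monoidI)
    fix f g :: "'k mpoly"
    assume fg: "f \<in> carrier (poly_ring X)" "g \<in> carrier (poly_ring X)"
    show "f \<otimes>\<^bsub>poly_ring X\<^esub> g \<in> carrier (poly_ring X)"
    proof -
      have "m \<in> monomials X" if "m \<in> Poly_Mapping.keys (f * g)" for m
      proof -
        from that Poly_Mapping.keys_mult[of f g] obtain a b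
          where m: "m = a + b" and "a \<in> Poly_Mapping.keys f" "b \<in> Poly_Mapping.keys g" by blast
        with fg have "a \<in> monomials X" "b \<in> monomials X" by (auto simp: poly_ring_def)
        then show ?thesis
          using Poly_Mapping.keys_add[of a b] by (auto simp: m monomials_def)
      qed
      then show ?thesis by (auto simp: poly_ring_def)
    qed
  qed (auto simp: poly_ring_def monomials_def algebra_simps)
qed (auto simp: poly_ring_def algebra_simps)


section \<open>Krull dimension and unmixed ideals\<close>

text \<open>
  The supremum of the lengths of strict chains of prime ideals. The zero ring gets dimension
  \<open>0\<close>; below, this value never matters.
\<close>

definition krull_dim :: "('a, 'b) ring_scheme \<Rightarrow> enat" where
  "krull_dim A = Sup {enat l | l. \<exists>P :: nat \<Rightarrow> 'a set.
     (\<forall>i\<le>l. primeideal (P i) A) \<and> (\<forall>i<l. P i \<subset> P (Suc i))}"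

text \<open>The primes of the form \<open>Ann (f + I)\<close>, that is, the associated primes of \<open>A/I\<close>.\<close>

definition assoc_primes :: "('a, 'b) ring_scheme \<Rightarrow> 'a set \<Rightarrow> 'a set set" where
  "assoc_primes A I = {P. primeideal P A \<and>
     (\<exists>f\<in>carrier A. P = {r \<in> carrier A. r \<otimes>\<^bsub>A\<^esub> f \<in> I})}"

definition unmixed :: "('a, 'b) ring_scheme \<Rightarrow> 'a set \<Rightarrow> bool" where
  "unmixed A I \<longleftrightarrow> (\<forall>P\<in>assoc_primes A I. krull_dim (A Quot I) = krull_dim (A Quot P))"


section \<open>Initial \<open>y\<close>-forms\<close>

definition y_degree :: "nat \<Rightarrow> ('k::field) mpoly \<Rightarrow> nat" where
  "y_degree y f = Max (insert 0 ((\<lambda>m. Poly_Mapping.lookup m y) ` Poly_Mapping.keys f))"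

text \<open>
  The coefficients \<open>\<alpha>\<^sub>i\<close>, free of \<open>y\<close>, in \<open>f = (\<Sum>i. \<alpha>\<^sub>i y\<^sup>i)\<close>.
\<close>

definition y_coeff :: "nat \<Rightarrow> nat \<Rightarrow> ('k::field) mpoly \<Rightarrow> 'k mpoly" where
  "y_coeff y i f = (\<Sum>m | m \<in> Poly_Mapping.keys f \<and> Poly_Mapping.lookup m y = i.
     Poly_Mapping.single (Poly_Mapping.update y 0 m) (Poly_Mapping.lookup f m))"

definition lead_y_coeff :: "nat \<Rightarrow> ('k::field) mpoly \<Rightarrow> 'k mpoly" where
  "lead_y_coeff y f = y_coeff y (y_degree y f) f"

definition init_y :: "nat \<Rightarrow> ('k::field) mpoly \<Rightarrow> 'k mpoly" where
  "init_y y f = lead_y_coeff y f * var y ^ y_degree y f"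

definition init_y_ideal :: "nat set \<Rightarrow> nat \<Rightarrow> ('k::field) mpoly set \<Rightarrow> 'k mpoly set" where
  "init_y_ideal X y J = Idl\<^bsub>poly_ring X\<^esub> (init_y y ` J)"


section \<open>Monomial orders and Groebner bases\<close>

text \<open>An order is given as the set of pairs \<open>(a, b)\<close> of monomials with \<open>a \<le> b\<close>.\<close>

definition monomial_order :: "nat set \<Rightarrow> monom rel \<Rightarrow> bool" where
  "monomial_order X ord \<longleftrightarrow> well_order_on (monomials X) ord \<and>
     (\<forall>a b c. (a, b) \<in> ord \<longrightarrow> c \<in> monomials X \<longrightarrow> (a + c, b + c) \<in> ord)"

definition lead_monom :: "monom rel \<Rightarrow> ('k::field) mpoly \<Rightarrow> monom" where
  "lead_monom ord f =
     (THE m. m \<in> Poly_Mapping.keys f \<and> (\<forall>m'\<in>Poly_Mapping.keys f. (m', m) \<in> ord))"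

text \<open>The initial term, with its coefficient; it is \<open>0\<close> for \<open>f = 0\<close>.\<close>

definition init_term :: "monom rel \<Rightarrow> ('k::field) mpoly \<Rightarrow> 'k mpoly" where
  "init_term ord f =
     Poly_Mapping.single (lead_monom ord f) (Poly_Mapping.lookup f (lead_monom ord f))"

definition y_compatible :: "'k::field itself \<Rightarrow> nat set \<Rightarrow> nat \<Rightarrow> monom rel \<Rightarrow> bool" where
  "y_compatible _ X y ord \<longleftrightarrow>
     (\<forall>f \<in> carrier (poly_ring X :: 'k mpoly ring). init_term ord (init_y y f) = init_term ord f)"

definition groebner_basis ::
    "nat set \<Rightarrow> monom rel \<Rightarrow> ('k::field) mpoly set \<Rightarrow> 'k mpoly set \<Rightarrow> bool" where
  "groebner_basis X ord G I \<longleftrightarrow> finite G \<and> G \<subseteq> I - {0} \<and>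
     Idl\<^bsub>poly_ring X\<^esub> (init_term ord ` G) = Idl\<^bsub>poly_ring X\<^esub> (init_term ord ` I)"


section \<open>Geometric vertex decomposition\<close>

text \<open>
  The ideals \<open>C\<^bsub>y,I\<^esub>\<close> and \<open>N\<^bsub>y,I\<^esub>\<close> computed from a Groebner basis \<open>G\<close> of \<open>I\<close>. In
  \<open>g = y\<^sup>d q + r\<close>, the factor \<open>q\<close> is the leading \<open>y\<close>-coefficient of \<open>g\<close>.
\<close>

definition C_ideal :: "nat set \<Rightarrow> nat \<Rightarrow> ('k::field) mpoly set \<Rightarrow> 'k mpoly set" where
  "C_ideal X y G = Idl\<^bsub>poly_ring X\<^esub> (lead_y_coeff y ` G)"

definition N_ideal :: "nat set \<Rightarrow> nat \<Rightarrow> ('k::field) mpoly set \<Rightarrow> 'k mpoly set" where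
  "N_ideal X y G = Idl\<^bsub>poly_ring X\<^esub> (lead_y_coeff y ` {g \<in> G. y_degree y g = 0})"

definition geometric_vertex_decomposition ::
    "nat set \<Rightarrow> nat \<Rightarrow> monom rel \<Rightarrow> ('k::field) mpoly set \<Rightarrow> 'k mpoly set \<Rightarrow> bool" where
  "geometric_vertex_decomposition X y ord G I \<longleftrightarrow>
     monomial_order X ord \<and> y_compatible TYPE('k) X y ord \<and> groebner_basis X ord G I \<and>
     init_y_ideal X y I =
       C_ideal X y G \<inter> (N_ideal X y G <+>\<^bsub>poly_ring X\<^esub> Idl\<^bsub>poly_ring X\<^esub> {var y})"

definition contraction :: "nat set \<Rightarrow> ('k::field) mpoly set \<Rightarrow> 'k mpoly set" where
  "contraction Y J = J \<inter> carrier (poly_ring Y)"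

text \<open>\<open>gvd X I\<close>: the ideal \<open>I\<close> of \<open>\<bbbK>[X]\<close> is geometrically vertex decomposable.\<close>

inductive gvd :: "nat set \<Rightarrow> ('k::field) mpoly set \<Rightarrow> bool" where
  gvd_unit: "\<lbrakk>unmixed (poly_ring X) I; I = carrier (poly_ring X)\<rbrakk> \<Longrightarrow> gvd X I"
| gvd_vars: "\<lbrakk>unmixed (poly_ring X) I; V \<subseteq> X; I = Idl\<^bsub>poly_ring X\<^esub> (var ` V)\<rbrakk> \<Longrightarrow> gvd X I"
| gvd_step: "\<lbrakk>ideal I (poly_ring X); unmixed (poly_ring X) I; y \<in> X;
     geometric_vertex_decomposition X y ord G I;
     gvd (X - {y}) (contraction (X - {y}) (C_ideal X y G));
     gvd (X - {y}) (contraction (X - {y}) (N_ideal X y G))\<rbrakk> \<Longrightarrow> gvd X I"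


section \<open>Gradings, Hilbert functions and the \<open>a\<close>-invariant\<close>

definition monom_degree :: "monom \<Rightarrow> nat" where
  "monom_degree m = (\<Sum>i\<in>Poly_Mapping.keys m. Poly_Mapping.lookup m i)"

definition graded_part :: "nat set \<Rightarrow> nat \<Rightarrow> ('k::field) mpoly set" where
  "graded_part X t =
     {f \<in> carrier (poly_ring X). \<forall>m\<in>Poly_Mapping.keys f. monom_degree m = t}"

definition homogeneous_ideal :: "nat set \<Rightarrow> ('k::field) mpoly set \<Rightarrow> bool" where
  "homogeneous_ideal X I \<longleftrightarrow> (\<exists>S \<subseteq> (\<Union>t. graded_part X t). I = Idl\<^bsub>poly_ring X\<^esub> S)"

text \<open>
  The dimension of \<open>(R/I)\<^sub>t\<close>, the image of \<open>R\<^sub>t\<close> in \<open>R/I\<close>, over the field of scalars, i.e. the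
  image of \<open>\<bbbK>\<close> in \<open>R/I\<close>. The latter is a copy of \<open>\<bbbK>\<close> only for proper \<open>I\<close>.
\<close>

definition hilbert_function :: "nat set \<Rightarrow> ('k::field) mpoly set \<Rightarrow> nat \<Rightarrow> nat" where
  "hilbert_function X I t =
     ring.dim (poly_ring X Quot I)
       (range (\<lambda>c. I +>\<^bsub>poly_ring X\<^esub> const c))
       ((\<lambda>f. I +>\<^bsub>poly_ring X\<^esub> f) ` graded_part X t)"

definition hilbert_series :: "nat set \<Rightarrow> ('k::field) mpoly set \<Rightarrow> rat fps" where
  "hilbert_series X I = Abs_fps (\<lambda>t. of_nat (hilbert_function X I t))"

definition quot_dim :: "nat set \<Rightarrow> ('k::field) mpoly set \<Rightarrow> nat" where
  "quot_dim X I = the_enat (krull_dim (poly_ring X Quot I))"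

definition h_polynomial :: "nat set \<Rightarrow> ('k::field) mpoly set \<Rightarrow> rat poly" where
  "h_polynomial X I =
     (THE h. hilbert_series X I = fps_of_poly h / (1 - fps_X) ^ quot_dim X I)"

definition a_invariant :: "nat set \<Rightarrow> ('k::field) mpoly set \<Rightarrow> int" where
  "a_invariant X I = int (Polynomial.degree (h_polynomial X I)) - int (quot_dim X I)"

definition hilbert_polynomial :: "nat set \<Rightarrow> ('k::field) mpoly set \<Rightarrow> rat poly" where
  "hilbert_polynomial X I =
     (THE p. \<forall>\<^sub>F t in sequentially. poly p (of_nat t) = of_nat (hilbert_function X I t))"

end

theory Submission
  imports Defs "HOL-Library.Product_Lexorder"
begin

text \<open>
  A geometric vertex decomposition says that the leading coefficient ideals
  \<open>L\<^sub>i\<close> of \<open>I\<close> with respect to \<open>y\<close> are \<open>L\<^sub>0 = N\<close> and \<open>L\<^sub>i = C\<close> for \<open>i \<ge> 1\<close> (after contraction), so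
  the Hilbert series satisfy \<open>(1 - x) H(I) = (1 - x) H(N) + x H(C)\<close>. By induction
  \<open>H(I) (1 - x)\<^sup>u\<close> is a polynomial of degree at most \<open>u\<close> for the size \<open>u\<close> of some set \<open>U\<close> of variables with
  \<open>I \<inter> \<bbbK>[U] = 0\<close>. To get the bound for the \<open>a\<close>-invariant it then suffices that \<open>u\<close> is at most the Krull
  dimension. A graded ideal containing \<open>I\<close> and maximal with respect to \<open>P \<inter> \<bbbK>[U] = 0\<close> is prime, and
  comparing the growth of Hilbert functions shows that \<open>P + \<langle>x\<^sub>j\<rangle>\<close> with \<open>j \<in> U\<close> still avoids the polynomials
  in some \<open>u - 1\<close> variables; iterating this yields a chain of \<open>u + 1\<close> primes. The Krull dimension is finite
  because a strict chain of primes produces algebraically independent elements.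
\<close>

section \<open>Polynomials\<close>

text \<open>The a-invariant refers to the Krull dimension d, which is awkward to follow through a
  decomposition. Any u at most d serves as well: passing from the denominator (1 - x)^u to (1 - x)^d
  multiplies the numerator by (1 - x)^(d - u), so degree at most u becomes degree at most d. Hence d
  only has to be bounded below and known to be finite. The set U follows the recursion: the set for
  N is kept, the set for C is enlarged by y, and the larger of the two is taken.

  Hilbert functions are treated as numbers of standard monomials. The number does not depend on the
  weight that selects leading monomials, so each estimate can choose the weight that makes it
  visible.

  That the degree may equal u, and is not always smaller, explains the range t >= 1 for the equality
  of Hilbert function and Hilbert polynomial: the top coefficient of the numerator can be removed at
  the cost of a constant, which changes the series only at t = 0.\<close>

abbreviation "keys \<equiv> Poly_Mapping.keys"
abbreviation "lookup \<equiv> Poly_Mapping.lookup"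

text \<open>The argument may be \<open>monomials X\<close> (the whole ring),
  \<open>hmons X t\<close> (a graded piece) or any other set of monomials, so one notion serves for
  subrings and for subspaces.\<close>

definition supported :: "monom set \<Rightarrow> ('k::field) mpoly set" where
  "supported M = {f. keys f \<subseteq> M}"

lemma carrier_poly_ring: "carrier (poly_ring X) = supported (monomials X)"
  by (simp add: poly_ring_def supported_def)

lemma poly_ring_simps [simp]:
  "x \<otimes>\<^bsub>poly_ring X\<^esub> y = x * y" "x \<oplus>\<^bsub>poly_ring X\<^esub> y = x + y"
  "\<zero>\<^bsub>poly_ring X\<^esub> = 0" "\<one>\<^bsub>poly_ring X\<^esub> = 1"
  by (simp_all add: poly_ring_def)

lemma supported_zero [simp]: "0 \<in> supported M"
  by (simp add: supported_def)

lemma supported_add: "f \<in> supported M \<Longrightarrow> g \<in> supported M \<Longrightarrow> f + g \<in> supported M"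
  using Poly_Mapping.keys_add[of f g] by (auto simp: supported_def)

lemma keys_uminus [simp]: "keys (- f) = keys (f :: 'a \<Rightarrow>\<^sub>0 'b::ab_group_add)"
  by (auto simp: in_keys_iff)

lemma supported_uminus: "f \<in> supported M \<Longrightarrow> - f \<in> supported M"
  by (simp add: supported_def)

lemma supported_minus: "f \<in> supported M \<Longrightarrow> g \<in> supported M \<Longrightarrow> f - g \<in> supported M"
  using supported_add[of f M "- g"] supported_uminus by fastforce

lemma supported_sum: "(\<And>a. a \<in> A \<Longrightarrow> f a \<in> supported M) \<Longrightarrow> sum f A \<in> supported M"
  by (induction A rule: infinite_finite_induct) (auto intro: supported_add)

lemma supported_mono: "f \<in> supported M \<Longrightarrow> M \<subseteq> M' \<Longrightarrow> f \<in> supported M'"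
  by (auto simp: supported_def)

lemma supported_single: "m \<in> M \<Longrightarrow> Poly_Mapping.single m c \<in> supported M"
  by (simp add: supported_def)

lemma keys_plus_monom: "keys (a + b :: monom) = keys a \<union> keys b"
  by (auto simp: in_keys_iff lookup_add)

lemma monomials_add [simp]: "a + b \<in> monomials X \<longleftrightarrow> a \<in> monomials X \<and> b \<in> monomials X"
  by (auto simp: monomials_def keys_plus_monom)

lemma monomials_zero [simp]: "0 \<in> monomials X"
  by (simp add: monomials_def)

lemma monomials_mono: "X \<subseteq> Y \<Longrightarrow> monomials X \<subseteq> monomials Y"
  by (auto simp: monomials_def)

lemma monomials_single: "x \<in> X \<Longrightarrow> Poly_Mapping.single x n \<in> monomials X"
  by (simp add: monomials_def)

lemma supported_mult:
  "f \<in> supported (monomials X) \<Longrightarrow> g \<in> supported (monomials X) \<Longrightarrow> f * g \<in> supported (monomials X)"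
  using Poly_Mapping.keys_mult[of f g] by (auto simp: supported_def subset_iff)

lemma supported_one [simp]: "1 \<in> supported (monomials X)"
  by (simp add: supported_def)

lemma supported_power: "f \<in> supported (monomials X) \<Longrightarrow> f ^ n \<in> supported (monomials X)"
  by (induction n) (auto intro: supported_mult)

lemma supported_const [simp]: "const c \<in> supported (monomials X)"
  by (simp add: const_def supported_def)

lemma supported_var: "x \<in> X \<Longrightarrow> var x \<in> supported (monomials X)"
  by (simp add: var_def supported_def monomials_def)

section \<open>Divisibility and degree of monomials, multiplication by a single term\<close>

lemma monom_le_iff: "(\<forall>i. lookup p i \<le> lookup m i) \<longleftrightarrow> (\<exists>q. m = p + (q :: monom))"
proof
  assume "\<forall>i. lookup p i \<le> lookup m i"
  then have "m = p + (m - p)"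
    by (intro poly_mapping_eqI) (simp add: lookup_add lookup_minus)
  then show "\<exists>q. m = p + q" by blast
qed (auto simp: lookup_add)

lemma monom_degree_eq_sum:
  "finite A \<Longrightarrow> keys m \<subseteq> A \<Longrightarrow> monom_degree m = (\<Sum>i\<in>A. lookup m i)"
  unfolding monom_degree_def by (rule sum.mono_neutral_left) (auto simp: in_keys_iff)

lemma monom_degree_add [simp]: "monom_degree (a + b) = monom_degree a + monom_degree b"
proof -
  let ?A = "keys a \<union> keys b"
  have "monom_degree (a + b) = (\<Sum>i\<in>?A. lookup (a + b) i)"
    by (rule monom_degree_eq_sum) (auto simp: keys_plus_monom)
  also have "\<dots> = (\<Sum>i\<in>?A. lookup a i) + (\<Sum>i\<in>?A. lookup b i)"
    by (simp add: lookup_add sum.distrib)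
  also have "(\<Sum>i\<in>?A. lookup a i) = monom_degree a"
    by (rule monom_degree_eq_sum[symmetric]) auto
  also have "(\<Sum>i\<in>?A. lookup b i) = monom_degree b"
    by (rule monom_degree_eq_sum[symmetric]) auto
  finally show ?thesis .
qed

lemma monom_degree_zero [simp]: "monom_degree 0 = 0"
  by (simp add: monom_degree_def)

lemma monom_degree_single [simp]: "monom_degree (Poly_Mapping.single x n) = n"
  by (simp add: monom_degree_def)

text \<open>Split off the term of \<open>f\<close> at \<open>q\<close>. The remainder has no key
  \<open>q\<close>, and since monomials cancel, its product with the single term cannot have the key
  \<open>m + q\<close>.\<close>

lemma lookup_single_times_add [simp]:
  "lookup (Poly_Mapping.single m c * f) (m + q) = c * lookup (f :: ('k::field) mpoly) q"
proof -
  have "f = Poly_Mapping.single q (lookup f q) + (f - Poly_Mapping.single q (lookup f q))"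
    by simp
  then have "lookup (Poly_Mapping.single m c * f) (m + q) =
     lookup (Poly_Mapping.single m c * Poly_Mapping.single q (lookup f q)) (m + q) +
     lookup (Poly_Mapping.single m c * (f - Poly_Mapping.single q (lookup f q))) (m + q)"
    by (metis distrib_left lookup_add)
  moreover have "lookup (Poly_Mapping.single m c * (f - Poly_Mapping.single q (lookup f q))) (m + q) = 0"
  proof (rule ccontr)
    let ?g = "f - Poly_Mapping.single q (lookup f q)"
    assume "lookup (Poly_Mapping.single m c * ?g) (m + q) \<noteq> 0"
    then have "m + q \<in> keys (Poly_Mapping.single m c * ?g)" by (simp add: in_keys_iff)
    then obtain a b where "m + q = a + b" "a \<in> keys (Poly_Mapping.single m c)" "b \<in> keys ?g"
      using Poly_Mapping.keys_mult by blast
    then have "q \<in> keys ?g" by (auto split: if_splits)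
    then show False by (simp add: in_keys_iff lookup_minus)
  qed
  ultimately show ?thesis by (simp add: mult_single)
qed

lemma lookup_single_times_eq_0:
  assumes "\<And>q. p \<noteq> m + q"
  shows "lookup (Poly_Mapping.single m c * (f :: ('k::field) mpoly)) p = 0"
proof (rule ccontr)
  assume "lookup (Poly_Mapping.single m c * f) p \<noteq> 0"
  then have "p \<in> keys (Poly_Mapping.single m c * f)" by (simp add: in_keys_iff)
  then show False
    using Poly_Mapping.keys_mult[of "Poly_Mapping.single m c" f] assms by (auto split: if_splits)
qed

lemma keys_single_times:
  "c \<noteq> 0 \<Longrightarrow> keys (Poly_Mapping.single m c * (f :: ('k::field) mpoly)) = (+) m ` keys f"
proof -
  assume c: "c \<noteq> 0"
  show ?thesis
  proof (intro equalityI subsetI)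
    fix p assume p: "p \<in> keys (Poly_Mapping.single m c * f)"
    then obtain q where "p = m + q"
      using lookup_single_times_eq_0 by (metis in_keys_iff)
    with p show "p \<in> (+) m ` keys f" by (auto simp: in_keys_iff)
  qed (use c in \<open>auto simp: in_keys_iff\<close>)
qed

lemma sum_single_keys:
  "(\<Sum>m\<in>keys f. Poly_Mapping.single m (lookup f m)) = (f :: 'a \<Rightarrow>\<^sub>0 'b::comm_monoid_add)"
proof (rule poly_mapping_eqI)
  fix p
  show "lookup (\<Sum>m\<in>keys f. Poly_Mapping.single m (lookup f m)) p = lookup f p"
    by (cases "p \<in> keys f") (auto simp: lookup_sum lookup_single when_def in_keys_iff)
qed

lemma sum_single_superset:
  assumes "finite M" "keys f \<subseteq> M"
  shows "(\<Sum>m\<in>M. Poly_Mapping.single m (lookup f m)) = (f :: 'a \<Rightarrow>\<^sub>0 'b::comm_monoid_add)"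
proof -
  have "(\<Sum>m\<in>M. Poly_Mapping.single m (lookup f m)) = (\<Sum>m\<in>keys f. Poly_Mapping.single m (lookup f m))"
    by (rule sum.mono_neutral_right) (use assms in \<open>auto simp: in_keys_iff\<close>)
  then show ?thesis by (simp add: sum_single_keys)
qed

lemma single_eq_const_times: "Poly_Mapping.single m c = const c * Poly_Mapping.single m (1::'k::field)"
  by (simp add: const_def mult_single)

lemma lookup_const_times [simp]: "lookup (const c * f) m = c * lookup (f :: ('k::field) mpoly) m"
  using lookup_single_times_add[of 0 c f m] by (simp add: const_def)

lemma keys_const_times: "c \<noteq> 0 \<Longrightarrow> keys (const c * f) = keys (f :: ('k::field) mpoly)"
  by (auto simp: in_keys_iff)

lemma const_add: "const (a + b) = const a + const b"
  by (simp add: const_def single_add)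

lemma const_mult: "const (a * b) = const a * const b"
  by (simp add: const_def mult_single)

lemma const_one [simp]: "const 1 = 1"
  by (simp add: const_def)

lemma const_zero [simp]: "const 0 = 0"
  by (simp add: const_def)

lemma const_uminus: "const (- a) = - const a"
  by (simp add: const_def single_uminus)

section \<open>Restriction of a polynomial to the terms that satisfy a condition\<close>

lift_definition restrict_terms :: "('a \<Rightarrow> bool) \<Rightarrow> ('a \<Rightarrow>\<^sub>0 'b::zero) \<Rightarrow> ('a \<Rightarrow>\<^sub>0 'b)"
  is "\<lambda>P f m. if P m then f m else 0"
  by (erule finite_subset[rotated]) auto

lemma lookup_restrict_terms [simp]: "lookup (restrict_terms P f) m = (if P m then lookup f m else 0)"
  by transfer simp

lemma keys_restrict_terms [simp]: "keys (restrict_terms P f) = {m \<in> keys f. P m}"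
  by (auto simp: in_keys_iff split: if_splits)

lemma restrict_terms_zero [simp]: "restrict_terms P 0 = 0"
  by (rule poly_mapping_eqI) simp

lemma restrict_terms_add:
  "restrict_terms P (f + g) = restrict_terms P f + restrict_terms P (g :: 'a \<Rightarrow>\<^sub>0 'b::monoid_add)"
  by (rule poly_mapping_eqI) (simp add: lookup_add)

lemma restrict_terms_single_times:
  "restrict_terms P (Poly_Mapping.single m c * f) =
    Poly_Mapping.single m c * restrict_terms (\<lambda>q. P (m + q)) (f :: ('k::field) mpoly)"
proof (rule poly_mapping_eqI)
  fix p
  show "lookup (restrict_terms P (Poly_Mapping.single m c * f)) p =
      lookup (Poly_Mapping.single m c * restrict_terms (\<lambda>q. P (m + q)) f) p"
  proof (cases "\<exists>q. p = m + q")
    case True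
    then show ?thesis by auto
  next
    case False
    then show ?thesis by (simp add: lookup_single_times_eq_0)
  qed
qed

lemma restrict_terms_id: "(\<And>m. m \<in> keys f \<Longrightarrow> P m) \<Longrightarrow> restrict_terms P f = f"
  by (rule poly_mapping_eqI) (auto simp: in_keys_iff)

lemma restrict_terms_eq_0: "(\<And>m. m \<in> keys f \<Longrightarrow> \<not> P m) \<Longrightarrow> restrict_terms P f = 0"
  by (rule poly_mapping_eqI) (auto simp: in_keys_iff)

section \<open>Ideals\<close>

text \<open>Restates \<open>ideal I (poly_ring X)\<close> in the operations of the type itself,
  which keeps the ring record out of the computations; see
  \<open>ideal_iff_poly_ideal\<close>.\<close>

definition poly_ideal :: "nat set \<Rightarrow> ('k::field) mpoly set \<Rightarrow> bool" where
  "poly_ideal X I \<longleftrightarrow> I \<subseteq> supported (monomials X) \<and> 0 \<in> I \<and> (\<forall>f\<in>I. \<forall>g\<in>I. f + g \<in> I) \<and>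
     (\<forall>f\<in>I. \<forall>g\<in>supported (monomials X). g * f \<in> I)"

lemma poly_idealI:
  assumes "I \<subseteq> supported (monomials X)" "0 \<in> I" "\<And>f g. f \<in> I \<Longrightarrow> g \<in> I \<Longrightarrow> f + g \<in> I"
    "\<And>f g. f \<in> I \<Longrightarrow> g \<in> supported (monomials X) \<Longrightarrow> g * f \<in> I"
  shows "poly_ideal X I"
  using assms by (auto simp: poly_ideal_def)

lemma poly_idealD:
  assumes "poly_ideal X I"
  shows "I \<subseteq> supported (monomials X)" "f \<in> I \<Longrightarrow> f \<in> supported (monomials X)" "0 \<in> I"
    "f \<in> I \<Longrightarrow> g \<in> I \<Longrightarrow> f + g \<in> I"
    "f \<in> I \<Longrightarrow> g \<in> supported (monomials X) \<Longrightarrow> g * f \<in> I"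
    "f \<in> I \<Longrightarrow> g \<in> supported (monomials X) \<Longrightarrow> f * g \<in> I"
  using assms by (auto simp: poly_ideal_def mult.commute)

lemma poly_ideal_sum:
  "poly_ideal X I \<Longrightarrow> (\<And>a. a \<in> A \<Longrightarrow> f a \<in> I) \<Longrightarrow> sum f A \<in> I"
  by (induction A rule: infinite_finite_induct) (auto intro: poly_idealD)

lemma poly_ideal_const: "poly_ideal X I \<Longrightarrow> f \<in> I \<Longrightarrow> const c * f \<in> I"
  by (simp add: poly_idealD)

lemma poly_ideal_uminus: "poly_ideal X I \<Longrightarrow> f \<in> I \<Longrightarrow> - f \<in> I"
  using poly_ideal_const[of X I f "-1"] by (simp add: const_uminus)

lemma poly_ideal_minus: "poly_ideal X I \<Longrightarrow> f \<in> I \<Longrightarrow> g \<in> I \<Longrightarrow> f - g \<in> I"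
  using poly_idealD(4)[of X I f "- g"] poly_ideal_uminus by fastforce

lemma poly_ideal_minus_iff: "poly_ideal X I \<Longrightarrow> f - g \<in> I \<Longrightarrow> f \<in> I \<longleftrightarrow> g \<in> I"
  using poly_idealD(4)[of X I "f - g" g] poly_ideal_minus[of X I f "f - g"] by auto

text \<open>A polynomial is a sum of terms, so closure under multiplication by single terms is
  enough. Formulas such as \<open>y_coeff_single_times\<close> and \<open>hcomp_single_times\<close>
  concern exactly such products.\<close>

lemma poly_ideal_monomI:
  fixes I :: "('k::field) mpoly set"
  assumes "I \<subseteq> supported (monomials X)" "0 \<in> I" "\<And>f g. f \<in> I \<Longrightarrow> g \<in> I \<Longrightarrow> f + g \<in> I"
    "\<And>f m c. f \<in> I \<Longrightarrow> m \<in> monomials X \<Longrightarrow> Poly_Mapping.single m c * f \<in> I"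
  shows "poly_ideal X I"
proof (rule poly_idealI)
  fix f g :: "'k mpoly" assume f: "f \<in> I" and g: "g \<in> supported (monomials X)"
  have "(\<Sum>m\<in>A. Poly_Mapping.single m (lookup g m) * f) \<in> I" if "A \<subseteq> keys g" for A
  proof -
    have "finite A" using that finite_subset by fastforce
    then show ?thesis using that
    proof induction
      case (insert m A)
      then have "m \<in> monomials X" using g by (auto simp: supported_def)
      then show ?case using insert assms(3,4) f by simp
    qed (simp add: assms(2))
  qed
  from this[of "keys g"] have "(\<Sum>m\<in>keys g. Poly_Mapping.single m (lookup g m)) * f \<in> I"
    by (simp add: sum_distrib_right)
  then show "g * f \<in> I" by (simp add: sum_single_keys)
qed (use assms in auto)

lemma poly_ideal_one_iff: "poly_ideal X I \<Longrightarrow> 1 \<in> I \<longleftrightarrow> I = supported (monomials X)"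
  using poly_idealD(1)[of X I] poly_idealD(5)[of X I 1] by auto

lemma poly_ideal_const_mem: "poly_ideal X I \<Longrightarrow> const c \<in> I \<Longrightarrow> c \<noteq> 0 \<Longrightarrow> 1 \<in> I"
  using poly_ideal_const[of X I "const c" "inverse c"] by (simp add: const_mult[symmetric])

lemma ideal_iff_poly_ideal: "ideal I (poly_ring X) \<longleftrightarrow> poly_ideal X I"
proof
  assume "ideal I (poly_ring X)"
  then interpret ideal I "poly_ring X" .
  show "poly_ideal X I"
    using a_subset a_closed I_l_closed additive_subgroup.zero_closed[OF is_additive_subgroup]
      additive_subgroup.a_closed[OF is_additive_subgroup]
    by (intro poly_idealI) (auto simp: carrier_poly_ring)
next
  assume I: "poly_ideal X I"
  interpret R: cring "poly_ring X" by (rule poly_ring_cring)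
  have inv: "\<ominus>\<^bsub>poly_ring X\<^esub> f = - f" if "f \<in> I" for f
  proof (rule R.minus_equality)
    show "f \<in> carrier (poly_ring X)" using that poly_idealD(2)[OF I] by (simp add: carrier_poly_ring)
    then show "- f \<in> carrier (poly_ring X)" by (simp add: carrier_poly_ring supported_uminus)
  qed simp
  show "ideal I (poly_ring X)"
  proof (rule idealI)
    show "ring (poly_ring X)" by unfold_locales
    show "subgroup I (add_monoid (poly_ring X))"
    proof (rule R.add.subgroupI)
      show "\<ominus>\<^bsub>poly_ring X\<^esub> a \<in> I" if "a \<in> I" for a
        using inv[OF that] poly_ideal_uminus[OF I that] by simp
    qed (use poly_idealD[OF I] in \<open>auto simp: carrier_poly_ring\<close>)
  qed (use poly_idealD[OF I] in \<open>auto simp: carrier_poly_ring\<close>)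
qed

text \<open>The third claim is how upper bounds are obtained: to control every element of a
  generated ideal, exhibit an ideal that contains the generators.\<close>

lemma genideal_poly_ideal:
  assumes "S \<subseteq> supported (monomials X)"
  shows "poly_ideal X (Idl\<^bsub>poly_ring X\<^esub> S)" "S \<subseteq> Idl\<^bsub>poly_ring X\<^esub> S"
    "\<And>J. poly_ideal X J \<Longrightarrow> S \<subseteq> J \<Longrightarrow> Idl\<^bsub>poly_ring X\<^esub> S \<subseteq> J"
proof -
  interpret R: cring "poly_ring X" by (rule poly_ring_cring)
  show "poly_ideal X (Idl\<^bsub>poly_ring X\<^esub> S)"
    using R.genideal_ideal assms by (simp add: ideal_iff_poly_ideal[symmetric] carrier_poly_ring)
  show "S \<subseteq> Idl\<^bsub>poly_ring X\<^esub> S"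
    using R.genideal_self assms by (simp add: carrier_poly_ring)
  show "Idl\<^bsub>poly_ring X\<^esub> S \<subseteq> J" if "poly_ideal X J" "S \<subseteq> J" for J
    using R.genideal_minimal that by (simp add: ideal_iff_poly_ideal)
qed

lemma sum_of_ideals_eq: "A <+>\<^bsub>poly_ring X\<^esub> B = {f + g | f g. f \<in> A \<and> g \<in> B}"
  by (auto simp: set_add_def set_mult_def poly_ring_def)

section \<open>Standard monomials\<close>

definition hmons :: "nat set \<Rightarrow> nat \<Rightarrow> monom set" where
  "hmons X t = {m \<in> monomials X. monom_degree m = t}"

lemma graded_part_eq: "graded_part X t = supported (hmons X t)"
  by (auto simp: graded_part_def carrier_poly_ring supported_def hmons_def)

text \<open>Monomials with prescribed exponent bounds are counted as a box of functions. Such boxes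
  give finiteness and both the upper and the lower estimates for Hilbert functions.\<close>

lemma bounded_monomials_bij:
  "bij_betw (\<lambda>m. restrict (lookup m) X) {m \<in> monomials X. \<forall>i\<in>X. lookup m i \<le> b i} (\<Pi>\<^sub>E i\<in>X. {..b i})"
  if "finite X" for b :: "nat \<Rightarrow> nat"
proof (rule bij_betwI')
  fix m m' assume mm: "m \<in> {m \<in> monomials X. \<forall>i\<in>X. lookup m i \<le> b i}" "m' \<in> {m \<in> monomials X. \<forall>i\<in>X. lookup m i \<le> b i}"
  show "restrict (lookup m) X = restrict (lookup m') X \<longleftrightarrow> m = m'"
  proof
    assume eq: "restrict (lookup m) X = restrict (lookup m') X"
    show "m = m'"
    proof (rule poly_mapping_eqI)
      fix i
      show "lookup m i = lookup m' i"
      proof (cases "i \<in> X")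
        case True
        then show ?thesis using eq by (metis restrict_apply)
      next
        case False
        then have "i \<notin> keys m" "i \<notin> keys m'" using mm by (auto simp: monomials_def)
        then show ?thesis by (simp add: in_keys_iff)
      qed
    qed
  qed simp
next
  fix m assume "m \<in> {m \<in> monomials X. \<forall>i\<in>X. lookup m i \<le> b i}"
  then show "restrict (lookup m) X \<in> (\<Pi>\<^sub>E i\<in>X. {..b i})" by auto
next
  fix g assume g: "g \<in> (\<Pi>\<^sub>E i\<in>X. {..b i})"
  define m where "m = Poly_Mapping.Abs_poly_mapping (\<lambda>i. if i \<in> X then g i else 0)"
  have l: "lookup m = (\<lambda>i. if i \<in> X then g i else 0)"
    unfolding m_def by (rule lookup_Abs_poly_mapping, rule finite_subset[OF _ that]) auto
  show "\<exists>m\<in>{m \<in> monomials X. \<forall>i\<in>X. lookup m i \<le> b i}. g = restrict (lookup m) X"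
  proof (rule bexI[of _ m])
    show "g = restrict (lookup m) X" using g by (auto simp: l fun_eq_iff PiE_def extensional_def)
    show "m \<in> {m \<in> monomials X. \<forall>i\<in>X. lookup m i \<le> b i}"
      using g by (auto simp: monomials_def in_keys_iff l split: if_splits)
  qed
qed

lemma bounded_monomials_card:
  assumes "finite X"
  shows "card {m \<in> monomials X. \<forall>i\<in>X. lookup m i \<le> b i} = (\<Prod>i\<in>X. Suc (b i))"
    "finite {m \<in> monomials X. \<forall>i\<in>X. lookup m i \<le> b i}"
proof -
  show "card {m \<in> monomials X. \<forall>i\<in>X. lookup m i \<le> b i} = (\<Prod>i\<in>X. Suc (b i))"
    using bij_betw_same_card[OF bounded_monomials_bij[OF assms]] by (simp add: card_PiE assms)
  show "finite {m \<in> monomials X. \<forall>i\<in>X. lookup m i \<le> b i}"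
    using bij_betw_finite[OF bounded_monomials_bij[OF assms]] by (simp add: finite_PiE assms)
qed

lemma lookup_le_monom_degree: "lookup m i \<le> monom_degree m"
proof (cases "i \<in> keys m")
  case True
  then show ?thesis unfolding monom_degree_def by (intro member_le_sum) auto
qed (simp add: in_keys_iff)

lemma finite_hmons [simp]: "finite X \<Longrightarrow> finite (hmons X t)"
  by (rule finite_subset[OF _ bounded_monomials_card(2)[of X "\<lambda>_. t"]])
    (auto simp: hmons_def lookup_le_monom_degree)

text \<open>
  Leading monomials with respect to the weight \<open>w\<close>, with ties broken by the linear order of
  \<^typ>\<open>monom\<close>. Only finite sets of monomials are compared, so \<open>w\<close> may be negative. The weights
  used are the exponent of \<open>y\<close>, minus the exponent of a variable, and the degree in a set of variables.
\<close>

definition leads :: "(monom \<Rightarrow> int) \<Rightarrow> ('k::field) mpoly set \<Rightarrow> monom set" where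
  "leads w V = {m. \<exists>f\<in>V. m \<in> keys f \<and> (\<forall>m'\<in>keys f. (w m', m') \<le> (w m, m))}"

lemma leading_key_exists:
  fixes f :: "('k::field) mpoly"
  assumes "f \<noteq> 0"
  shows "\<exists>m\<in>keys f. \<forall>m'\<in>keys f. (w m' :: int, m') \<le> (w m, m)"
proof -
  let ?K = "(\<lambda>m. (w m, m)) ` keys f"
  have "keys f \<noteq> {}" using assms by simp
  then have "Max ?K \<in> ?K" by (intro Max_in) auto
  then obtain m where m: "m \<in> keys f" "Max ?K = (w m, m)" by auto
  then have "\<forall>m'\<in>keys f. (w m', m') \<le> (w m, m)"
    by (metis (mono_tags, lifting) Max_ge finite_imageI finite_keys imageI)
  then show ?thesis using m by blast
qed

lemma standard_monomials_independent:
  assumes "f \<in> V" "f \<in> supported (M - leads w V)"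
  shows "f = 0"
proof (rule ccontr)
  assume "f \<noteq> 0"
  then obtain m where "m \<in> keys f" "\<forall>m'\<in>keys f. (w m', m') \<le> (w m, m)"
    using leading_key_exists by blast
  then show False using assms by (auto simp: leads_def supported_def)
qed

text \<open>Cancel the leading term with an element of \<open>V\<close> and recurse on the remaining
  terms. The order by \<open>(w m, m)\<close> need not be well-founded on all monomials, so the
  induction counts the smaller monomials inside the finite set \<open>M\<close>.\<close>

lemma single_reduces_to_standard:
  assumes V: "V \<subseteq> supported M" "0 \<in> V" "\<And>f g. f \<in> V \<Longrightarrow> g \<in> V \<Longrightarrow> f + g \<in> V"
      "\<And>c f. f \<in> V \<Longrightarrow> const c * f \<in> V" and M: "finite M"
  shows "m \<in> M \<Longrightarrow> \<exists>g\<in>supported (M - leads w V). Poly_Mapping.single m (1::'k::field) - g \<in> V"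
proof (induction "card {p \<in> M. (w p, p) < (w m, m)}" arbitrary: m rule: less_induct)
  case less
  show ?case
  proof (cases "m \<in> leads w V")
    case False
    then show ?thesis
      using less.prems V(2) by (intro bexI[of _ "Poly_Mapping.single m 1"]) (auto intro: supported_single)
  next
    case True
    then obtain f where f: "f \<in> V" "m \<in> keys f" and fm: "\<And>m'. m' \<in> keys f \<Longrightarrow> (w m', m') \<le> (w m, m)"
      by (auto simp: leads_def)
    let ?c = "lookup f m"
    have c: "?c \<noteq> 0" using f by (simp add: in_keys_iff)
    define h where "h = Poly_Mapping.single m 1 - const (inverse ?c) * f"
    have h: "p \<in> M \<and> (w p, p) < (w m, m)" if "p \<in> keys h" for p
    proof -
      have "p \<noteq> m" using that c by (auto simp: in_keys_iff h_def lookup_minus)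
      then have "p \<in> keys f" using that
        by (auto simp: in_keys_iff h_def lookup_minus lookup_single when_def)
      then have "p \<in> M" using f(1) V(1) unfolding supported_def by blast
      moreover have "(w p, p) \<noteq> (w m, m)" using \<open>p \<noteq> m\<close> by blast
      ultimately show ?thesis using fm[OF \<open>p \<in> keys f\<close>] order_le_neq_trans by blast
    qed
    have "\<exists>g\<in>supported (M - leads w V). Poly_Mapping.single p (1::'k) - g \<in> V" if "p \<in> keys h" for p
    proof (rule less.hyps)
      show "card {pa \<in> M. (w pa, pa) < (w p, p)} < card {p \<in> M. (w p, p) < (w m, m)}"
      proof (rule psubset_card_mono)
        have "p \<in> {p \<in> M. (w p, p) < (w m, m)}" "p \<notin> {pa \<in> M. (w pa, pa) < (w p, p)}"
          using h[OF that] by blast+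
        moreover have "{pa \<in> M. (w pa, pa) < (w p, p)} \<subseteq> {p \<in> M. (w p, p) < (w m, m)}"
          using order_less_trans[OF _ conjunct2[OF h[OF that]]] by blast
        ultimately show "{pa \<in> M. (w pa, pa) < (w p, p)} \<subset> {p \<in> M. (w p, p) < (w m, m)}"
          by blast
      qed (use M in simp)
    qed (use h[OF that] in blast)
    then have "\<forall>p\<in>keys h. \<exists>g. g \<in> supported (M - leads w V) \<and> Poly_Mapping.single p (1::'k) - g \<in> V" by blast
    from bchoice[OF this] obtain g where g: "\<And>p. p \<in> keys h \<Longrightarrow> g p \<in> supported (M - leads w V)"
        "\<And>p. p \<in> keys h \<Longrightarrow> Poly_Mapping.single p (1::'k) - g p \<in> V" by blast
    let ?g = "\<Sum>p\<in>keys h. const (lookup h p) * g p"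
    have sumV: "(\<Sum>p\<in>A. k p) \<in> V" if "\<And>p. p \<in> A \<Longrightarrow> k p \<in> V" for A and k :: "monom \<Rightarrow> 'k mpoly"
      using that by (induction A rule: infinite_finite_induct) (auto simp: V)
    have "h - ?g = (\<Sum>p\<in>keys h. const (lookup h p) * (Poly_Mapping.single p (1::'k) - g p))"
      by (simp add: right_diff_distrib sum_subtractf single_eq_const_times[symmetric] sum_single_keys)
    also have "\<dots> \<in> V" by (intro sumV V(4) g(2))
    finally have "h - ?g + const (inverse ?c) * f \<in> V" using f by (intro V(3) V(4))
    then have "Poly_Mapping.single m 1 - ?g \<in> V" by (simp add: h_def)
    moreover have "?g \<in> supported (M - leads w V)"
    proof (rule supported_sum)
      fix p assume "p \<in> keys h"
      then show "const (lookup h p) * g p \<in> supported (M - leads w V)"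
        using g(1)[of p] by (auto simp: supported_def keys_const_times in_keys_iff)
    qed
    ultimately show ?thesis by blast
  qed
qed

lemma reduces_to_standard:
  assumes V: "V \<subseteq> supported M" "0 \<in> V" "\<And>f g. f \<in> V \<Longrightarrow> g \<in> V \<Longrightarrow> f + g \<in> V"
      "\<And>c f. f \<in> V \<Longrightarrow> const c * f \<in> V" and M: "finite M" and f: "f \<in> supported M"
  shows "\<exists>g\<in>supported (M - leads w V). (f :: ('k::field) mpoly) - g \<in> V"
proof -
  have "\<exists>g\<in>supported (M - leads w V). Poly_Mapping.single p (1::'k) - g \<in> V" if "p \<in> keys f" for p
    using single_reduces_to_standard[OF assms(1-5)] that f by (auto simp: supported_def)
  then have "\<forall>p\<in>keys f. \<exists>g. g \<in> supported (M - leads w V) \<and> Poly_Mapping.single p (1::'k) - g \<in> V" by blast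
  from bchoice[OF this] obtain g where g: "\<And>p. p \<in> keys f \<Longrightarrow> g p \<in> supported (M - leads w V)"
      "\<And>p. p \<in> keys f \<Longrightarrow> Poly_Mapping.single p (1::'k) - g p \<in> V" by blast
  let ?g = "\<Sum>p\<in>keys f. const (lookup f p) * g p"
  have sumV: "(\<Sum>p\<in>A. k p) \<in> V" if "\<And>p. p \<in> A \<Longrightarrow> k p \<in> V" for A and k :: "monom \<Rightarrow> 'k mpoly"
    using that by (induction A rule: infinite_finite_induct) (auto simp: V)
  have "f - ?g = (\<Sum>p\<in>keys f. const (lookup f p) * (Poly_Mapping.single p (1::'k) - g p))"
    by (simp add: right_diff_distrib sum_subtractf single_eq_const_times[symmetric] sum_single_keys)
  also have "\<dots> \<in> V" by (intro sumV V(4) g(2))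
  finally have "f - ?g \<in> V" .
  moreover have "?g \<in> supported (M - leads w V)"
  proof (rule supported_sum)
    fix p assume "p \<in> keys f"
    then show "const (lookup f p) * g p \<in> supported (M - leads w V)"
      using g(1)[of p] by (auto simp: supported_def keys_const_times in_keys_iff)
  qed
  ultimately show ?thesis by blast
qed

text \<open>For a graded part of a proper ideal these monomials represent a basis of the degree
  \<open>t\<close> part of the quotient. Each degree is treated on its own, so only finitely many
  monomials are ever compared.\<close>

definition std_monomials :: "(monom \<Rightarrow> int) \<Rightarrow> nat set \<Rightarrow> ('k::field) mpoly set \<Rightarrow> nat \<Rightarrow> monom set" where
  "std_monomials w X I t = hmons X t - leads w (I \<inter> supported (hmons X t))"

section \<open>The Hilbert function counts standard monomials\<close>

text \<open>\<open>ring.dim\<close> refers to a subfield; the image of this one in the quotient is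
  the field of scalars in \<open>hilbert_function\<close>.\<close>

lemma subfield_constants: "subfield (range const) (poly_ring X :: ('k::field) mpoly ring)"
proof -
  interpret R: cring "poly_ring X :: 'k mpoly ring" by (rule poly_ring_cring)
  have inv: "\<ominus>\<^bsub>poly_ring X\<^esub> (const c :: 'k mpoly) = const (- c)" for c
    by (rule R.minus_equality) (simp_all add: carrier_poly_ring const_add[symmetric])
  have sub: "subcring (range const) (poly_ring X :: 'k mpoly ring)"
  proof (rule R.subcringI')
    show "subring (range const) (poly_ring X :: 'k mpoly ring)"
    proof (rule R.subringI)
      show "\<one>\<^bsub>poly_ring X\<^esub> \<in> range (const :: 'k \<Rightarrow> _)"
        using const_one[symmetric] by (metis poly_ring_simps(4) rangeI)
    qed (auto simp: carrier_poly_ring inv const_add[symmetric] const_mult[symmetric])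
  qed
  show ?thesis
  proof (rule R.subfieldI[OF sub])
    show "Units (poly_ring X\<lparr>carrier := range (const :: 'k \<Rightarrow> _)\<rparr>) = range const - {\<zero>\<^bsub>poly_ring X\<^esub>}"
    proof (intro equalityI subsetI)
      fix f :: "'k mpoly" assume "f \<in> Units (poly_ring X\<lparr>carrier := range (const :: 'k \<Rightarrow> _)\<rparr>)"
      then show "f \<in> range const - {\<zero>\<^bsub>poly_ring X\<^esub>}"
        by (auto simp: Units_def)
    next
      fix f :: "'k mpoly" assume "f \<in> range const - {\<zero>\<^bsub>poly_ring X\<^esub>}"
      then obtain c where c: "f = const c" "f \<noteq> 0" by auto
      then have "c \<noteq> 0" using const_zero by blast
      then have "const (inverse c) * f = 1" "f * const (inverse c) = 1"
        using c by (simp_all add: const_mult[symmetric])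
      then show "f \<in> Units (poly_ring X\<lparr>carrier := range (const :: 'k \<Rightarrow> _)\<rparr>)"
        using c by (auto simp: Units_def)
    qed
  qed
qed

lemma coset_eq_iff:
  fixes I :: "('k::field) mpoly set"
  assumes I: "poly_ideal X I" and f: "f \<in> supported (monomials X)" and g: "g \<in> supported (monomials X)"
  shows "I +>\<^bsub>poly_ring X\<^esub> f = I +>\<^bsub>poly_ring X\<^esub> g \<longleftrightarrow> f - g \<in> I"
proof -
  interpret R: cring "poly_ring X :: 'k mpoly ring" by (rule poly_ring_cring)
  have "\<ominus>\<^bsub>poly_ring X\<^esub> g = - g"
    by (rule R.minus_equality) (use g in \<open>auto simp: carrier_poly_ring supported_uminus\<close>)
  then have "f \<ominus>\<^bsub>poly_ring X\<^esub> g = f - g" by (simp add: a_minus_def)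
  then show ?thesis
    using R.quotient_eq_iff_same_a_r_cos[OF I[folded ideal_iff_poly_ideal], of f g] f g
    by (simp add: carrier_poly_ring)
qed

text \<open>Adding one monomial to \<open>T\<close> enlarges the image by one line. Independence
  modulo \<open>I\<close> says that the new class lies outside the previous span, as
  \<open>Q.Suc_dim\<close> demands.\<close>

lemma dimension_quotient_supported:
  fixes I :: "('k::field) mpoly set"
  assumes I: "poly_ideal X I" and T: "finite T" "T \<subseteq> monomials X"
    and indep: "\<And>f. f \<in> I \<Longrightarrow> f \<in> supported T \<Longrightarrow> f = 0"
  defines "Q \<equiv> poly_ring X Quot I"
  shows "ring.dimension Q (card T) (range (\<lambda>c. I +>\<^bsub>poly_ring X\<^esub> const c))
    ((\<lambda>f. I +>\<^bsub>poly_ring X\<^esub> f) ` supported T)"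
  using T indep
proof (induction T)
  interpret R: cring "poly_ring X :: 'k mpoly ring" by (rule poly_ring_cring)
  interpret ideal I "poly_ring X" using I by (simp add: ideal_iff_poly_ideal)
  interpret Q: ring Q unfolding Q_def by (rule quotient_is_ring)
  case empty
  have "supported {} = {0 :: 'k mpoly}" by (auto simp: supported_def)
  moreover have "I +>\<^bsub>poly_ring X\<^esub> 0 = \<zero>\<^bsub>Q\<^esub>"
    using R.a_coset_add_zero[OF a_subset] by (simp add: Q_def FactRing_def)
  ultimately show ?case by simp
next
  interpret R: cring "poly_ring X :: 'k mpoly ring" by (rule poly_ring_cring)
  interpret ideal I "poly_ring X" using I by (simp add: ideal_iff_poly_ideal)
  interpret Q: ring Q unfolding Q_def by (rule quotient_is_ring)
  let ?\<pi> = "\<lambda>f. I +>\<^bsub>poly_ring X\<^esub> f"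
  let ?K = "range (\<lambda>c. ?\<pi> (const c))"
  case (insert s T)
  have S: "supported T \<subseteq> supported (monomials X)" "supported (insert s T) \<subseteq> supported (monomials X)"
    using insert.prems(1) by (auto simp: supported_def)
  have s: "Poly_Mapping.single s (1::'k) \<in> supported (monomials X)"
    using insert.prems(1) by (auto simp: supported_def)
  have hom: "?\<pi> \<in> ring_hom (poly_ring X) Q" unfolding Q_def by (rule rcos_ring_hom)
  have hadd: "?\<pi> f \<oplus>\<^bsub>Q\<^esub> ?\<pi> g = ?\<pi> (f + g)" if "f \<in> supported (monomials X)" "g \<in> supported (monomials X)" for f g
    using ring_hom_add[OF hom, of f g] that by (simp add: carrier_poly_ring)
  have hmult: "?\<pi> f \<otimes>\<^bsub>Q\<^esub> ?\<pi> g = ?\<pi> (f * g)" if "f \<in> supported (monomials X)" "g \<in> supported (monomials X)" for f g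
    using ring_hom_mult[OF hom, of f g] that by (simp add: carrier_poly_ring)
  have "?\<pi> (Poly_Mapping.single s 1) \<notin> ?\<pi> ` supported T"
  proof
    assume "?\<pi> (Poly_Mapping.single s 1) \<in> ?\<pi> ` supported T"
    then obtain g where g: "g \<in> supported T" "?\<pi> (Poly_Mapping.single s 1) = ?\<pi> g" by auto
    have "Poly_Mapping.single s 1 - g \<in> I"
      using g(2) coset_eq_iff[OF I s, of g] g(1) S by blast
    then have "Poly_Mapping.single s 1 - g = 0"
      using g by (intro insert.prems(2)) (auto intro!: supported_minus supported_single intro: supported_mono)
    then have "lookup g s = 1" by (metis eq_iff_diff_eq_0 lookup_single_eq)
    then show False using g insert.hyps by (auto simp: supported_def in_keys_iff subset_iff)
  qed
  moreover have "?\<pi> (Poly_Mapping.single s 1) \<in> carrier Q"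
    using ring_hom_closed[OF hom, of "Poly_Mapping.single s 1"] s by (simp add: carrier_poly_ring)
  moreover have "Q.dimension (card T) ?K (?\<pi> ` supported T)"
    using insert.prems by (intro insert.IH) (auto intro: supported_mono)
  ultimately have "Q.dimension (Suc (card T)) ?K
      (Q.line_extension ?K (?\<pi> (Poly_Mapping.single s 1)) (?\<pi> ` supported T))"
    by (intro Q.Suc_dim)
  moreover have "Q.line_extension ?K (?\<pi> (Poly_Mapping.single s 1)) (?\<pi> ` supported T) =
      ?\<pi> ` supported (insert s T)"
  proof (intro equalityI subsetI)
    fix x assume "x \<in> Q.line_extension ?K (?\<pi> (Poly_Mapping.single s 1)) (?\<pi> ` supported T)"
    then obtain c g where x: "g \<in> supported T" "x = (?\<pi> (const c) \<otimes>\<^bsub>Q\<^esub> ?\<pi> (Poly_Mapping.single s 1)) \<oplus>\<^bsub>Q\<^esub> ?\<pi> g"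
      by (auto simp: Q.line_extension_def set_add_def' r_coset_def)
    have m: "const c * Poly_Mapping.single s 1 \<in> supported (monomials X)" "g \<in> supported (monomials X)"
      using s S x by (auto intro: supported_mult)
    have "x = ?\<pi> (const c * Poly_Mapping.single s 1 + g)"
      using hmult[OF supported_const s, of c] hadd[OF m] x by simp
    then have "x = ?\<pi> (Poly_Mapping.single s c + g)"
      by (simp add: single_eq_const_times[symmetric])
    moreover have "Poly_Mapping.single s c + g \<in> supported (insert s T)"
      using x by (intro supported_add) (auto intro: supported_single supported_mono)
    ultimately show "x \<in> ?\<pi> ` supported (insert s T)" by blast
  next
    fix x assume "x \<in> ?\<pi> ` supported (insert s T)"
    then obtain f where f: "f \<in> supported (insert s T)" "x = ?\<pi> f" by auto
    let ?g = "f - Poly_Mapping.single s (lookup f s)"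
    have g: "?g \<in> supported T"
      using f by (auto simp: supported_def in_keys_iff lookup_minus lookup_single when_def split: if_splits)
    have "x = ?\<pi> (const (lookup f s) * Poly_Mapping.single s 1 + ?g)"
      by (simp add: f single_eq_const_times[symmetric])
    also have "\<dots> = (?\<pi> (const (lookup f s)) \<otimes>\<^bsub>Q\<^esub> ?\<pi> (Poly_Mapping.single s 1)) \<oplus>\<^bsub>Q\<^esub> ?\<pi> ?g"
      using hmult[OF supported_const s, of "lookup f s"] hadd[OF supported_mult[OF supported_const s], of ?g "lookup f s"] S g
      by auto
    also have "\<dots> \<in> Q.line_extension ?K (?\<pi> (Poly_Mapping.single s 1)) (?\<pi> ` supported T)"
      using g by (auto simp: Q.line_extension_def set_add_def' r_coset_def)
    finally show "x \<in> Q.line_extension ?K (?\<pi> (Poly_Mapping.single s 1)) (?\<pi> ` supported T)" .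
  qed
  ultimately show ?case using insert.hyps by simp
qed

text \<open>Reduction shows that the standard monomials span, the definition of leading monomials
  that they are independent. As \<open>1\<close> is not in \<open>I\<close>, the scalars remain a
  field in the quotient, and \<open>Q.dimI\<close> turns the dimension found into
  \<open>ring.dim\<close>.\<close>

lemma hilbert_function_eq_card:
  fixes I :: "('k::field) mpoly set"
  assumes I: "poly_ideal X I" and proper: "1 \<notin> I" and X: "finite X"
  shows "hilbert_function X I t = card (std_monomials w X I t)"
proof -
  let ?\<pi> = "\<lambda>f. I +>\<^bsub>poly_ring X\<^esub> f"
  let ?V = "I \<inter> supported (hmons X t)"
  interpret R: cring "poly_ring X :: 'k mpoly ring" by (rule poly_ring_cring)
  interpret ideal I "poly_ring X" using I by (simp add: ideal_iff_poly_ideal)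
  interpret Q: ring "poly_ring X Quot I" by (rule quotient_is_ring)
  interpret h: ring_hom_ring "poly_ring X" "poly_ring X Quot I" ?\<pi> by (rule rcos_ring_hom_ring)
  have ne: "\<one>\<^bsub>poly_ring X Quot I\<^esub> \<noteq> \<zero>\<^bsub>poly_ring X Quot I\<^esub>"
  proof
    assume "\<one>\<^bsub>poly_ring X Quot I\<^esub> = \<zero>\<^bsub>poly_ring X Quot I\<^esub>"
    then have "I +>\<^bsub>poly_ring X\<^esub> 1 = I" by (simp add: FactRing_def)
    moreover have "1 \<in> I +>\<^bsub>poly_ring X\<^esub> 1"
      using a_rcos_self[of 1] by (simp add: carrier_poly_ring)
    ultimately show False using proper by simp
  qed
  have K: "subfield (range (\<lambda>c. ?\<pi> (const c))) (poly_ring X Quot I)"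
    using h.img_is_subfield(2)[OF subfield_constants ne] by (simp add: image_image)
  have sub: "supported (std_monomials w X I t) \<subseteq> supported (hmons X t)"
    "supported (hmons X t) \<subseteq> supported (monomials X)"
    by (auto simp: supported_def std_monomials_def hmons_def)
  have "?\<pi> ` graded_part X t = ?\<pi> ` supported (std_monomials w X I t)"
  proof (intro equalityI subsetI)
    fix x assume "x \<in> ?\<pi> ` graded_part X t"
    then obtain f where f: "f \<in> supported (hmons X t)" "x = ?\<pi> f" by (auto simp: graded_part_eq)
    have "\<exists>g\<in>supported (hmons X t - leads w ?V). f - g \<in> ?V"
    proof (rule reduces_to_standard)
      fix c :: 'k and f assume "f \<in> ?V"
      then show "const c * f \<in> ?V"
        by (cases "c = 0") (auto simp: supported_def keys_const_times poly_ideal_const[OF I] poly_idealD[OF I])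
    qed (use f X poly_idealD[OF I] in \<open>auto intro: supported_add\<close>)
    then obtain g where g: "g \<in> supported (std_monomials w X I t)" "f - g \<in> I"
      by (auto simp: std_monomials_def)
    then have "?\<pi> f = ?\<pi> g"
      using coset_eq_iff[OF I, of f g] f sub by blast
    then show "x \<in> ?\<pi> ` supported (std_monomials w X I t)" using f g by blast
  qed (use sub in \<open>auto simp: graded_part_eq\<close>)
  moreover have "Q.dimension (card (std_monomials w X I t)) (range (\<lambda>c. ?\<pi> (const c)))
      (?\<pi> ` supported (std_monomials w X I t))"
  proof (rule dimension_quotient_supported[OF I])
    show "finite (std_monomials w X I t)" "std_monomials w X I t \<subseteq> monomials X"
      using finite_hmons[OF X, of t] by (auto simp: std_monomials_def hmons_def)
    show "f = 0" if "f \<in> I" "f \<in> supported (std_monomials w X I t)" for f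
      using that sub by (intro standard_monomials_independent[of f ?V "hmons X t" w])
        (auto simp: std_monomials_def)
  qed
  ultimately show ?thesis
    using Q.dimI[OF K] by (simp add: hilbert_function_def over_def)
qed

text \<open>
  For \<open>1 \<in> I\<close> this is \<open>0\<close>, whereas \<^const>\<open>hilbert_function\<close> is a dimension over the zero ring.
\<close>

definition hilb :: "nat set \<Rightarrow> ('k::field) mpoly set \<Rightarrow> nat \<Rightarrow> nat" where
  "hilb X I t = card (std_monomials (\<lambda>_. 0) X I t)"

lemma std_monomials_whole:
  assumes "poly_ideal X I" "1 \<in> I"
  shows "std_monomials w X I t = {}"
proof -
  have "I = supported (monomials X)" using assms poly_ideal_one_iff by blast
  moreover have "m \<in> leads w (supported (monomials X) \<inter> supported (hmons X t))" if "m \<in> hmons X t" for m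
    unfolding leads_def using that
    by (auto intro!: bexI[of _ "Poly_Mapping.single m 1"] simp: supported_def hmons_def)
  ultimately show ?thesis by (auto simp: std_monomials_def)
qed

text \<open>For a proper ideal both counts are the dimension of the same space, otherwise both are
  0. This is what allows each later estimate to choose its own weight.\<close>

lemma hilb_eq_card:
  assumes "poly_ideal X I" "finite X"
  shows "hilb X I t = card (std_monomials w X I t)"
proof (cases "1 \<in> I")
  case True
  then show ?thesis using assms by (simp add: hilb_def std_monomials_whole)
next
  case False
  then show ?thesis
    using hilbert_function_eq_card[OF assms(1) False assms(2), of t "\<lambda>_. 0"]
      hilbert_function_eq_card[OF assms(1) False assms(2), of t w] by (simp add: hilb_def)
qed

lemma hilbert_function_eq_hilb:
  "poly_ideal X I \<Longrightarrow> 1 \<notin> I \<Longrightarrow> finite X \<Longrightarrow> hilbert_function X I t = hilb X I t"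
  unfolding hilb_def by (rule hilbert_function_eq_card)

section \<open>Homogeneous components and coefficients in one variable\<close>

abbreviation hcomp :: "nat \<Rightarrow> ('k::field) mpoly \<Rightarrow> 'k mpoly" where
  "hcomp t \<equiv> restrict_terms (\<lambda>m. monom_degree m = t)"

definition graded_ideal :: "nat set \<Rightarrow> ('k::field) mpoly set \<Rightarrow> bool" where
  "graded_ideal X I \<longleftrightarrow> poly_ideal X I \<and> (\<forall>f\<in>I. \<forall>t. hcomp t f \<in> I)"

lemma restrict_terms_supported: "f \<in> supported M \<Longrightarrow> restrict_terms P f \<in> supported M"
  by (auto simp: supported_def)

lemma hcomp_single_times:
  "hcomp t (Poly_Mapping.single m c * f) =
    (if monom_degree m \<le> t then Poly_Mapping.single m c * hcomp (t - monom_degree m) f else 0)"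
proof -
  have "restrict_terms (\<lambda>q. monom_degree m + monom_degree q = t) f =
      (if monom_degree m \<le> t then hcomp (t - monom_degree m) f else 0)"
    by (intro poly_mapping_eqI) auto
  then show ?thesis by (simp add: restrict_terms_single_times)
qed

text \<open>Serves as a bounding ideal: homogeneous generators of \<open>I\<close> lie in it, hence
  so does all of \<open>I\<close>.\<close>

lemma graded_ideal_homogeneous_kernel:
  assumes "poly_ideal X I"
  shows "poly_ideal X {f \<in> I. \<forall>t. hcomp t f \<in> I}"
  using poly_idealD[OF assms]
  by (intro poly_ideal_monomI) (auto simp: restrict_terms_add hcomp_single_times supported_single)

lemma homogeneous_ideal_imp_graded:
  assumes "homogeneous_ideal X I"
  shows "graded_ideal X I"
proof -
  obtain S where S: "S \<subseteq> (\<Union>t. graded_part X t)" and I: "I = Idl\<^bsub>poly_ring X\<^esub> S"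
    using assms by (auto simp: homogeneous_ideal_def)
  have "S \<subseteq> supported (monomials X)"
    using S by (auto simp: graded_part_def carrier_poly_ring)
  note gen = genideal_poly_ideal[OF this]
  have "S \<subseteq> {f \<in> I. \<forall>t. hcomp t f \<in> I}"
  proof
    fix f assume f: "f \<in> S"
    then obtain s where s: "\<And>m. m \<in> keys f \<Longrightarrow> monom_degree m = s"
      using S by (auto simp: graded_part_def)
    have fI: "f \<in> I" using f gen(2) I by blast
    have "hcomp t f \<in> I" for t
    proof (cases "t = s")
      case True
      then have "hcomp t f = f" using s by (intro restrict_terms_id) auto
      then show ?thesis using fI by simp
    next
      case False
      then have "hcomp t f = 0" using s by (intro restrict_terms_eq_0) auto
      then show ?thesis using poly_idealD(3)[OF gen(1)] I by simp
    qed
    then show "f \<in> {f \<in> I. \<forall>t. hcomp t f \<in> I}" using fI by blast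
  qed
  then have "I \<subseteq> {f \<in> I. \<forall>t. hcomp t f \<in> I}"
    using gen(3)[OF graded_ideal_homogeneous_kernel[OF gen(1)]] I by blast
  then show ?thesis using gen(1) I by (auto simp: graded_ideal_def)
qed

section \<open>Coefficients with respect to one variable\<close>

lemma lookup_update_zero_eq_iff:
  fixes p m :: monom
  assumes "lookup p y = 0"
  shows "Poly_Mapping.update y 0 m = p \<and> lookup m y = i \<longleftrightarrow> m = p + Poly_Mapping.single y i"
proof
  assume *: "Poly_Mapping.update y 0 m = p \<and> lookup m y = i"
  show "m = p + Poly_Mapping.single y i"
  proof (rule poly_mapping_eqI)
    fix j
    show "lookup m j = lookup (p + Poly_Mapping.single y i) j"
      using * by (auto simp: lookup_add lookup_single lookup_update when_def)
  qed
next
  assume "m = p + Poly_Mapping.single y i"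
  then show "Poly_Mapping.update y 0 m = p \<and> lookup m y = i"
    using assms by (auto intro!: poly_mapping_eqI simp: lookup_add lookup_single lookup_update when_def)
qed

text \<open>The working form of the definition: at most one key has exponent \<open>i\<close> in
  \<open>y\<close> and a given remaining part, so the sum collapses.\<close>

lemma lookup_y_coeff [simp]:
  "lookup (y_coeff y i f) p = (if lookup p y = 0 then lookup f (p + Poly_Mapping.single y i) else 0)"
proof -
  have "lookup (y_coeff y i f) p =
      (\<Sum>m | m \<in> keys f \<and> lookup m y = i. if Poly_Mapping.update y 0 m = p then lookup f m else 0)"
    by (simp add: y_coeff_def lookup_sum lookup_single when_def)
  also have "\<dots> = (if lookup p y = 0 then lookup f (p + Poly_Mapping.single y i) else 0)"
  proof (cases "lookup p y = 0")
    case True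
    have "(\<Sum>m | m \<in> keys f \<and> lookup m y = i. if Poly_Mapping.update y 0 m = p then lookup f m else 0) =
      (\<Sum>m | m \<in> keys f \<and> lookup m y = i. if m = p + Poly_Mapping.single y i then lookup f m else 0)"
      using lookup_update_zero_eq_iff[OF True] by (intro sum.cong) auto
    also have "\<dots> = lookup f (p + Poly_Mapping.single y i)"
      using lookup_update_zero_eq_iff[OF True] by (auto simp: sum.delta lookup_add True in_keys_iff)
    finally show ?thesis using True by simp
  next
    case False
    then have "Poly_Mapping.update y 0 m \<noteq> p" for m :: monom by (auto simp: lookup_update)
    then show ?thesis using False by simp
  qed
  finally show ?thesis .
qed

lemma keys_y_coeff: "p \<in> keys (y_coeff y i f) \<longleftrightarrow> lookup p y = 0 \<and> p + Poly_Mapping.single y i \<in> keys f"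
  by (auto simp: in_keys_iff)

lemma y_coeff_zero [simp]: "y_coeff y i 0 = 0"
  by (rule poly_mapping_eqI) simp

lemma y_coeff_add: "y_coeff y i (f + g) = y_coeff y i f + y_coeff y i g"
  by (rule poly_mapping_eqI) (simp add: lookup_add)

lemma monom_split: "\<exists>q :: monom. lookup q y = 0 \<and> m = q + Poly_Mapping.single y (lookup m y)"
proof -
  have "lookup (Poly_Mapping.update y 0 m) y = 0" by (simp add: lookup_update)
  from this lookup_update_zero_eq_iff[OF this, of m "lookup m y"] show ?thesis by blast
qed

text \<open>The factor y^a moves coefficients up by \<open>a\<close> places, and the factor
  \<open>m'\<close>, free of \<open>y\<close>, acts on each coefficient separately.\<close>

lemma y_coeff_single_times:
  assumes m: "m = m' + Poly_Mapping.single y a" "lookup m' y = 0"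
  shows "y_coeff y i (Poly_Mapping.single m c * f) =
    (if a \<le> i then Poly_Mapping.single m' c * y_coeff y (i - a) f else 0)"
proof (rule poly_mapping_eqI)
  fix p
  show "lookup (y_coeff y i (Poly_Mapping.single m c * f)) p =
    lookup (if a \<le> i then Poly_Mapping.single m' c * y_coeff y (i - a) f else 0) p"
  proof (cases "lookup p y = 0")
    case False
    have "lookup (Poly_Mapping.single m' c * y_coeff y (i - a) f) p = 0"
    proof (cases "\<exists>q. p = m' + q")
      case True
      then obtain q where "p = m' + q" by blast
      then show ?thesis using False m(2) by (simp add: lookup_add)
    qed (simp add: lookup_single_times_eq_0)
    then show ?thesis using False by simp
  next
    case True
    show ?thesis
    proof (cases "a \<le> i \<and> (\<exists>q. p = m' + q)")
      case T: True
      then obtain q where q: "p = m' + q" by blast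
      then have "lookup q y = 0" using True by (simp add: lookup_add)
      moreover have "p + Poly_Mapping.single y i = m + (q + Poly_Mapping.single y (i - a))"
        using T by (simp add: m q algebra_simps single_add[symmetric])
      ultimately show ?thesis using T True
        by (simp del: lookup_single_times_add) (simp add: q)
    next
      \<comment> \<open>No monomial can contribute here: comparing exponents of \<open>y\<close> in
        a supposed equation forces \<open>a\<close> to be at most \<open>i\<close>, and cancelling
        the powers of \<open>y\<close> exhibits \<open>p\<close> as a multiple of
        \<open>m'\<close>.\<close>
      case F: False
      have "p + Poly_Mapping.single y i \<noteq> m + q" for q
      proof
        assume eq: "p + Poly_Mapping.single y i = m + q"
        then have "lookup (p + Poly_Mapping.single y i) y = lookup (m + q) y" by simp
        then have i: "i = a + lookup q y" using True m by (simp add: lookup_add)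
        obtain r where r: "lookup r y = 0" "q = r + Poly_Mapping.single y (lookup q y)"
          using monom_split by blast
        have "p + Poly_Mapping.single y i = (m' + r) + Poly_Mapping.single y i"
          using eq r(2) i m(1) by (metis (no_types, lifting) add.assoc add.commute single_add)
        then have "p = m' + r" by simp
        then show False using F i by auto
      qed
      then have "lookup (Poly_Mapping.single m c * f) (p + Poly_Mapping.single y i) = 0"
        by (rule lookup_single_times_eq_0)
      moreover have "a \<le> i \<Longrightarrow> lookup (Poly_Mapping.single m' c * y_coeff y (i - a) f) p = 0"
        using F by (intro lookup_single_times_eq_0) auto
      ultimately show ?thesis by simp
    qed
  qed
qed

lemma monomials_minus_iff: "q \<in> monomials (X - {y}) \<longleftrightarrow> q \<in> monomials X \<and> lookup q y = 0"
  by (auto simp: monomials_def in_keys_iff)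

lemma y_coeff_supported:
  "f \<in> supported (monomials X) \<Longrightarrow> y_coeff y i f \<in> supported (monomials (X - {y}))"
  unfolding supported_def by (force simp: keys_y_coeff monomials_minus_iff subset_iff)

lemma var_power: "var y ^ d = Poly_Mapping.single (Poly_Mapping.single y d) 1"
proof (induction d)
  case (Suc d)
  then show ?case by (simp add: var_def mult_single single_add[symmetric])
qed simp

lemma y_coeff_y_free:
  assumes "g \<in> supported (monomials (X - {y}))"
  shows "y_coeff y i g = (if i = 0 then g else 0)"
proof (rule poly_mapping_eqI)
  fix p
  have k: "lookup q y = 0" if "lookup g q \<noteq> 0" for q
    using that assms by (auto simp: supported_def monomials_minus_iff in_keys_iff subset_iff)
  have "lookup g (p + Poly_Mapping.single y i) = 0" if "i \<noteq> 0"
    using k[of "p + Poly_Mapping.single y i"] that by (auto simp: lookup_add)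
  then show "lookup (y_coeff y i g) p = lookup (if i = 0 then g else 0) p"
    using k[of p] by (cases "lookup g p = 0") auto
qed

lemma y_coeff_times_var_power:
  assumes "g \<in> supported (monomials (X - {y}))"
  shows "y_coeff y i (g * var y ^ d) = (if i = d then g else 0)"
proof -
  have "y_coeff y i (Poly_Mapping.single (Poly_Mapping.single y d) 1 * g) =
      (if d \<le> i then Poly_Mapping.single 0 1 * y_coeff y (i - d) g else 0)"
    by (rule y_coeff_single_times) simp_all
  then show ?thesis
    using y_coeff_y_free[OF assms] by (simp add: var_power mult.commute)
qed

lemma y_degree_le_iff: "y_degree y f \<le> d \<longleftrightarrow> (\<forall>m\<in>keys f. lookup m y \<le> d)"
  by (auto simp: y_degree_def)

lemma y_coeff_eq_0: "y_degree y f < i \<Longrightarrow> y_coeff y i f = 0"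
proof (rule poly_mapping_eqI)
  fix p assume "y_degree y f < i"
  then have "\<forall>m\<in>keys f. lookup m y \<le> y_degree y f" using y_degree_le_iff by blast
  then have "p + Poly_Mapping.single y i \<notin> keys f"
    using \<open>y_degree y f < i\<close> by (fastforce simp: lookup_add)
  then show "lookup (y_coeff y i f) p = lookup 0 p" by (simp add: in_keys_iff)
qed

lemma hcomp_y_coeff: "hcomp s (y_coeff y i f) = y_coeff y i (hcomp (s + i) f)"
  by (rule poly_mapping_eqI) simp

text \<open>Multiplication by \<open>y\<close> moves a coefficient to a higher index, which is why
  the family has to increase. Ideals of this form bound generated ideals from above.\<close>

lemma poly_ideal_of_coefficient_ideals:
  assumes J: "\<And>i. poly_ideal (X - {y}) (J i)" and mono: "\<And>i j. i \<le> j \<Longrightarrow> J i \<subseteq> J j"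
  shows "poly_ideal X {f \<in> supported (monomials X). \<forall>i. y_coeff y i f \<in> J i}"
proof (rule poly_ideal_monomI)
  fix f :: "'a mpoly" and m c
  assume f: "f \<in> {f \<in> supported (monomials X). \<forall>i. y_coeff y i f \<in> J i}" and m: "m \<in> monomials X"
  obtain q where q: "lookup q y = 0" "m = q + Poly_Mapping.single y (lookup m y)"
    using monom_split by blast
  then have "q \<in> monomials X" using m by (metis monomials_add)
  then have qY: "q \<in> monomials (X - {y})" using q by (simp add: monomials_minus_iff)
  have "y_coeff y i (Poly_Mapping.single m c * f) \<in> J i" for i
    unfolding y_coeff_single_times[OF q(2,1)]
    using f mono[of "i - lookup m y" i] poly_idealD(3)[OF J] poly_idealD(5)[OF J _ supported_single[OF qY]]
    by (auto dest: subsetD)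
  then show "Poly_Mapping.single m c * f \<in> {f \<in> supported (monomials X). \<forall>i. y_coeff y i f \<in> J i}"
    using f supported_mult[OF supported_single[OF m]] by auto
qed (use poly_idealD[OF J] in \<open>auto simp: y_coeff_add intro: supported_add\<close>)

section \<open>Leading coefficient ideals\<close>

text \<open>Bounding the degree by \<open>i\<close> rather than fixing it keeps the set closed under
  sums whose top terms cancel, and puts 0 into it.\<close>

definition lead_coeffs :: "nat \<Rightarrow> ('k::field) mpoly set \<Rightarrow> nat \<Rightarrow> 'k mpoly set" where
  "lead_coeffs y I i = {y_coeff y i f | f. f \<in> I \<and> y_degree y f \<le> i}"

lemma lead_coeffsI: "f \<in> I \<Longrightarrow> y_degree y f \<le> i \<Longrightarrow> y_coeff y i f \<in> lead_coeffs y I i"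
  by (auto simp: lead_coeffs_def)

lemma y_degree_add_le: "y_degree y f \<le> i \<Longrightarrow> y_degree y g \<le> i \<Longrightarrow> y_degree y (f + g) \<le> i"
  using Poly_Mapping.keys_add[of f g] by (auto simp: y_degree_le_iff)

lemma y_degree_single_times_le:
  "y_degree y f \<le> i \<Longrightarrow> y_degree y (Poly_Mapping.single m c * f) \<le> lookup m y + i"
  using Poly_Mapping.keys_mult[of "Poly_Mapping.single m c" f]
  by (fastforce simp: y_degree_le_iff lookup_add split: if_splits)

lemma y_degree_zero [simp]: "y_degree y 0 = 0"
  by (simp add: y_degree_def)

lemma poly_ideal_lead_coeffs:
  assumes I: "poly_ideal X I"
  shows "poly_ideal (X - {y}) (lead_coeffs y I i)"
proof (rule poly_ideal_monomI)
  show "lead_coeffs y I i \<subseteq> supported (monomials (X - {y}))"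
    using poly_idealD(2)[OF I] by (auto simp: lead_coeffs_def intro: y_coeff_supported)
  show "0 \<in> lead_coeffs y I i"
    unfolding lead_coeffs_def using poly_idealD(3)[OF I]
    by (intro CollectI exI[of _ 0]) simp
next
  fix f g assume "f \<in> lead_coeffs y I i" "g \<in> lead_coeffs y I i"
  then obtain f' g' where "f = y_coeff y i f'" "g = y_coeff y i g'" "f' \<in> I" "g' \<in> I"
      "y_degree y f' \<le> i" "y_degree y g' \<le> i"
    by (auto simp: lead_coeffs_def)
  then show "f + g \<in> lead_coeffs y I i"
    using lead_coeffsI[of "f' + g'" I y i] poly_idealD(4)[OF I] y_degree_add_le[of y f' i g']
    by (simp add: y_coeff_add)
next
  fix f m c assume "f \<in> lead_coeffs y I i" and m: "m \<in> monomials (X - {y})"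
  then obtain f' where f: "f = y_coeff y i f'" "f' \<in> I" "y_degree y f' \<le> i"
    by (auto simp: lead_coeffs_def)
  have "lookup m y = 0" "m \<in> monomials X" using m by (simp_all add: monomials_minus_iff)
  then have "y_coeff y i (Poly_Mapping.single m c * f') = Poly_Mapping.single m c * f"
    and "y_degree y (Poly_Mapping.single m c * f') \<le> i" "Poly_Mapping.single m c * f' \<in> I"
    using y_coeff_single_times[of m m y 0 i c f'] y_degree_single_times_le[OF f(3), of m c]
      poly_idealD(5)[OF I f(2) supported_single] f(1) by auto
  then show "Poly_Mapping.single m c * f \<in> lead_coeffs y I i"
    using lead_coeffsI[of "Poly_Mapping.single m c * f'" I y i] by simp
qed

lemma lead_coeffs_mono:
  assumes I: "poly_ideal X I" and y: "y \<in> X" and ij: "i \<le> j"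
  shows "lead_coeffs y I i \<subseteq> lead_coeffs y I j"
proof
  fix g assume "g \<in> lead_coeffs y I i"
  then obtain f where f: "g = y_coeff y i f" "f \<in> I" "y_degree y f \<le> i"
    by (auto simp: lead_coeffs_def)
  let ?m = "Poly_Mapping.single y (j - i)"
  have "y_coeff y j (Poly_Mapping.single ?m 1 * f) = g"
    using y_coeff_single_times[of ?m 0 y "j - i" j 1 f] ij f(1) by simp
  moreover have "y_degree y (Poly_Mapping.single ?m 1 * f) \<le> j"
    using y_degree_single_times_le[OF f(3), of ?m 1] ij by simp
  moreover have "Poly_Mapping.single ?m 1 * f \<in> I"
    by (intro poly_idealD(5)[OF I f(2)] supported_single monomials_single y)
  ultimately show "g \<in> lead_coeffs y I j"
    using lead_coeffsI[of "Poly_Mapping.single ?m 1 * f" I y j] by simp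
qed

lemma graded_lead_coeffs:
  assumes "graded_ideal X I"
  shows "graded_ideal (X - {y}) (lead_coeffs y I i)"
proof -
  have "hcomp s g \<in> lead_coeffs y I i" if g: "g \<in> lead_coeffs y I i" for s g
  proof -
    obtain f where f: "g = y_coeff y i f" "f \<in> I" "y_degree y f \<le> i"
      using g by (auto simp: lead_coeffs_def)
    have "hcomp (s + i) f \<in> I" "y_degree y (hcomp (s + i) f) \<le> i"
      using assms f by (auto simp: graded_ideal_def y_degree_le_iff)
    then show ?thesis using lead_coeffsI by (simp add: f(1) hcomp_y_coeff)
  qed
  then show ?thesis
    using assms poly_ideal_lead_coeffs by (auto simp: graded_ideal_def)
qed

lemma init_y_supported:
  assumes "f \<in> supported (monomials X)" "y \<in> X"
  shows "init_y y f \<in> supported (monomials X)"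
  unfolding init_y_def lead_y_coeff_def
  using supported_mono[OF y_coeff_supported[OF assms(1), of y] monomials_mono[of "X - {y}" X]] assms(2)
  by (intro supported_mult supported_power supported_var) auto

text \<open>An initial form has at most one nonzero coefficient, and it lies in the matching leading
  coefficient ideal. So the polynomials with all coefficients in these ideals form an ideal that
  contains \<open>init_y_ideal X y I\<close>.\<close>

lemma lead_coeffs_iff_init_y_ideal:
  assumes I: "poly_ideal X I" and y: "y \<in> X" and g: "g \<in> supported (monomials (X - {y}))"
  shows "g \<in> lead_coeffs y I i \<longleftrightarrow> g * var y ^ i \<in> init_y_ideal X y I"
proof -
  have S: "init_y y ` I \<subseteq> supported (monomials X)"
    using init_y_supported poly_idealD(2)[OF I] y by blast
  note gen = genideal_poly_ideal[OF S, folded init_y_ideal_def]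
  let ?T = "{f \<in> supported (monomials X). \<forall>i. y_coeff y i f \<in> lead_coeffs y I i}"
  have "init_y y ` I \<subseteq> ?T"
  proof
    fix h assume "h \<in> init_y y ` I"
    then obtain f where f: "f \<in> I" "h = init_y y f" by blast
    have "y_coeff y i h \<in> lead_coeffs y I i" for i
    proof (cases "i = y_degree y f")
      case True
      then show ?thesis
        using y_coeff_times_var_power[OF y_coeff_supported, of f X y i] f poly_idealD(2)[OF I]
        by (auto simp: init_y_def lead_y_coeff_def lead_coeffs_def)
    next
      case False
      then have "y_coeff y i h = 0"
        using y_coeff_times_var_power[OF y_coeff_supported[OF poly_idealD(2)[OF I f(1)]], of y i "y_degree y f"] f
        by (auto simp: init_y_def lead_y_coeff_def)
      then show ?thesis using poly_idealD(3)[OF poly_ideal_lead_coeffs[OF I]] by simp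
    qed
    then show "h \<in> ?T" using S f by blast
  qed
  then have sub: "init_y_ideal X y I \<subseteq> ?T"
    using gen(3)[OF poly_ideal_of_coefficient_ideals[of X y "lead_coeffs y I"]]
      poly_ideal_lead_coeffs[OF I] lead_coeffs_mono[OF I y] by blast
  show ?thesis
  proof
    assume "g \<in> lead_coeffs y I i"
    then obtain f where f: "g = y_coeff y i f" "f \<in> I" "y_degree y f \<le> i"
      by (auto simp: lead_coeffs_def)
    show "g * var y ^ i \<in> init_y_ideal X y I"
    proof (cases "y_degree y f = i")
      case True
      then have "g * var y ^ i = init_y y f" by (simp add: init_y_def lead_y_coeff_def f)
      then show ?thesis using f gen(2) by auto
    next
      case False
      then have "g = 0" using f y_coeff_eq_0[of y f i] by simp
      then show ?thesis using poly_idealD(3)[OF gen(1)] by simp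
    qed
  next
    assume "g * var y ^ i \<in> init_y_ideal X y I"
    then have "y_coeff y i (g * var y ^ i) \<in> lead_coeffs y I i" using sub by blast
    then show "g \<in> lead_coeffs y I i" using y_coeff_times_var_power[OF g] by simp
  qed
qed

text \<open>For generators free of \<open>y\<close>, the constant family equal to the contraction
  bounds the generated ideal by \<open>poly_ideal_of_coefficient_ideals\<close>, so all coefficients
  in \<open>y\<close> stay in the contraction.\<close>

lemma genideal_y_free:
  assumes S: "S \<subseteq> supported (monomials (X - {y}))"
  defines "J \<equiv> Idl\<^bsub>poly_ring X\<^esub> S"
  shows "poly_ideal X J" "poly_ideal (X - {y}) (contraction (X - {y}) J)"
    "f \<in> J \<Longrightarrow> y_coeff y i f \<in> contraction (X - {y}) J"
proof -
  have mono: "supported (monomials (X - {y})) \<subseteq> supported (monomials X)"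
    using monomials_mono[of "X - {y}" X] by (auto intro: supported_mono)
  then have SX: "S \<subseteq> supported (monomials X)" using S by blast
  note gen = genideal_poly_ideal[OF SX, folded J_def]
  show "poly_ideal X J" by (rule gen)
  show c: "poly_ideal (X - {y}) (contraction (X - {y}) J)"
    using poly_idealD[OF gen(1)] mono
    by (intro poly_idealI) (auto simp: contraction_def carrier_poly_ring intro: supported_add supported_mult)
  have "S \<subseteq> {f \<in> supported (monomials X). \<forall>i. y_coeff y i f \<in> contraction (X - {y}) J}"
  proof
    fix f assume f: "f \<in> S"
    have "y_coeff y i f \<in> contraction (X - {y}) J" for i
      using y_coeff_y_free[OF subsetD[OF S f]] subsetD[OF S f] subsetD[OF gen(2) f] poly_idealD(3)[OF c]
      by (cases "i = 0") (auto simp: contraction_def carrier_poly_ring)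
    then show "f \<in> {f \<in> supported (monomials X). \<forall>i. y_coeff y i f \<in> contraction (X - {y}) J}"
      using f SX by blast
  qed
  from gen(3)[OF poly_ideal_of_coefficient_ideals[OF c] this]
  have "J \<subseteq> {f \<in> supported (monomials X). \<forall>i. y_coeff y i f \<in> contraction (X - {y}) J}" by simp
  then show "f \<in> J \<Longrightarrow> y_coeff y i f \<in> contraction (X - {y}) J" by blast
qed

text \<open>By \<open>lead_coeffs_iff_init_y_ideal\<close> one has to decide which g y^i lie in the
  intersection of C with N + <y>. For i = 0 the summand from <y> has no part free of
  \<open>y\<close>, which leaves N; for positive i the product already lies in <y>, which leaves
  C.\<close>

lemma geometric_vertex_decomposition_lead_coeffs:
  fixes I :: "('k::field) mpoly set"
  assumes I: "poly_ideal X I" and y: "y \<in> X" and gvd: "geometric_vertex_decomposition X y ord G I"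
  shows "lead_coeffs y I 0 = contraction (X - {y}) (N_ideal X y G)"
    "i \<noteq> 0 \<Longrightarrow> lead_coeffs y I i = contraction (X - {y}) (C_ideal X y G)"
proof -
  let ?N = "N_ideal X y G" and ?C = "C_ideal X y G" and ?Y = "X - {y}"
  have GI: "G \<subseteq> I" using gvd by (auto simp: geometric_vertex_decomposition_def groebner_basis_def)
  have S: "lead_y_coeff y ` G \<subseteq> supported (monomials ?Y)"
    using GI poly_idealD(2)[OF I] by (auto simp: lead_y_coeff_def intro: y_coeff_supported)
  then have S0: "lead_y_coeff y ` {g \<in> G. y_degree y g = 0} \<subseteq> supported (monomials ?Y)" by auto
  note C = genideal_y_free[OF S, folded C_ideal_def]
  note N = genideal_y_free[OF S0, folded N_ideal_def]
  have mono: "supported (monomials ?Y) \<subseteq> supported (monomials X)"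
    using monomials_mono[of ?Y X] by (auto intro: supported_mono)
  have NC: "?N \<subseteq> ?C"
    unfolding N_ideal_def using S0 mono C(1) genideal_poly_ideal(2)[of "lead_y_coeff y ` G" X] S
    by (intro genideal_poly_ideal(3)) (auto simp: C_ideal_def)
  define Y where "Y = Idl\<^bsub>poly_ring X\<^esub> {var y :: 'k mpoly}"
  have "{var y :: 'k mpoly} \<subseteq> supported (monomials X)" using y by (simp add: supported_var)
  note Y = genideal_poly_ideal[OF this, folded Y_def]
  have init: "init_y_ideal X y I = ?C \<inter> {f + g | f g. f \<in> ?N \<and> g \<in> Y}"
    using gvd by (simp add: geometric_vertex_decomposition_def sum_of_ideals_eq Y_def)
  have Y0: "y_coeff y 0 f = 0" if "f \<in> Y" for f
  proof -
    \<comment> \<open>The family with zero at index 0 and everything above describes the multiples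
      of \<open>y\<close>, and so bounds <y>.\<close>
    have "poly_ideal X {f \<in> supported (monomials X). \<forall>i. y_coeff y i f \<in> (if i = 0 then {0} else supported (monomials ?Y))}"
      by (rule poly_ideal_of_coefficient_ideals)
        (auto intro!: poly_idealI intro: supported_add supported_mult)
    moreover have "y_coeff y 0 (var y) = 0"
      using y_coeff_times_var_power[of 1 X y 0 1] by simp
    ultimately have "Y \<subseteq> {f \<in> supported (monomials X). \<forall>i. y_coeff y i f \<in> (if i = 0 then {0} else supported (monomials ?Y))}"
      using y by (intro Y(3)) (auto simp: supported_var intro: y_coeff_supported)
    then show ?thesis using that by (auto split: if_splits)
  qed
  have L: "g \<in> lead_coeffs y I i \<longleftrightarrow> g \<in> supported (monomials ?Y) \<and> g * var y ^ i \<in> init_y_ideal X y I" for g i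
    using lead_coeffs_iff_init_y_ideal[OF I y] poly_idealD(2)[OF poly_ideal_lead_coeffs[OF I]] by blast
  show "lead_coeffs y I 0 = contraction ?Y ?N"
  proof (intro equalityI subsetI)
    fix g assume "g \<in> lead_coeffs y I 0"
    then have g: "g \<in> supported (monomials ?Y)" "g \<in> init_y_ideal X y I" using L[of g 0] by auto
    then obtain f h where fh: "g = f + h" "f \<in> ?N" "h \<in> Y" using init by auto
    have "g = y_coeff y 0 g" using y_coeff_y_free[OF g(1)] by simp
    also have "\<dots> = y_coeff y 0 f" using fh Y0 by (simp add: y_coeff_add)
    also have "\<dots> \<in> contraction ?Y ?N" using N(3) fh by blast
    finally show "g \<in> contraction ?Y ?N" .
  next
    fix g assume g: "g \<in> contraction ?Y ?N"
    then have "g = g + 0" "g \<in> ?C" "g \<in> ?N" "0 \<in> Y"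
      using NC poly_idealD(3)[OF Y(1)] by (auto simp: contraction_def)
    then have "g \<in> init_y_ideal X y I" unfolding init by blast
    then show "g \<in> lead_coeffs y I 0" using g L[of g 0] by (simp add: contraction_def carrier_poly_ring)
  qed
  show "lead_coeffs y I i = contraction ?Y ?C" if "i \<noteq> 0"
  proof (intro equalityI subsetI)
    fix g assume "g \<in> lead_coeffs y I i"
    then have g: "g \<in> supported (monomials ?Y)" "g * var y ^ i \<in> init_y_ideal X y I" using L by auto
    then have "g * var y ^ i \<in> ?C" using init by auto
    then have "y_coeff y i (g * var y ^ i) \<in> contraction ?Y ?C" using C(3) by blast
    then show "g \<in> contraction ?Y ?C" using y_coeff_times_var_power[OF g(1)] by simp
  next
    fix g assume "g \<in> contraction ?Y ?C"
    then have g: "g \<in> ?C" "g \<in> supported (monomials ?Y)" by (auto simp: contraction_def carrier_poly_ring)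
    have vX: "var y ^ j \<in> supported (monomials X)" for j by (intro supported_power supported_var y)
    have 1: "g * var y ^ i \<in> ?C" by (rule poly_idealD(6)[OF C(1) g(1) vX])
    have "g * var y ^ i = var y * (g * var y ^ (i - 1))"
      using that by (cases i) (auto simp: algebra_simps)
    also have "\<dots> \<in> Y"
      using Y(2) g(2) mono vX by (intro poly_idealD(6)[OF Y(1)] supported_mult) auto
    finally have 2: "g * var y ^ i \<in> Y" .
    have "g * var y ^ i = 0 + g * var y ^ i" by simp
    then have "g * var y ^ i \<in> init_y_ideal X y I"
      unfolding init using 1 2 poly_idealD(3)[OF N(1)] by blast
    then show "g \<in> lead_coeffs y I i" using g L by blast
  qed
qed

text \<open>With the exponent of \<open>y\<close> as weight, q y^i is a leading monomial of
  \<open>I\<close> exactly if q is one of the i-th leading coefficient ideal. Sorting the standard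
  monomials by their exponent of \<open>y\<close> gives the sum.\<close>

lemma hilb_lead_coeffs:
  fixes I :: "('k::field) mpoly set"
  assumes I: "graded_ideal X I" and y: "y \<in> X" and X: "finite X"
  shows "hilb X I t = (\<Sum>i\<le>t. hilb (X - {y}) (lead_coeffs y I i) (t - i))"
proof -
  let ?w = "\<lambda>m::monom. int (lookup m y)" and ?Y = "X - {y}"
  have pI: "poly_ideal X I" using I by (simp add: graded_ideal_def)
  have lead: "q + Poly_Mapping.single y i \<in> leads ?w (I \<inter> supported (hmons X t)) \<longleftrightarrow>
      q \<in> leads (\<lambda>_. 0) (lead_coeffs y I i \<inter> supported (hmons ?Y (t - i)))"
    if q: "q \<in> hmons ?Y (t - i)" and i: "i \<le> t" for q i
  proof
    have q0: "lookup q y = 0" using q by (simp add: hmons_def monomials_minus_iff)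
    assume "q + Poly_Mapping.single y i \<in> leads ?w (I \<inter> supported (hmons X t))"
    then obtain f where f: "f \<in> I" "f \<in> supported (hmons X t)" "q + Poly_Mapping.single y i \<in> keys f"
      and ge: "\<And>m. m \<in> keys f \<Longrightarrow> (?w m, m) \<le> (?w (q + Poly_Mapping.single y i), q + Poly_Mapping.single y i)"
      unfolding leads_def by blast
    have "y_degree y f \<le> i"
      using ge q0 by (fastforce simp: y_degree_le_iff lookup_add)
    then have "y_coeff y i f \<in> lead_coeffs y I i" using f by (auto simp: lead_coeffs_def)
    moreover have "y_coeff y i f \<in> supported (hmons ?Y (t - i))"
      using f(2) by (fastforce simp: supported_def keys_y_coeff hmons_def monomials_minus_iff subset_iff)
    moreover have "q \<in> keys (y_coeff y i f)" using f q0 by (simp add: keys_y_coeff)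
    moreover have "(0, p) \<le> (0::int, q)" if "p \<in> keys (y_coeff y i f)" for p
      using ge[of "p + Poly_Mapping.single y i"] that q0 by (simp add: keys_y_coeff lookup_add)
    ultimately show "q \<in> leads (\<lambda>_. 0) (lead_coeffs y I i \<inter> supported (hmons ?Y (t - i)))"
      unfolding leads_def by blast
  next
    have q0: "lookup q y = 0" using q by (simp add: hmons_def monomials_minus_iff)
    assume "q \<in> leads (\<lambda>_. 0) (lead_coeffs y I i \<inter> supported (hmons ?Y (t - i)))"
    then obtain g where g: "g \<in> lead_coeffs y I i" "g \<in> supported (hmons ?Y (t - i))" "q \<in> keys g"
      and ge: "\<And>p. p \<in> keys g \<Longrightarrow> (0::int, p) \<le> (0, q)"
      unfolding leads_def by blast
    obtain f0 where f0: "g = y_coeff y i f0" "f0 \<in> I" "y_degree y f0 \<le> i"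
      using g(1) by (auto simp: lead_coeffs_def)
    \<comment> \<open>\<open>f0\<close> need not be homogeneous. Its component of degree
      \<open>t\<close> has the same coefficient at index \<open>i\<close>, since \<open>g\<close> is
      homogeneous of degree \<open>t - i\<close>.\<close>
    let ?f = "hcomp t f0"
    have fI: "?f \<in> I" using I f0 by (simp add: graded_ideal_def)
    have "y_coeff y i ?f = hcomp (t - i) g" using i by (simp add: f0 hcomp_y_coeff)
    also have "\<dots> = g" using g(2) by (intro restrict_terms_id) (auto simp: supported_def hmons_def)
    finally have fg: "y_coeff y i ?f = g" .
    have "?f \<in> supported (hmons X t)"
      using poly_idealD(2)[OF pI f0(2)] by (auto simp: supported_def hmons_def)
    moreover have "q + Poly_Mapping.single y i \<in> keys ?f"
      using g(3) by (metis fg keys_y_coeff)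
    moreover have "(?w m, m) \<le> (?w (q + Poly_Mapping.single y i), q + Poly_Mapping.single y i)"
      if m: "m \<in> keys ?f" for m
    proof -
      have le: "lookup m y \<le> i" using m f0(3) by (simp add: y_degree_le_iff)
      show ?thesis
      proof (cases "lookup m y = i")
        case True
        obtain p where p: "lookup p y = 0" "m = p + Poly_Mapping.single y i"
          using monom_split[of y m] True by blast
        then have "p \<in> keys g" using m fg keys_y_coeff by metis
        then have "p \<le> q" using ge by simp
        then show ?thesis using p by (simp add: lookup_add q0)
      next
        case False
        then show ?thesis using le by (simp add: lookup_add q0)
      qed
    qed
    ultimately show "q + Poly_Mapping.single y i \<in> leads ?w (I \<inter> supported (hmons X t))"
      unfolding leads_def using fI by blast
  qed
  let ?S = "\<lambda>i. std_monomials (\<lambda>_. 0) ?Y (lead_coeffs y I i) (t - i)"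
  let ?sh = "\<lambda>i q. q + Poly_Mapping.single y i :: monom"
  have "std_monomials ?w X I t = (\<Union>i\<in>{..t}. ?sh i ` ?S i)"
  proof (intro equalityI subsetI)
    fix m assume m: "m \<in> std_monomials ?w X I t"
    define i where "i = lookup m y"
    obtain q where q: "lookup q y = 0" "m = q + Poly_Mapping.single y i"
      using monom_split[of y m] by (auto simp: i_def)
    have mX: "m \<in> monomials X" "monom_degree m = t" using m by (auto simp: std_monomials_def hmons_def)
    then have "monom_degree q + i = t" using q by simp
    then have i: "i \<le> t" and qh: "q \<in> hmons ?Y (t - i)"
      using mX q by (auto simp: hmons_def monomials_minus_iff)
    have "q \<in> ?S i"
      using lead[OF qh i] m qh q by (simp add: std_monomials_def)
    then show "m \<in> (\<Union>i\<in>{..t}. ?sh i ` ?S i)" using q i by auto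
  next
    fix m assume "m \<in> (\<Union>i\<in>{..t}. ?sh i ` ?S i)"
    then obtain i q where i: "i \<le> t" and q: "q \<in> ?S i" "m = q + Poly_Mapping.single y i" by auto
    have qh: "q \<in> hmons ?Y (t - i)" using q by (simp add: std_monomials_def)
    have "m \<in> hmons X t"
      using qh i y unfolding q(2) by (auto simp: hmons_def monomials_minus_iff monomials_single)
    then show "m \<in> std_monomials ?w X I t"
      using lead[OF qh i] q by (simp add: std_monomials_def)
  qed
  also have "card \<dots> = (\<Sum>i\<le>t. card (?sh i ` ?S i))"
  proof (rule card_UN_disjoint)
    show "\<forall>i\<in>{..t}. \<forall>j\<in>{..t}. i \<noteq> j \<longrightarrow> ?sh i ` ?S i \<inter> ?sh j ` ?S j = {}"
    proof (intro ballI impI equals0I)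
      fix i j m assume "i \<noteq> j" and m: "m \<in> ?sh i ` ?S i \<inter> ?sh j ` ?S j"
      then obtain q q' where q: "q \<in> ?S i" "m = ?sh i q" and q': "q' \<in> ?S j" "m = ?sh j q'" by blast
      have "lookup m y = i" using q(1) unfolding q(2)
        by (simp add: std_monomials_def hmons_def monomials_minus_iff lookup_add)
      moreover have "lookup m y = j" using q'(1) unfolding q'(2)
        by (simp add: std_monomials_def hmons_def monomials_minus_iff lookup_add)
      ultimately have "i = j" by simp
      then show False using \<open>i \<noteq> j\<close> by simp
    qed
  qed (use X in \<open>auto simp: std_monomials_def\<close>)
  also have "\<dots> = (\<Sum>i\<le>t. card (?S i))"
    by (intro sum.cong refl card_image) (auto simp: inj_on_def)
  finally show ?thesis
    unfolding hilb_def[symmetric] hilb_eq_card[OF pI X, of t ?w, symmetric] .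
qed

section \<open>Hilbert series\<close>

definition hseries :: "nat set \<Rightarrow> ('k::field) mpoly set \<Rightarrow> rat fps" where
  "hseries X I = Abs_fps (\<lambda>t. of_nat (hilb X I t))"

text \<open>The Hilbert function of \<open>I\<close> is that of \<open>A\<close> plus the partial
  sums of that of \<open>B\<close>, and taking partial sums is division by 1 - x. Multiplying by 1 -
  x keeps quotients of power series out of the recursion.\<close>

lemma hseries_lead_coeffs:
  fixes I :: "('k::field) mpoly set"
  assumes I: "graded_ideal X I" and y: "y \<in> X" and X: "finite X"
    and A: "lead_coeffs y I 0 = A" and B: "\<And>i. i \<noteq> 0 \<Longrightarrow> lead_coeffs y I i = B"
  shows "(1 - fps_X) * hseries X I = (1 - fps_X) * hseries (X - {y}) A + fps_X * hseries (X - {y}) B"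
proof (rule fps_ext)
  fix n
  let ?a = "hilb (X - {y}) A" and ?b = "hilb (X - {y}) B"
  have h: "hilb X I t = ?a t + (\<Sum>j<t. ?b j)" for t
  proof -
    have "hilb X I t = (\<Sum>i\<in>insert 0 {1..t}. hilb (X - {y}) (lead_coeffs y I i) (t - i))"
      unfolding hilb_lead_coeffs[OF I y X] by (intro sum.cong) auto
    also have "\<dots> = ?a t + (\<Sum>i\<in>{1..t}. hilb (X - {y}) (lead_coeffs y I i) (t - i))"
      by (simp add: A)
    also have "(\<Sum>i\<in>{1..t}. hilb (X - {y}) (lead_coeffs y I i) (t - i)) = (\<Sum>i\<in>{1..t}. ?b (t - i))"
      using B by (intro sum.cong) auto
    also have "\<dots> = (\<Sum>j<t. ?b j)"
      by (rule sum.reindex_bij_witness[of _ "\<lambda>j. t - j" "\<lambda>i. t - i"]) auto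
    finally show ?thesis .
  qed
  show "fps_nth ((1 - fps_X) * hseries X I) n =
      fps_nth ((1 - fps_X) * hseries (X - {y}) A + fps_X * hseries (X - {y}) B) n"
    by (cases n) (simp_all add: left_diff_distrib hseries_def h)
qed

section \<open>Ideals generated by variables\<close>

lemma graded_ideal_zero: "graded_ideal X {0 :: ('k::field) mpoly}"
  by (auto simp: graded_ideal_def intro: poly_idealI)

lemma hilb_zero_ideal: "hilb X {0 :: ('k::field) mpoly} t = card (hmons X t)"
proof -
  have "leads w ({0 :: 'k mpoly} \<inter> V) = {}" for w V
    by (auto simp: leads_def)
  from this[of _ "UNIV"] show ?thesis by (simp add: hilb_def std_monomials_def)
qed

text \<open>All leading coefficient ideals of the zero ideal are zero, so the recursion removes one
  variable at a time.\<close>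

lemma hseries_zero_ideal:
  assumes "finite X"
  shows "hseries X {0 :: ('k::field) mpoly} * (1 - fps_X) ^ card X = 1"
  using assms
proof induction
  case empty
  have "card (hmons {} t) = (if t = 0 then 1 else 0)" for t
  proof -
    have "monomials {} = {0}" by (auto simp: monomials_def)
    then have "hmons {} t = (if t = 0 then {0} else {})" by (auto simp: hmons_def)
    then show ?thesis by simp
  qed
  then have "hseries {} {0 :: 'k mpoly} = 1"
    by (intro fps_ext) (simp add: hseries_def hilb_zero_ideal)
  then show ?case by simp
next
  case (insert y X)
  have L: "lead_coeffs y {0} i = {0 :: 'k mpoly}" for i
    by (auto simp: lead_coeffs_def)
  have "(1 - fps_X) * hseries (insert y X) {0 :: 'k mpoly} =
      (1 - fps_X) * hseries (insert y X - {y}) {0 :: 'k mpoly} + fps_X * hseries (insert y X - {y}) {0 :: 'k mpoly}"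
    using insert.hyps by (intro hseries_lead_coeffs graded_ideal_zero L) auto
  also have "\<dots> = hseries X {0 :: 'k mpoly}"
    using insert.hyps by (simp add: left_diff_distrib)
  finally have "(1 - fps_X) * hseries (insert y X) {0 :: 'k mpoly} = hseries X {0 :: 'k mpoly}" .
  moreover have "hseries (insert y X) {0 :: 'k mpoly} * (1 - fps_X) ^ card (insert y X) =
     ((1 - fps_X) * hseries (insert y X) {0 :: 'k mpoly}) * (1 - fps_X) ^ card X"
    using insert.hyps by (simp add: mult_ac)
  ultimately have "hseries (insert y X) {0 :: 'k mpoly} * (1 - fps_X) ^ card (insert y X) =
     hseries X {0 :: 'k mpoly} * (1 - fps_X) ^ card X" by simp
  then show ?case using insert.IH by simp
qed

lemma hseries_whole: "poly_ideal X I \<Longrightarrow> 1 \<in> I \<Longrightarrow> hseries X I = 0"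
  by (intro fps_ext) (simp add: hseries_def hilb_def std_monomials_whole)

text \<open>The polynomials all of whose monomials meet \<open>V\<close> form an ideal containing
  the generators, which gives the first claim. For the second, divide the monomial by a variable
  from \<open>V\<close>.\<close>

lemma monom_ideal_vars:
  fixes V :: "nat set"
  assumes V: "V \<subseteq> X"
  defines "I \<equiv> Idl\<^bsub>poly_ring X\<^esub> ((var :: nat \<Rightarrow> ('k::field) mpoly) ` V)"
  shows "f \<in> I \<Longrightarrow> m \<in> keys f \<Longrightarrow> keys m \<inter> V \<noteq> {}"
    and "m \<in> monomials X \<Longrightarrow> keys m \<inter> V \<noteq> {} \<Longrightarrow> Poly_Mapping.single m 1 \<in> I"
proof -
  have S: "(var :: nat \<Rightarrow> 'k mpoly) ` V \<subseteq> supported (monomials X)" using V by (auto intro: supported_var)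
  note gen = genideal_poly_ideal[OF S, folded I_def]
  let ?J = "{f :: 'k mpoly. f \<in> supported (monomials X) \<and> (\<forall>m\<in>keys f. keys m \<inter> V \<noteq> {})}"
  have "poly_ideal X ?J"
  proof (rule poly_ideal_monomI)
    fix f g :: "'k mpoly" assume "f \<in> ?J" "g \<in> ?J"
    then show "f + g \<in> ?J" using Poly_Mapping.keys_add[of f g] by (auto intro: supported_add)
  next
    fix f :: "'k mpoly" and m c assume f: "f \<in> ?J" and m: "m \<in> monomials X"
    have "Poly_Mapping.single m c * f \<in> supported (monomials X)"
      using f m by (auto intro: supported_mult supported_single)
    moreover have "keys p \<inter> V \<noteq> {}" if p: "p \<in> keys (Poly_Mapping.single m c * f)" for p
    proof -
      have "c \<noteq> 0" using p by auto
      then obtain q where "p = m + q" "q \<in> keys f" using p by (auto simp: keys_single_times)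
      then show ?thesis using f by (auto simp: keys_plus_monom)
    qed
    ultimately show "Poly_Mapping.single m c * f \<in> ?J" by blast
  qed auto
  moreover have "var ` V \<subseteq> ?J" using S by (auto simp: var_def)
  ultimately have "I \<subseteq> ?J" using gen(3)[of ?J] by simp
  then show "f \<in> I \<Longrightarrow> m \<in> keys f \<Longrightarrow> keys m \<inter> V \<noteq> {}"
    by (auto dest: subsetD)
  assume m: "m \<in> monomials X" "keys m \<inter> V \<noteq> {}"
  then obtain v where v: "v \<in> keys m" "v \<in> V" by blast
  have "\<forall>i. lookup (Poly_Mapping.single v 1) i \<le> lookup m i"
    using v(1) by (simp add: lookup_single when_def in_keys_iff)
  then obtain q where q: "m = Poly_Mapping.single v 1 + q" using monom_le_iff by blast
  have "var v \<in> I" using gen(2) v by blast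
  then have "var v * Poly_Mapping.single q (1::'k) \<in> I"
    using m(1) by (intro poly_idealD(6)[OF gen(1)] supported_single) (simp_all add: q)
  then show "Poly_Mapping.single m 1 \<in> I" by (simp add: var_def mult_single q)
qed

lemma hilb_vars:
  fixes V :: "nat set"
  assumes V: "V \<subseteq> X"
  defines "I \<equiv> Idl\<^bsub>poly_ring X\<^esub> ((var :: nat \<Rightarrow> ('k::field) mpoly) ` V)"
  shows "hilb X I t = card (hmons (X - V) t)" "I \<inter> supported (monomials (X - V)) \<subseteq> {0}"
proof -
  note I = monom_ideal_vars[OF V, where 'k = 'k, folded I_def]
  have "std_monomials (\<lambda>_. 0) X I t = hmons (X - V) t"
  proof (intro equalityI subsetI)
    fix m assume m: "m \<in> std_monomials (\<lambda>_. 0) X I t"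
    have "keys m \<inter> V = {}"
    proof (rule ccontr)
      assume "keys m \<inter> V \<noteq> {}"
      then have "Poly_Mapping.single m 1 \<in> I" using I(2) m by (simp add: std_monomials_def hmons_def)
      then have "m \<in> leads (\<lambda>_. 0) (I \<inter> supported (hmons X t))"
        unfolding leads_def using m
        by (intro CollectI bexI[of _ "Poly_Mapping.single m 1"]) (auto intro: supported_single simp: std_monomials_def)
      then show False using m by (simp add: std_monomials_def)
    qed
    then show "m \<in> hmons (X - V) t" using m by (auto simp: std_monomials_def hmons_def monomials_def)
  next
    fix m assume m: "m \<in> hmons (X - V) t"
    then have "keys m \<inter> V = {}" by (auto simp: hmons_def monomials_def)
    then have "m \<notin> leads (\<lambda>_. 0) (I \<inter> supported (hmons X t))"
      using I(1) by (auto simp: leads_def)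
    then show "m \<in> std_monomials (\<lambda>_. 0) X I t"
      using m by (auto simp: std_monomials_def hmons_def monomials_def)
  qed
  then show "hilb X I t = card (hmons (X - V) t)" by (simp add: hilb_def)
  show "I \<inter> supported (monomials (X - V)) \<subseteq> {0}"
  proof
    fix f assume f: "f \<in> I \<inter> supported (monomials (X - V))"
    have "keys f = {}"
    proof (rule equals0I)
      fix m assume "m \<in> keys f"
      then show False using I(1)[of f m] f by (auto simp: supported_def monomials_def)
    qed
    then show "f \<in> {0}" by simp
  qed
qed

lemma y_free_iff:
  assumes "f \<in> supported (monomials X)"
  shows "f \<in> supported (monomials (X - {y})) \<longleftrightarrow> y_degree y f \<le> 0"
  using assms unfolding y_degree_le_iff supported_def by (auto simp: monomials_minus_iff subset_iff)

text \<open>For a geometric vertex decomposition this identifies the contraction of N with the part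
  of \<open>I\<close> free of \<open>y\<close>. Properness thus passes from \<open>I\<close> to the
  contraction, and independent sets of variables pass back.\<close>

lemma lead_coeffs_0:
  assumes "poly_ideal X I"
  shows "lead_coeffs y I 0 = I \<inter> supported (monomials (X - {y}))"
proof (intro equalityI subsetI)
  fix g assume "g \<in> lead_coeffs y I 0"
  then obtain f where f: "g = y_coeff y 0 f" "f \<in> I" "y_degree y f \<le> 0"
    by (auto simp: lead_coeffs_def)
  then have "f \<in> supported (monomials (X - {y}))"
    using poly_idealD(2)[OF assms] y_free_iff by blast
  then show "g \<in> I \<inter> supported (monomials (X - {y}))" using f y_coeff_y_free[of f X y 0] by simp
next
  fix g assume g: "g \<in> I \<inter> supported (monomials (X - {y}))"
  then have "y_degree y g \<le> 0" using poly_idealD(2)[OF assms] y_free_iff by blast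
  then show "g \<in> lead_coeffs y I 0"
    using lead_coeffsI[of g I y 0] g y_coeff_y_free[of g X y 0] by simp
qed

lemma lead_y_coeff_nonzero:
  assumes "f \<noteq> 0"
  shows "y_coeff y (y_degree y f) f \<noteq> 0"
proof -
  have ne: "(\<lambda>m. lookup m y) ` keys f \<noteq> {}" using assms by simp
  have "y_degree y f = Max ((\<lambda>m. lookup m y) ` keys f)"
    using ne by (simp add: y_degree_def)
  then have "y_degree y f \<in> (\<lambda>m. lookup m y) ` keys f" using Max_in[OF _ ne] by simp
  then obtain m where m: "m \<in> keys f" "lookup m y = y_degree y f" by auto
  obtain q where "lookup q y = 0" "m = q + Poly_Mapping.single y (y_degree y f)"
    using monom_split[of y m] m by auto
  then have "q \<in> keys (y_coeff y (y_degree y f) f)" using m by (simp add: keys_y_coeff)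
  then show ?thesis by auto
qed

lemma one_coeff_fps: "fps_of_poly [:1, -1 :: rat:] = 1 - fps_X"
  by (simp add: fps_of_poly_pCons)

text \<open>\<open>HA\<close> has the denominator (1 - x)^a, and x/(1 - x) times \<open>HB\<close>
  has (1 - x)^(b + 1). Over the common denominator both numerators have degree at most its exponent,
  the factor x accounting for the extra 1.\<close>

lemma combine_series:
  fixes H HA HB :: "rat fps" and PA PB :: "rat poly"
  assumes H: "(1 - fps_X) * H = (1 - fps_X) * HA + fps_X * HB"
    and A: "degree PA \<le> a" "HA * (1 - fps_X) ^ a = fps_of_poly PA"
    and B: "degree PB \<le> b" "HB * (1 - fps_X) ^ b = fps_of_poly PB"
  shows "\<exists>P. degree P \<le> max a (Suc b) \<and> H * (1 - fps_X) ^ max a (Suc b) = fps_of_poly P"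
proof -
  let ?z = "[:1, -1 :: rat:]"
  define k l where "k = max a (Suc b) - a" and "l = max a (Suc b) - Suc b"
  have u: "max a (Suc b) = a + k" "max a (Suc b) = Suc (b + l)" by (auto simp: k_def l_def)
  have zd: "degree (?z ^ n) \<le> n" for n
    using degree_power_le[of ?z n] by simp
  let ?P = "PA * ?z ^ k + pCons 0 (PB * ?z ^ l)"
  have "degree (PA * ?z ^ k) \<le> max a (Suc b)"
    using degree_mult_le[of PA "?z ^ k"] zd[of k] A(1) unfolding u(1) by linarith
  moreover have "degree (pCons 0 (PB * ?z ^ l)) \<le> max a (Suc b)"
    using degree_mult_le[of PB "?z ^ l"] zd[of l] B(1) degree_pCons_le[of 0 "PB * ?z ^ l"]
    unfolding u(2) by linarith
  ultimately have "degree ?P \<le> max a (Suc b)" by (rule degree_add_le)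
  moreover have "H * (1 - fps_X) ^ max a (Suc b) = fps_of_poly ?P"
  proof -
    have "H * (1 - fps_X) ^ max a (Suc b) = ((1 - fps_X) * H) * (1 - fps_X) ^ (b + l)"
      unfolding u(2) by (simp add: algebra_simps)
    also have "\<dots> = HA * (1 - fps_X) ^ Suc (b + l) + fps_X * (HB * (1 - fps_X) ^ (b + l))"
      unfolding H by (simp add: algebra_simps)
    also have "\<dots> = (HA * (1 - fps_X) ^ a) * (1 - fps_X) ^ k + fps_X * ((HB * (1 - fps_X) ^ b) * (1 - fps_X) ^ l)"
      unfolding u(2)[symmetric] unfolding u(1) by (simp add: power_add mult.assoc)
    also have "\<dots> = fps_of_poly ?P"
      by (simp add: A B fps_of_poly_add fps_of_poly_mult fps_of_poly_power one_coeff_fps fps_of_poly_pCons mult.commute)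
    finally show ?thesis .
  qed
  ultimately show ?thesis by blast
qed

lemma gvd_hilbert_series:
  fixes I :: "('k::field) mpoly set"
  assumes "gvd X I" "graded_ideal X I" "finite X" "1 \<notin> I"
  shows "\<exists>U P. U \<subseteq> X \<and> I \<inter> supported (monomials U) \<subseteq> {0} \<and> degree P \<le> card U \<and>
    hseries X I * (1 - fps_X) ^ card U = fps_of_poly P"
  using assms
proof (induction rule: gvd.induct)
  case (gvd_unit X I)
  then show ?case by (simp add: carrier_poly_ring)
next
  case (gvd_vars X I V)
  have "hilb X I t = hilb (X - V) {0 :: 'k mpoly} t" for t
    using hilb_vars(1)[OF gvd_vars(2), where 'k = 'k] gvd_vars(3) by (simp add: hilb_zero_ideal)
  then have "hseries X I = hseries (X - V) {0 :: 'k mpoly}" by (simp add: hseries_def)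
  then have "hseries X I * (1 - fps_X) ^ card (X - V) = fps_of_poly 1"
    using hseries_zero_ideal[of "X - V", where 'k = 'k] gvd_vars.prems by simp
  moreover have "I \<inter> supported (monomials (X - V)) \<subseteq> {0}"
    using hilb_vars(2)[OF gvd_vars(2), where 'k = 'k] gvd_vars(3) by simp
  ultimately show ?case by (intro exI[of _ "X - V"] exI[of _ 1]) auto
next
  case (gvd_step I X y ord G)
  let ?Y = "X - {y}"
  define A where "A = contraction ?Y (N_ideal X y G)"
  define B where "B = contraction ?Y (C_ideal X y G)"
  have pI: "poly_ideal X I" using gvd_step.prems by (simp add: graded_ideal_def)
  have LA: "lead_coeffs y I 0 = A" and LB: "\<And>i. i \<noteq> 0 \<Longrightarrow> lead_coeffs y I i = B"
    using geometric_vertex_decomposition_lead_coeffs[OF pI gvd_step(3,4)] by (simp_all add: A_def B_def)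
  have LB1: "lead_coeffs y I 1 = B" using LB by simp
  have gA: "graded_ideal ?Y A" and gB: "graded_ideal ?Y B"
    using graded_lead_coeffs[OF gvd_step.prems(1), of y 0] graded_lead_coeffs[OF gvd_step.prems(1), of y 1]
    by (simp_all only: LA LB1)
  have A0: "A = I \<inter> supported (monomials ?Y)" using lead_coeffs_0[OF pI] LA by blast
  then have "1 \<notin> A" using gvd_step.prems by blast
  from gvd_step.IH(2)[folded A_def, OF gA _ this] gvd_step.prems(2)
  obtain UA PA where UA: "UA \<subseteq> ?Y" "A \<inter> supported (monomials UA) \<subseteq> {0}"
    and PA: "degree PA \<le> card UA" "hseries ?Y A * (1 - fps_X) ^ card UA = fps_of_poly PA"
    by auto
  have H: "(1 - fps_X) * hseries X I = (1 - fps_X) * hseries ?Y A + fps_X * hseries ?Y B"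
    by (rule hseries_lead_coeffs[OF gvd_step.prems(1) gvd_step(3) gvd_step.prems(2) LA LB])
  have "supported (monomials UA) \<subseteq> supported (monomials ?Y)"
    using monomials_mono[OF UA(1)] by (auto intro: supported_mono)
  then have UA': "UA \<subseteq> X" "I \<inter> supported (monomials UA) \<subseteq> {0}"
    using UA A0 by blast+
  show ?case
  proof (cases "1 \<in> B")
    \<comment> \<open>The induction hypothesis for \<open>B\<close> assumes properness. For the unit
      ideal the series vanishes, and \<open>I\<close> and \<open>A\<close> have the same
      series.\<close>
    case True
    then have "hseries ?Y B = 0" using gB by (intro hseries_whole) (simp_all add: graded_ideal_def)
    then have "(1 - fps_X) * hseries X I = (1 - fps_X) * hseries ?Y A" using H by simp
    moreover have "1 - fps_X \<noteq> (0 :: rat fps)"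
      by (metis one_neq_zero eq_iff_diff_eq_0 fps_X_neq_one)
    ultimately have "hseries X I = hseries ?Y A" by simp
    then show ?thesis using UA' PA by auto
  next
    case False
    from gvd_step.IH(1)[folded B_def, OF gB _ False] gvd_step.prems(2)
    obtain UB PB where UB: "UB \<subseteq> ?Y" "B \<inter> supported (monomials UB) \<subseteq> {0}"
      and PB: "degree PB \<le> card UB" "hseries ?Y B * (1 - fps_X) ^ card UB = fps_of_poly PB"
      by auto
    have yUB: "y \<notin> UB" "finite UB" using UB gvd_step.prems(2) finite_subset by blast+
    have UB': "insert y UB \<subseteq> X" using UB gvd_step(3) by auto
    \<comment> \<open>The leading coefficient of an element of \<open>I\<close> in K[UB, y] lies in
      \<open>B\<close> and in K[UB], hence is zero. The index is raised by one because
      \<open>LB\<close> excludes index 0.\<close>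
    have UB'': "I \<inter> supported (monomials (insert y UB)) \<subseteq> {0}"
    proof
      fix f assume f: "f \<in> I \<inter> supported (monomials (insert y UB))"
      have "y_coeff y (y_degree y f) f \<in> lead_coeffs y I (Suc (y_degree y f))"
        using lead_coeffs_mono[OF pI gvd_step(3), of "y_degree y f" "Suc (y_degree y f)"]
          lead_coeffsI[of f I y "y_degree y f"] f by auto
      moreover have "insert y UB - {y} = UB" using yUB by auto
      then have "y_coeff y (y_degree y f) f \<in> supported (monomials UB)"
        using y_coeff_supported[of f "insert y UB" y "y_degree y f"] f by auto
      ultimately have "y_coeff y (y_degree y f) f = 0" using LB[of "Suc (y_degree y f)"] UB by auto
      then show "f \<in> {0}" using lead_y_coeff_nonzero by blast
    qed
    obtain P where P: "degree P \<le> max (card UA) (Suc (card UB))"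
        "hseries X I * (1 - fps_X) ^ max (card UA) (Suc (card UB)) = fps_of_poly P"
      using combine_series[OF H PA PB] by blast
    show ?thesis
    \<comment> \<open>Take the larger of the two candidate sets: its size is the exponent produced
      by \<open>combine_series\<close>.\<close>
    proof (cases "card UA \<le> Suc (card UB)")
      case True
      then show ?thesis using P UB' UB'' yUB
        by (intro exI[of _ "insert y UB"] exI[of _ P]) (simp add: max_def)
    next
      case False
      then show ?thesis using P UA' by (intro exI[of _ UA] exI[of _ P]) (simp add: max_def)
    qed
  qed
qed

section \<open>Chains of primes are short\<close>

definition poly_prime :: "nat set \<Rightarrow> ('k::field) mpoly set \<Rightarrow> bool" where
  "poly_prime X P \<longleftrightarrow> poly_ideal X P \<and> 1 \<notin> P \<and>
     (\<forall>f\<in>supported (monomials X). \<forall>g\<in>supported (monomials X). f * g \<in> P \<longrightarrow> f \<in> P \<or> g \<in> P)"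

lemma poly_primeD:
  assumes "poly_prime X P"
  shows "poly_ideal X P" "1 \<notin> P"
    "f * g \<in> P \<Longrightarrow> f \<in> supported (monomials X) \<Longrightarrow> g \<in> supported (monomials X) \<Longrightarrow> f \<in> P \<or> g \<in> P"
  using assms by (auto simp: poly_prime_def)

text \<open>
  If \<open>f \<in> Q - P\<close> for primes \<open>P \<subseteq> Q\<close>, then a family independent modulo \<open>Q\<close> stays independent modulo
  \<open>P\<close> after multiplication by powers of \<open>f\<close>: the lowest power of \<open>f\<close> in a relation can be cancelled.
\<close>

lemma independent_mod_prime_step:
  fixes P Q :: "('k::field) mpoly set"
  assumes P: "poly_prime X P" and Q: "poly_ideal X Q" and PQ: "P \<subseteq> Q" and f: "f \<in> Q" "f \<notin> P"
    and b: "\<And>a. a \<in> A \<Longrightarrow> b a \<in> supported (monomials X)"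
    and ind: "\<And>c. (\<Sum>a\<in>A. const (c a) * b a) \<in> Q \<Longrightarrow> \<forall>a\<in>A. c a = 0"
  shows "(\<Sum>e\<le>k. f ^ e * (\<Sum>a\<in>A. const (c e a) * b a)) \<in> P \<Longrightarrow> \<forall>e\<le>k. \<forall>a\<in>A. c e a = 0"
proof (induction k arbitrary: c)
  case 0
  then have "(\<Sum>a\<in>A. const (c 0 a) * b a) \<in> Q" using PQ by auto
  from ind[OF this] show ?case by simp
next
  case (Suc k)
  define G where "G e = (\<Sum>a\<in>A. const (c e a) * b a)" for e
  define S where "S = (\<Sum>e\<le>k. f ^ e * G (Suc e))"
  have GX: "G e \<in> supported (monomials X)" for e
    unfolding G_def by (intro supported_sum supported_mult b) auto
  have fX: "f \<in> supported (monomials X)" using f poly_idealD(2)[OF Q] by blast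
  have SX: "S \<in> supported (monomials X)"
    unfolding S_def by (intro supported_sum supported_mult supported_power GX fX)
  have "(\<Sum>e\<le>Suc k. f ^ e * G e) = G 0 + f * S"
    by (simp add: sum.atMost_Suc_shift S_def sum_distrib_left mult.assoc del: sum.atMost_Suc)
  then have mem: "G 0 + f * S \<in> P" using Suc.prems by (simp add: G_def del: sum.atMost_Suc)
  have "f * S \<in> Q" by (rule poly_idealD(6)[OF Q f(1) SX])
  moreover have "G 0 + f * S \<in> Q" using mem PQ by blast
  ultimately have "G 0 \<in> Q" using poly_ideal_minus[OF Q] by fastforce
  then have c0: "\<forall>a\<in>A. c 0 a = 0" unfolding G_def by (rule ind)
  then have "G 0 = 0" by (simp add: G_def)
  then have "f * S \<in> P" using mem by simp
  then have "S \<in> P" using poly_primeD(3)[OF P] fX SX f(2) by blast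
  then have "\<forall>e\<le>k. \<forall>a\<in>A. c (Suc e) a = 0"
    unfolding S_def G_def by (rule Suc.IH[of "\<lambda>e. c (Suc e)"])
  show ?case
  proof (intro allI impI)
    fix e assume "e \<le> Suc k"
    then show "\<forall>a\<in>A. c e a = 0"
      using c0 \<open>\<forall>e\<le>k. \<forall>a\<in>A. c (Suc e) a = 0\<close> by (cases e) auto
  qed
qed

text \<open>Exponents form a list, and the tail uses the shifted family, to match an induction that
  removes the first prime of a chain.\<close>

fun power_product :: "(nat \<Rightarrow> 'a::comm_monoid_mult) \<Rightarrow> nat list \<Rightarrow> 'a" where
  "power_product f [] = 1"
| "power_product f (e # es) = f 0 ^ e * power_product (\<lambda>i. f (Suc i)) es"

lemma power_product_supported:
  "(\<And>i. f i \<in> supported (monomials X)) \<Longrightarrow> power_product f es \<in> supported (monomials X)"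
proof (induction es arbitrary: f)
  case (Cons e es)
  then show ?case by (auto intro!: supported_mult supported_power)
qed simp

text \<open>By induction the power products of the later elements are independent modulo the second
  prime, and \<open>independent_mod_prime_step\<close> adjoins the powers of \<open>f 0\<close>. As
  \<open>k\<close> is arbitrary, elements picked from the successive differences are algebraically
  independent modulo the first prime.\<close>

lemma power_product_independent:
  fixes P :: "nat \<Rightarrow> ('k::field) mpoly set"
  assumes "\<And>i. i \<le> l \<Longrightarrow> poly_prime X (P i)" "\<And>i. i < l \<Longrightarrow> P i \<subseteq> P (Suc i)"
    "\<And>i. i < l \<Longrightarrow> f i \<in> P (Suc i) - P i" "\<And>i. f i \<in> supported (monomials X)"
    "(\<Sum>es | set es \<subseteq> {..k} \<and> length es = l. const (c es) * power_product f es) \<in> P 0"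
  shows "\<forall>es. set es \<subseteq> {..k} \<and> length es = l \<longrightarrow> c es = 0"
  using assms
proof (induction l arbitrary: P f c)
  case 0
  have eq: "{es. set es \<subseteq> {..k} \<and> length es = 0} = {[]}" by auto
  have "const (c []) \<in> P 0" using 0(5) unfolding eq by simp
  then have "c [] = 0"
    using poly_ideal_const_mem[of X "P 0" "c []"] poly_primeD(1,2)[OF 0(1)[of 0]] by blast
  then show ?case by auto
next
  case (Suc l)
  let ?A = "{es. set es \<subseteq> {..k} \<and> length es = l}"
  let ?f = "\<lambda>i. f (Suc i)"
  have fin: "finite ?A" by (rule finite_lists_length_eq) simp
  have "(\<Sum>es | set es \<subseteq> {..k} \<and> length es = Suc l. const (c es) * power_product f es) =
      (\<Sum>(e, es)\<in>{..k} \<times> ?A. const (c (e # es)) * power_product f (e # es))"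
    by (rule sum.reindex_bij_witness[of _ "\<lambda>(e, es). e # es" "\<lambda>es. (hd es, tl es)"])
      (auto simp: length_Suc_conv)
  also have "\<dots> = (\<Sum>e\<le>k. f 0 ^ e * (\<Sum>es\<in>?A. const (c (e # es)) * power_product ?f es))"
    by (simp add: sum.cartesian_product[symmetric] sum_distrib_left mult_ac)
  finally have mem: "(\<Sum>e\<le>k. f 0 ^ e * (\<Sum>es\<in>?A. const (c (e # es)) * power_product ?f es)) \<in> P 0"
    using Suc.prems(5) by simp
  have "\<forall>e\<le>k. \<forall>es\<in>?A. c (e # es) = 0"
  proof (rule independent_mod_prime_step[OF _ _ _ _ _ _ _ mem])
    show "poly_prime X (P 0)" "poly_ideal X (P (Suc 0))"
      using Suc.prems(1)[of 0] Suc.prems(1)[of "Suc 0"] poly_primeD(1) by auto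
    show "P 0 \<subseteq> P (Suc 0)" using Suc.prems(2) by blast
    show "f 0 \<in> P (Suc 0)" "f 0 \<notin> P 0" using Suc.prems(3)[of 0] by auto
    show "power_product ?f es \<in> supported (monomials X)" for es
      using Suc.prems(4) by (intro power_product_supported)
    fix c' assume "(\<Sum>es\<in>?A. const (c' es) * power_product ?f es) \<in> P (Suc 0)"
    then have "\<forall>es. set es \<subseteq> {..k} \<and> length es = l \<longrightarrow> c' es = 0"
      using Suc.prems by (intro Suc.IH[of "\<lambda>i. P (Suc i)" ?f c']) auto
    then show "\<forall>es\<in>?A. c' es = 0" by blast
  qed
  then show ?case by (auto simp: length_Suc_conv)
qed

section \<open>Counting power products against monomials of bounded degree\<close>

lemma supported_degree_mult:
  assumes "f \<in> supported {m \<in> monomials X. monom_degree m \<le> a}"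
    "g \<in> supported {m \<in> monomials X. monom_degree m \<le> b}"
  shows "f * g \<in> supported {m \<in> monomials X. monom_degree m \<le> a + b}"
  using assms Poly_Mapping.keys_mult[of f g] unfolding supported_def by (fastforce simp: subset_iff)

lemma supported_degree_power:
  assumes "f \<in> supported {m \<in> monomials X. monom_degree m \<le> a}"
  shows "f ^ e \<in> supported {m \<in> monomials X. monom_degree m \<le> a * e}"
proof (induction e)
  case (Suc e)
  then show ?case using supported_degree_mult[OF assms Suc] by simp
qed (simp add: supported_def)

lemma power_product_degree:
  assumes "\<And>i. f i \<in> supported {m \<in> monomials X. monom_degree m \<le> d}"
  shows "power_product f es \<in> supported {m \<in> monomials X. monom_degree m \<le> d * sum_list es}"
  using assms
proof (induction es arbitrary: f)
  case (Cons e es)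
  have "power_product (\<lambda>i. f (Suc i)) es \<in> supported {m \<in> monomials X. monom_degree m \<le> d * sum_list es}"
    using Cons.prems by (intro Cons.IH)
  from supported_degree_mult[OF supported_degree_power[OF Cons.prems] this]
  show ?case by (simp add: distrib_left)
qed (simp add: supported_def)

text \<open>An independent set is compared with a spanning set of single terms. The family is
  indexed, so injectivity comes first: equal members would satisfy the relation with coefficients 1
  and -1.\<close>

lemma independent_family_card_le:
  fixes b :: "'i \<Rightarrow> ('k::field) mpoly"
  assumes A: "finite A" and M: "finite M" and b: "\<And>a. a \<in> A \<Longrightarrow> b a \<in> supported M"
    and ind: "\<And>c. (\<Sum>a\<in>A. const (c a) * b a) = 0 \<Longrightarrow> \<forall>a\<in>A. c a = 0"
  shows "card A \<le> card M"
proof -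
  interpret vs: vector_space "\<lambda>c (f :: 'k mpoly). const c * f"
    by unfold_locales (simp_all add: algebra_simps const_add const_mult)
  have inj: "inj_on b A"
  proof (rule inj_onI, rule ccontr)
    fix a a' assume a: "a \<in> A" "a' \<in> A" "b a = b a'" "a \<noteq> a'"
    let ?c = "\<lambda>x. if x = a then 1 else if x = a' then - 1 else 0 :: 'k"
    have "(\<Sum>x\<in>A. const (?c x) * b x) = (\<Sum>x\<in>{a, a'}. const (?c x) * b x)"
      by (rule sum.mono_neutral_right) (use A a in auto)
    also have "\<dots> = 0" using a by (simp add: const_uminus)
    finally have "\<forall>x\<in>A. ?c x = 0" by (rule ind)
    then show False using a(1) by auto
  qed
  have "vs.independent (b ` A)"
  proof
    assume "vs.dependent (b ` A)"
    then obtain u where u: "\<exists>v\<in>b ` A. u v \<noteq> 0" "(\<Sum>v\<in>b ` A. const (u v) * v) = 0"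
      using A by (auto simp: vs.dependent_finite)
    have "(\<Sum>a\<in>A. const (u (b a)) * b a) = 0"
      using u(2) by (simp add: sum.reindex[OF inj])
    then show False using ind[of "\<lambda>a. u (b a)"] u(1) by auto
  qed
  moreover have "b ` A \<subseteq> vs.span ((\<lambda>m. Poly_Mapping.single m 1) ` M)"
  proof
    fix f assume "f \<in> b ` A"
    then have "keys f \<subseteq> M" using b by (auto simp: supported_def)
    then have "f = (\<Sum>m\<in>M. const (lookup f m) * Poly_Mapping.single m 1)"
      using sum_single_superset[OF M, of f] by (simp add: single_eq_const_times[symmetric])
    also have "\<dots> \<in> vs.span ((\<lambda>m. Poly_Mapping.single m 1) ` M)"
      by (intro vs.span_sum vs.span_scale vs.span_base) auto
    finally show "f \<in> vs.span ((\<lambda>m. Poly_Mapping.single m 1) ` M)" .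
  qed
  ultimately have "card (b ` A) \<le> card ((\<lambda>m. Poly_Mapping.single m (1::'k)) ` M)"
    using vs.independent_span_bound[of "(\<lambda>m. Poly_Mapping.single m 1) ` M" "b ` A"] M by blast
  also have "\<dots> \<le> card M" using M by (rule card_image_le)
  finally show ?thesis by (simp add: card_image[OF inj])
qed

lemma monomials_degree_le_card:
  assumes "finite X"
  shows "finite {m \<in> monomials X. monom_degree m \<le> d}"
    "card {m \<in> monomials X. monom_degree m \<le> d} \<le> Suc d ^ card X"
proof -
  let ?B = "{m \<in> monomials X. \<forall>i\<in>X. lookup m i \<le> d}"
  have sub: "{m \<in> monomials X. monom_degree m \<le> d} \<subseteq> ?B"
    using lookup_le_monom_degree le_trans by blast
  show "finite {m \<in> monomials X. monom_degree m \<le> d}"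
    by (rule finite_subset[OF sub bounded_monomials_card(2)[OF assms]])
  have "card {m \<in> monomials X. monom_degree m \<le> d} \<le> card ?B"
    by (rule card_mono[OF bounded_monomials_card(2)[OF assms] sub])
  also have "\<dots> = Suc d ^ card X" by (simp add: bounded_monomials_card(1)[OF assms])
  finally show "card {m \<in> monomials X. monom_degree m \<le> d} \<le> Suc d ^ card X" .
qed

lemma sum_list_le_mult_length:
  fixes es :: "nat list"
  shows "set es \<subseteq> {..k} \<Longrightarrow> sum_list es \<le> k * length es"
  by (induction es) auto

text \<open>In n variables, a longer chain would supply n + 1 elements as in
  \<open>power_product_independent\<close>. Their power products with exponents up to k number (k +
  1)^(n + 1), but their degrees are O(k), where there are only O(k^n) monomials.\<close>

lemma prime_chain_length_le:
  fixes P :: "nat \<Rightarrow> ('k::field) mpoly set"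
  assumes X: "finite X" and prime: "\<And>i. i \<le> l \<Longrightarrow> poly_prime X (P i)"
    and strict: "\<And>i. i < l \<Longrightarrow> P i \<subset> P (Suc i)"
  shows "l \<le> card X"
proof (rule ccontr)
  assume "\<not> l \<le> card X"
  define n where "n = card X"
  have nl: "Suc n \<le> l" using \<open>\<not> l \<le> card X\<close> by (simp add: n_def)
  have "\<exists>f. f \<in> supported (monomials X) \<and> (i < Suc n \<longrightarrow> f \<in> P (Suc i) - P i)" for i
  proof (cases "i < Suc n")
    case True
    then obtain f where "f \<in> P (Suc i) - P i" using strict[of i] nl by fastforce
    moreover have "poly_ideal X (P (Suc i))" using prime[of "Suc i"] True nl poly_primeD(1) by fastforce
    ultimately show ?thesis using poly_idealD(2) by blast
  qed (auto intro: exI[of _ 0])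
  then have "\<forall>i. \<exists>f. f \<in> supported (monomials X) \<and> (i < Suc n \<longrightarrow> f \<in> P (Suc i) - P i)" by blast
  from choice[OF this] obtain f0
    where f0: "\<And>i. f0 i \<in> supported (monomials X)" "\<And>i. i < Suc n \<Longrightarrow> f0 i \<in> P (Suc i) - P i"
    by blast
  \<comment> \<open>Zero beyond the relevant indices, so that one degree bound \<open>D\<close>
    holds for every index, as \<open>power_product_degree\<close> requires.\<close>
  define f where "f i = (if i < Suc n then f0 i else 0)" for i
  define D where "D = Max (insert 0 (monom_degree ` (\<Union>i<Suc n. keys (f0 i))))"
  have fX: "f i \<in> supported (monomials X)" for i using f0 by (simp add: f_def)
  have fD: "f i \<in> supported {m \<in> monomials X. monom_degree m \<le> D}" for i
  proof -
    have "monom_degree m \<le> D" if "m \<in> keys (f i)" for m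
      unfolding D_def using that by (intro Max_ge) (auto simp: f_def split: if_splits)
    then show ?thesis using fX by (auto simp: supported_def)
  qed
  have bound: "Suc k ^ Suc n \<le> Suc (D * (k * Suc n)) ^ n" for k
  proof -
    let ?A = "{es. set es \<subseteq> {..k} \<and> length es = Suc n}"
    let ?M = "{m \<in> monomials X. monom_degree m \<le> D * (k * Suc n)}"
    have "card ?A \<le> card ?M"
    proof (rule independent_family_card_le[where b = "power_product f"])
      show "finite ?A" by (rule finite_lists_length_eq) simp
      show "finite ?M" by (rule monomials_degree_le_card[OF X])
      show "power_product f es \<in> supported ?M" if "es \<in> ?A" for es
      proof -
        have "D * sum_list es \<le> D * (k * Suc n)" using sum_list_le_mult_length[where es = es and k = k] that by auto
        then have "{m \<in> monomials X. monom_degree m \<le> D * sum_list es} \<subseteq> ?M" using le_trans by blast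
        from supported_mono[OF power_product_degree[of f X D es, OF fD] this] show ?thesis .
      qed
      fix c assume "(\<Sum>es\<in>?A. const (c es) * power_product f es) = 0"
      moreover have "0 \<in> P 0" using prime[of 0] poly_primeD(1) poly_idealD(3) by blast
      ultimately have "(\<Sum>es\<in>?A. const (c es) * power_product f es) \<in> P 0" by simp
      then have "\<forall>es. set es \<subseteq> {..k} \<and> length es = Suc n \<longrightarrow> c es = 0"
        using prime psubset_imp_subset[OF strict] nl f0 fX
        by (intro power_product_independent[where l = "Suc n" and X = X and P = P and f = f and k = k and c = c]) (auto simp: f_def)
      then show "\<forall>es\<in>?A. c es = 0" by blast
    qed
    moreover have "card ?A = Suc k ^ Suc n" using card_lists_length_eq[of "{..k}" "Suc n"] by simp
    ultimately show ?thesis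
      using monomials_degree_le_card(2)[OF X, of "D * (k * Suc n)"] by (simp add: n_def)
  qed
  \<comment> \<open>\<open>E\<close> satisfies D k (n + 1) + 1 <= E (k + 1). The number of monomials
    is then at most E^n (k + 1)^n, which for k = E^n is smaller than (k + 1)^(n + 1).\<close>
  define E where "E = Suc (D * Suc n)"
  define k where "k = E ^ n"
  have "Suc (D * (k * Suc n)) \<le> E * Suc k" by (simp add: E_def algebra_simps)
  then have "Suc (D * (k * Suc n)) ^ n \<le> (E * Suc k) ^ n" by (rule power_mono) simp
  also have "\<dots> = k * Suc k ^ n" by (simp only: power_mult_distrib k_def[symmetric])
  also have "\<dots> < Suc k ^ Suc n" by simp
  finally show False using bound[of k] by simp
qed

section \<open>Primes of a quotient\<close>

text \<open>Together with \<open>primeideal_quotient_vimage\<close> this is the correspondence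
  between primes of the quotient and primes above \<open>I\<close>. The second claim makes strict
  inclusions survive in the quotient.\<close>

lemma primeideal_quotient_image:
  fixes I :: "('k::field) mpoly set"
  assumes I: "poly_ideal X I" and P: "poly_prime X P" and IP: "I \<subseteq> P"
  shows "primeideal ((\<lambda>f. I +>\<^bsub>poly_ring X\<^esub> f) ` P) (poly_ring X Quot I)"
    and "f \<in> supported (monomials X) \<Longrightarrow>
      I +>\<^bsub>poly_ring X\<^esub> f \<in> (\<lambda>f. I +>\<^bsub>poly_ring X\<^esub> f) ` P \<longleftrightarrow> f \<in> P"
proof -
  let ?\<pi> = "\<lambda>f. I +>\<^bsub>poly_ring X\<^esub> f"
  interpret R: cring "poly_ring X :: 'k mpoly ring" by (rule poly_ring_cring)
  interpret I: ideal I "poly_ring X" using I by (simp add: ideal_iff_poly_ideal)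
  have pP: "poly_ideal X P" using P poly_primeD(1) by blast
  have iff: "?\<pi> f \<in> ?\<pi> ` P \<longleftrightarrow> f \<in> P" if f: "f \<in> supported (monomials X)" for f
  proof
    assume "?\<pi> f \<in> ?\<pi> ` P"
    then obtain g where g: "g \<in> P" "?\<pi> f = ?\<pi> g" by blast
    then have "f - g \<in> P" using coset_eq_iff[OF I f] poly_idealD(2)[OF pP] IP by blast
    then show "f \<in> P" using poly_ideal_minus_iff[OF pP] g by blast
  qed simp
  then show "f \<in> supported (monomials X) \<Longrightarrow> ?\<pi> f \<in> ?\<pi> ` P \<longleftrightarrow> f \<in> P" .
  have carr: "carrier (poly_ring X Quot I) = ?\<pi> ` supported (monomials X)"
    by (auto simp: FactRing_def A_RCOSETS_def' carrier_poly_ring)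
  show "primeideal (?\<pi> ` P) (poly_ring X Quot I)"
  proof (rule primeidealI)
    show "ideal (?\<pi> ` P) (poly_ring X Quot I)"
      using I pP by (intro R.ring_ideal_imp_quot_ideal) (simp_all add: ideal_iff_poly_ideal)
    show "cring (poly_ring X Quot I)" by (rule I.quotient_is_cring[OF R.is_cring])
    show "carrier (poly_ring X Quot I) \<noteq> ?\<pi> ` P"
    proof
      assume "carrier (poly_ring X Quot I) = ?\<pi> ` P"
      then have "?\<pi> ` supported (monomials X) = ?\<pi> ` P" unfolding carr .
      moreover have "?\<pi> 1 \<in> ?\<pi> ` supported (monomials X)" by (rule imageI) simp
      ultimately have "?\<pi> 1 \<in> ?\<pi> ` P" by simp
      then show False using iff[of 1] poly_primeD(2)[OF P] by simp
    qed
    fix a b assume ab: "a \<in> carrier (poly_ring X Quot I)" "b \<in> carrier (poly_ring X Quot I)"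
      "a \<otimes>\<^bsub>poly_ring X Quot I\<^esub> b \<in> ?\<pi> ` P"
    then obtain f g where fg: "a = ?\<pi> f" "b = ?\<pi> g" "f \<in> supported (monomials X)" "g \<in> supported (monomials X)"
      unfolding carr by blast
    have "a \<otimes>\<^bsub>poly_ring X Quot I\<^esub> b = ?\<pi> (f * g)"
      using ring_hom_mult[OF I.rcos_ring_hom, of f g] fg by (simp add: carrier_poly_ring)
    then have "f * g \<in> P" using ab iff[OF supported_mult[OF fg(3,4)]] by simp
    then show "a \<in> ?\<pi> ` P \<or> b \<in> ?\<pi> ` P" using poly_primeD(3)[OF P] fg by blast
  qed
qed

lemma primeideal_quotient_vimage:
  fixes I :: "('k::field) mpoly set"
  assumes I: "poly_ideal X I" and J: "primeideal J (poly_ring X Quot I)"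
  shows "poly_prime X {f \<in> supported (monomials X). I +>\<^bsub>poly_ring X\<^esub> f \<in> J}"
    and "J = (\<lambda>f. I +>\<^bsub>poly_ring X\<^esub> f) ` {f \<in> supported (monomials X). I +>\<^bsub>poly_ring X\<^esub> f \<in> J}"
proof -
  let ?\<pi> = "\<lambda>f. I +>\<^bsub>poly_ring X\<^esub> f"
  interpret R: cring "poly_ring X :: 'k mpoly ring" by (rule poly_ring_cring)
  interpret I: ideal I "poly_ring X" using I by (simp add: ideal_iff_poly_ideal)
  interpret J: primeideal J "poly_ring X Quot I" by (rule J)
  interpret h: ring_hom_ring "poly_ring X" "poly_ring X Quot I" ?\<pi> by (rule I.rcos_ring_hom_ring)
  have carr: "carrier (poly_ring X Quot I) = ?\<pi> ` supported (monomials X)"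
    by (auto simp: FactRing_def A_RCOSETS_def' carrier_poly_ring)
  show Jeq: "J = ?\<pi> ` {f \<in> supported (monomials X). ?\<pi> f \<in> J}"
    using J.a_subset unfolding carr by blast
  have id: "poly_ideal X {f \<in> supported (monomials X). ?\<pi> f \<in> J}"
    using h.ideal_vimage[OF J.is_ideal] by (simp add: ideal_iff_poly_ideal carrier_poly_ring)
  have "1 \<notin> {f \<in> supported (monomials X). ?\<pi> f \<in> J}"
  proof
    assume "1 \<in> {f \<in> supported (monomials X). ?\<pi> f \<in> J}"
    then have "{f \<in> supported (monomials X). ?\<pi> f \<in> J} = supported (monomials X)"
      using poly_ideal_one_iff[OF id] by blast
    then show False using Jeq carr J.I_notcarr by simp
  qed
  moreover have "f \<in> {f \<in> supported (monomials X). ?\<pi> f \<in> J} \<or> g \<in> {f \<in> supported (monomials X). ?\<pi> f \<in> J}"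
    if fg: "f \<in> supported (monomials X)" "g \<in> supported (monomials X)" "f * g \<in> {f \<in> supported (monomials X). ?\<pi> f \<in> J}" for f g
  proof -
    have "?\<pi> f \<otimes>\<^bsub>poly_ring X Quot I\<^esub> ?\<pi> g = ?\<pi> (f * g)"
      using ring_hom_mult[OF I.rcos_ring_hom, of f g] fg by (simp add: carrier_poly_ring)
    then have "?\<pi> f \<in> J \<or> ?\<pi> g \<in> J" using fg carr by (intro J.I_prime) auto
    then show ?thesis using fg by blast
  qed
  ultimately show "poly_prime X {f \<in> supported (monomials X). ?\<pi> f \<in> J}"
    using id unfolding poly_prime_def by blast
qed

text \<open>A chain in the quotient says something about \<open>quot_dim\<close> only if the
  dimension is finite, since \<open>the_enat\<close> is unspecified at infinity. So arbitrary chains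
  in the quotient are also pulled back and bounded from above.\<close>

lemma krull_dim_quotient_bounds:
  fixes I :: "('k::field) mpoly set"
  assumes I: "poly_ideal X I" and X: "finite X"
    and chain: "\<And>i. i \<le> l \<Longrightarrow> poly_prime X (P i)" "\<And>i. i < l \<Longrightarrow> P i \<subset> P (Suc i)" "I \<subseteq> P 0"
  shows "l \<le> quot_dim X I"
proof -
  let ?\<pi> = "\<lambda>f. I +>\<^bsub>poly_ring X\<^esub> f" and ?Q = "poly_ring X Quot I"
  let ?S = "{enat l | l. \<exists>P. (\<forall>i\<le>l. primeideal (P i) ?Q) \<and> (\<forall>i<l. P i \<subset> P (Suc i))}"
  have "s \<le> enat (card X)" if s: "s \<in> ?S" for s
  proof -
    obtain l' J where J: "s = enat l'" "\<And>i. i \<le> l' \<Longrightarrow> primeideal (J i) ?Q" "\<And>i. i < l' \<Longrightarrow> J i \<subset> J (Suc i)"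
      using s by blast
    let ?P = "\<lambda>i. {f \<in> supported (monomials X). ?\<pi> f \<in> J i}"
    have "l' \<le> card X"
    proof (rule prime_chain_length_le[OF X])
      show "poly_prime X (?P i)" if "i \<le> l'" for i
        by (rule primeideal_quotient_vimage(1)[OF I J(2)[OF that]])
      show "?P i \<subset> ?P (Suc i)" if i: "i < l'" for i
      proof -
        obtain x where x: "x \<in> J (Suc i)" "x \<notin> J i" using J(3)[OF i] by blast
        have "J (Suc i) = ?\<pi> ` ?P (Suc i)"
          by (rule primeideal_quotient_vimage(2)[OF I J(2)]) (use i in simp)
        then obtain f where f: "f \<in> ?P (Suc i)" "x = ?\<pi> f" using x(1) by blast
        have "f \<notin> ?P i" using x f by blast
        moreover have "?P i \<subseteq> ?P (Suc i)" using J(3)[OF i] by blast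
        ultimately show ?thesis using f(1) by blast
      qed
    qed
    then show ?thesis using J by simp
  qed
  then have upper: "krull_dim ?Q \<le> enat (card X)"
    unfolding krull_dim_def by (rule Sup_least)
  have PI: "I \<subseteq> P i" if "i \<le> l" for i
    using that by (induction i) (use chain in \<open>auto simp: Suc_le_eq\<close>)
  have "enat l \<in> ?S"
  proof (intro CollectI exI[of _ l] conjI refl exI[of _ "\<lambda>i. ?\<pi> ` P i"] allI impI)
    show "primeideal (?\<pi> ` P i) ?Q" if "i \<le> l" for i
      by (rule primeideal_quotient_image(1)[OF I chain(1)[OF that] PI[OF that]])
    fix i assume i: "i < l"
    obtain f where f: "f \<in> P (Suc i)" "f \<notin> P i" using chain(2)[OF i] by blast
    have "f \<in> supported (monomials X)"
      using poly_idealD(2)[OF poly_primeD(1)[OF chain(1)[of "Suc i"]] f(1)] i by simp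
    then have "?\<pi> f \<notin> ?\<pi> ` P i"
      using primeideal_quotient_image(2)[OF I chain(1) PI, of i] i f by simp
    then show "?\<pi> ` P i \<subset> ?\<pi> ` P (Suc i)" using chain(2)[OF i] f by blast
  qed
  then have "enat l \<le> krull_dim ?Q"
    unfolding krull_dim_def by (rule Sup_upper)
  then show ?thesis
    using upper unfolding quot_dim_def by (cases "krull_dim ?Q") auto
qed

section \<open>Long chains of primes above a graded ideal\<close>

text \<open>The ideal P + <f>, in a form that displays its elements for computation.\<close>

definition add_gen :: "nat set \<Rightarrow> ('k::field) mpoly set \<Rightarrow> 'k mpoly \<Rightarrow> 'k mpoly set" where
  "add_gen X P f = {p + h * f | p h. p \<in> P \<and> h \<in> supported (monomials X)}"

lemma add_genI: "p \<in> P \<Longrightarrow> h \<in> supported (monomials X) \<Longrightarrow> p + h * f \<in> add_gen X P f"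
  by (auto simp: add_gen_def)

lemma poly_ideal_add_gen:
  fixes P :: "('k::field) mpoly set"
  assumes P: "poly_ideal X P" and f: "f \<in> supported (monomials X)"
  shows "poly_ideal X (add_gen X P f)" "P \<subseteq> add_gen X P f" "f \<in> add_gen X P f"
proof -
  show "poly_ideal X (add_gen X P f)"
  proof (rule poly_idealI)
    show "add_gen X P f \<subseteq> supported (monomials X)"
      using poly_idealD(2)[OF P] f by (auto simp: add_gen_def intro!: supported_add supported_mult)
    show "0 \<in> add_gen X P f"
      using add_genI[of 0 P 0 X f] poly_idealD(3)[OF P] by simp
  next
    fix a b assume "a \<in> add_gen X P f" "b \<in> add_gen X P f"
    then obtain p h p' h' where *: "a = p + h * f" "b = p' + h' * f" "p \<in> P" "p' \<in> P"
      "h \<in> supported (monomials X)" "h' \<in> supported (monomials X)"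
      by (auto simp: add_gen_def)
    have eq: "a + b = (p + p') + (h + h') * f" by (simp add: * algebra_simps)
    show "a + b \<in> add_gen X P f"
      unfolding eq by (intro add_genI supported_add poly_idealD(4)[OF P] *)
  next
    fix a g :: "'k mpoly" assume "a \<in> add_gen X P f" and g: "g \<in> supported (monomials X)"
    then obtain p h where *: "a = p + h * f" "p \<in> P" "h \<in> supported (monomials X)"
      by (auto simp: add_gen_def)
    have eq: "g * a = g * p + (g * h) * f" by (simp add: * algebra_simps)
    show "g * a \<in> add_gen X P f"
      unfolding eq by (intro add_genI supported_mult poly_idealD(5)[OF P] * g)
  qed
  show "P \<subseteq> add_gen X P f"
    using add_genI[of _ P 0 X f] by fastforce
  show "f \<in> add_gen X P f"
    using add_genI[of 0 P 1 X f] poly_idealD(3)[OF P] by simp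
qed

lemma hcomp_times_homogeneous:
  assumes f: "f \<in> supported (hmons X s)"
  shows "hcomp t (h * f) = (if s \<le> t then hcomp (t - s) h * f else 0)"
proof -
  have "hcomp t (\<Sum>m\<in>A. Poly_Mapping.single m (lookup h m) * f) =
      (\<Sum>m\<in>A. hcomp t (Poly_Mapping.single m (lookup h m) * f))" for A
    by (induction A rule: infinite_finite_induct) (simp_all add: restrict_terms_add)
  from this[of "keys h"] have "hcomp t (h * f) = (\<Sum>m\<in>keys h. hcomp t (Poly_Mapping.single m (lookup h m) * f))"
    by (simp add: sum_distrib_right[symmetric] sum_single_keys)
  also have "\<dots> = (\<Sum>m\<in>keys h. if monom_degree m + s = t then Poly_Mapping.single m (lookup h m) * f else 0)"
  proof (rule sum.cong)
    fix m assume "m \<in> keys h"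
    have "hcomp r f = (if r = s then f else 0)" for r
      using f by (auto intro!: restrict_terms_id restrict_terms_eq_0 simp: supported_def hmons_def)
    then show "hcomp t (Poly_Mapping.single m (lookup h m) * f) =
        (if monom_degree m + s = t then Poly_Mapping.single m (lookup h m) * f else 0)"
      by (auto simp: hcomp_single_times)
  qed simp
  also have "\<dots> = (\<Sum>m\<in>{m\<in>keys h. monom_degree m + s = t}. Poly_Mapping.single m (lookup h m)) * f"
    by (simp add: sum.inter_filter[symmetric] sum_distrib_right)
  also have "(\<Sum>m\<in>{m\<in>keys h. monom_degree m + s = t}. Poly_Mapping.single m (lookup h m)) =
      (if s \<le> t then hcomp (t - s) h else 0)"
  proof (cases "s \<le> t")
    case True
    have "hcomp (t - s) h = (\<Sum>m\<in>keys (hcomp (t - s) h). Poly_Mapping.single m (lookup (hcomp (t - s) h) m))"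
      by (rule sum_single_keys[symmetric])
    also have "\<dots> = (\<Sum>m\<in>{m\<in>keys h. monom_degree m + s = t}. Poly_Mapping.single m (lookup h m))"
      using True by (intro sum.cong) auto
    finally show ?thesis using True by simp
  qed auto
  finally show ?thesis by simp
qed

lemma graded_add_gen:
  assumes P: "graded_ideal X P" and f: "f \<in> supported (hmons X s)"
  shows "graded_ideal X (add_gen X P f)"
proof -
  have pP: "poly_ideal X P" using P by (simp add: graded_ideal_def)
  have fX: "f \<in> supported (monomials X)" using f by (rule supported_mono) (auto simp: hmons_def)
  have "hcomp t a \<in> add_gen X P f" if a: "a \<in> add_gen X P f" for a t
  proof -
    obtain p h where *: "a = p + h * f" "p \<in> P" "h \<in> supported (monomials X)"
      using a by (auto simp: add_gen_def)
    have eq: "hcomp t a = hcomp t p + (if s \<le> t then hcomp (t - s) h else 0) * f"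
      by (simp add: * restrict_terms_add hcomp_times_homogeneous[OF f])
    have "hcomp t p \<in> P" using P * by (simp add: graded_ideal_def)
    then show ?thesis
      unfolding eq using * by (intro add_genI) (simp_all add: restrict_terms_supported)
  qed
  then show ?thesis using poly_ideal_add_gen(1)[OF pP fX] by (simp add: graded_ideal_def)
qed

section \<open>Homogeneous components and primality\<close>

lemma restrict_terms_degree_mem:
  assumes P: "poly_ideal X P" and f: "\<And>t. Q t \<Longrightarrow> hcomp t f \<in> P"
  shows "restrict_terms (\<lambda>m. Q (monom_degree m)) f \<in> P"
proof -
  let ?D = "{t \<in> monom_degree ` keys f. Q t}"
  have "restrict_terms (\<lambda>m. Q (monom_degree m)) f = (\<Sum>t\<in>?D. hcomp t f)"
  proof (rule poly_mapping_eqI)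
    fix m
    show "lookup (restrict_terms (\<lambda>m. Q (monom_degree m)) f) m = lookup (\<Sum>t\<in>?D. hcomp t f) m"
    proof (cases "m \<in> keys f")
      case True
      then show ?thesis by (simp add: lookup_sum)
    next
      case False
      then show ?thesis by (simp add: lookup_sum in_keys_iff)
    qed
  qed
  also have "\<dots> \<in> P" by (rule poly_ideal_sum[OF P]) (use f in auto)
  finally show ?thesis .
qed

text \<open>Split both factors into top component and rest: products in which one factor is below
  its top degree do not reach degree s + t.\<close>

lemma hcomp_top_mult:
  assumes f: "\<And>m. m \<in> keys f \<Longrightarrow> monom_degree m \<le> s" and g: "\<And>m. m \<in> keys g \<Longrightarrow> monom_degree m \<le> t"
  shows "hcomp (s + t) (f * g) = hcomp s f * hcomp t (g :: ('k::field) mpoly)"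
proof -
  define f' g' where "f' = f - hcomp s f" and "g' = g - hcomp t g"
  have f': "monom_degree m < s" if "m \<in> keys f'" for m
    using that f[of m] by (cases "monom_degree m = s") (auto simp: f'_def in_keys_iff lookup_minus)
  have g': "monom_degree m < t" if "m \<in> keys g'" for m
    using that g[of m] by (cases "monom_degree m = t") (auto simp: g'_def in_keys_iff lookup_minus)
  have k: "hcomp (s + t) (a * b) = 0" if "\<And>m n. m \<in> keys a \<Longrightarrow> n \<in> keys b \<Longrightarrow> monom_degree m + monom_degree n \<noteq> s + t"
    for a b :: "'k mpoly"
    using that Poly_Mapping.keys_mult[of a b] by (intro restrict_terms_eq_0) fastforce
  have "f * g = hcomp s f * hcomp t g + (f' * g + hcomp s f * g')"
    by (simp add: f'_def g'_def algebra_simps)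
  moreover have "hcomp (s + t) (f' * g) = 0" using f' g by (intro k) fastforce
  moreover have "hcomp (s + t) (hcomp s f * g') = 0" using g' by (intro k) fastforce
  moreover have "hcomp (s + t) (hcomp s f * hcomp t g) = hcomp s f * hcomp t g"
    using Poly_Mapping.keys_mult[of "hcomp s f" "hcomp t g"] by (intro restrict_terms_id) fastforce
  ultimately show ?thesis by (simp add: restrict_terms_add)
qed

text \<open>If neither factor lies in \<open>P\<close>, cut each off above its highest component
  outside \<open>P\<close>, which changes it only modulo \<open>P\<close>. The top component of the
  new product is the product of these two components, contrary to \<open>hprime\<close>.\<close>

lemma graded_prime_imp_prime:
  fixes P :: "('k::field) mpoly set"
  assumes P: "graded_ideal X P" and one: "1 \<notin> P"
    and hprime: "\<And>s t f g. f \<in> supported (hmons X s) \<Longrightarrow> g \<in> supported (hmons X t) \<Longrightarrow> f * g \<in> P \<Longrightarrow> f \<in> P \<or> g \<in> P"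
  shows "poly_prime X P"
proof -
  have pP: "poly_ideal X P" using P by (simp add: graded_ideal_def)
  have top: "\<exists>s. hcomp s f \<notin> P \<and> f - restrict_terms (\<lambda>m. monom_degree m \<le> s) f \<in> P"
    if f: "f \<in> supported (monomials X)" "f \<notin> P" for f
  proof -
    let ?S = "{s. hcomp s f \<notin> P}"
    have "?S \<subseteq> monom_degree ` keys f"
    proof
      fix s assume s: "s \<in> ?S"
      have "hcomp s f \<noteq> 0" using s poly_idealD(3)[OF pP] by auto
      then have "keys (hcomp s f) \<noteq> {}" unfolding keys_eq_empty .
      then obtain m where "m \<in> keys (hcomp s f)" by blast
      then show "s \<in> monom_degree ` keys f" by auto
    qed
    then have fin: "finite ?S" by (rule finite_subset) simp
    have "?S \<noteq> {}"
    proof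
      assume "?S = {}"
      then have "restrict_terms (\<lambda>m. True) f \<in> P"
        by (intro restrict_terms_degree_mem[OF pP, where Q = "\<lambda>_. True"]) auto
      moreover have "restrict_terms (\<lambda>m. True) f = f" by (rule restrict_terms_id) simp
      ultimately show False using f by simp
    qed
    then have s: "Max ?S \<in> ?S" using fin by (rule Max_in[rotated])
    have "restrict_terms (\<lambda>m. Max ?S < monom_degree m) f \<in> P"
    proof (rule restrict_terms_degree_mem[OF pP])
      fix t assume "Max ?S < t"
      then show "hcomp t f \<in> P" using Max_ge[OF fin, of t] by force
    qed
    moreover have "restrict_terms (\<lambda>m. Max ?S < monom_degree m) f =
        f - restrict_terms (\<lambda>m. monom_degree m \<le> Max ?S) f"
      by (rule poly_mapping_eqI) (simp add: lookup_minus)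
    ultimately show ?thesis using s by auto
  qed
  have "f \<in> P \<or> g \<in> P" if fg: "f \<in> supported (monomials X)" "g \<in> supported (monomials X)" "f * g \<in> P" for f g
  proof (rule ccontr)
    assume n: "\<not> (f \<in> P \<or> g \<in> P)"
    obtain s where s: "hcomp s f \<notin> P" "f - restrict_terms (\<lambda>m. monom_degree m \<le> s) f \<in> P"
      using top[OF fg(1)] n by blast
    obtain t where t: "hcomp t g \<notin> P" "g - restrict_terms (\<lambda>m. monom_degree m \<le> t) g \<in> P"
      using top[OF fg(2)] n by blast
    define f' where "f' = restrict_terms (\<lambda>m. monom_degree m \<le> s) f"
    define g' where "g' = restrict_terms (\<lambda>m. monom_degree m \<le> t) g"
    have X': "f' \<in> supported (monomials X)" "g' \<in> supported (monomials X)"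
      using fg by (simp_all add: f'_def g'_def restrict_terms_supported)
    have "f' * g' = f * g - ((f - f') * g + f' * (g - g'))" by (simp add: algebra_simps)
    also have "\<dots> \<in> P"
      by (intro poly_ideal_minus[OF pP] poly_idealD(4)[OF pP] fg(3)
          poly_idealD(6)[OF pP s(2)[folded f'_def] fg(2)] poly_idealD(5)[OF pP t(2)[folded g'_def] X'(1)])
    finally have "hcomp (s + t) (f' * g') \<in> P" using P by (simp add: graded_ideal_def)
    moreover have "hcomp (s + t) (f' * g') = hcomp s f' * hcomp t g'"
      by (rule hcomp_top_mult) (auto simp: f'_def g'_def)
    moreover have "hcomp s f' = hcomp s f" "hcomp t g' = hcomp t g"
      by (auto intro!: poly_mapping_eqI simp: f'_def g'_def)
    moreover have "hcomp s f \<in> supported (hmons X s)" "hcomp t g \<in> supported (hmons X t)"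
      using fg by (auto simp: supported_def hmons_def)
    ultimately show False using hprime[of "hcomp s f" s "hcomp t g" t] s t by simp
  qed
  then show ?thesis using pP one by (simp add: poly_prime_def)
qed

text \<open>Maximality among graded ideals allows comparison with P + <f> only for homogeneous f, so
  primality is first shown for homogeneous elements. There it is the usual argument for an ideal
  maximal among those disjoint from a multiplicative set, here the nonzero elements of K[U].\<close>

lemma exists_graded_prime:
  fixes I :: "('k::field) mpoly set"
  assumes I: "graded_ideal X I" and U: "U \<subseteq> X" and IU: "I \<inter> supported (monomials U) \<subseteq> {0}"
  shows "\<exists>P. poly_prime X P \<and> graded_ideal X P \<and> I \<subseteq> P \<and> P \<inter> supported (monomials U) \<subseteq> {0}"
proof -
  define A where "A = {J. graded_ideal X J \<and> I \<subseteq> J \<and> J \<inter> supported (monomials U) \<subseteq> {0}}"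
  have "\<exists>M\<in>A. \<forall>J\<in>A. M \<subseteq> J \<longrightarrow> J = M"
  proof (rule subset_Zorn_nonempty)
    show "A \<noteq> {}" using I IU unfolding A_def by blast
    fix C assume C: "C \<noteq> {}" "subset.chain A C"
    then have CA: "C \<subseteq> A" by (simp add: subset.chain_def)
    have dir: "\<exists>J\<in>C. f \<in> J \<and> g \<in> J" if f: "f \<in> \<Union> C" and g: "g \<in> \<Union> C" for f g
    proof -
      obtain J K where JK: "J \<in> C" "f \<in> J" "K \<in> C" "g \<in> K" using f g by blast
      then have "J \<subseteq> K \<or> K \<subseteq> J" using C(2) by (auto simp: subset_chain_def)
      then show ?thesis using JK by blast
    qed
    have id: "poly_ideal X J" if "J \<in> C" for J using that CA by (auto simp: graded_ideal_def A_def)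
    have "poly_ideal X (\<Union> C)"
    proof (rule poly_idealI)
      show "\<Union> C \<subseteq> supported (monomials X)" by (intro Union_least poly_idealD(1) id)
      obtain J where "J \<in> C" using C(1) by blast
      then show "0 \<in> \<Union> C" using poly_idealD(3)[OF id] by blast
    next
      fix f g assume "f \<in> \<Union> C" "g \<in> \<Union> C"
      then obtain J where "J \<in> C" "f \<in> J" "g \<in> J" using dir by blast
      then show "f + g \<in> \<Union> C" using poly_idealD(4)[OF id] by blast
    next
      fix f g :: "'k mpoly" assume "f \<in> \<Union> C" and g: "g \<in> supported (monomials X)"
      then obtain J where "J \<in> C" "f \<in> J" by blast
      then show "g * f \<in> \<Union> C" using poly_idealD(5)[OF id _ g] by blast
    qed
    moreover have "hcomp t f \<in> \<Union> C" if f: "f \<in> \<Union> C" for f t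
    proof -
      obtain J where J: "J \<in> C" "f \<in> J" using f by blast
      then have "graded_ideal X J" using CA unfolding A_def by blast
      then have "hcomp t f \<in> J" using J by (simp add: graded_ideal_def)
      then show ?thesis using J by blast
    qed
    ultimately have "graded_ideal X (\<Union> C)" by (simp add: graded_ideal_def)
    moreover have "I \<subseteq> \<Union> C" using C(1) CA unfolding A_def by blast
    moreover have "\<Union> C \<inter> supported (monomials U) \<subseteq> {0}"
    proof
      fix f assume "f \<in> \<Union> C \<inter> supported (monomials U)"
      then obtain J where J: "J \<in> C" "f \<in> J \<inter> supported (monomials U)" by blast
      then have "J \<inter> supported (monomials U) \<subseteq> {0}" using CA unfolding A_def by blast
      then show "f \<in> {0}" using J(2) by blast
    qed
    ultimately show "\<Union> C \<in> A" unfolding A_def by blast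
  qed
  then obtain P where PA: "P \<in> A" and PM: "\<forall>J\<in>A. P \<subseteq> J \<longrightarrow> J = P" by (rule bexE)
  have P: "graded_ideal X P" "I \<subseteq> P" "P \<inter> supported (monomials U) \<subseteq> {0}"
    using PA by (simp_all add: A_def)
  have max: "J = P" if "graded_ideal X J" "I \<subseteq> J" "J \<inter> supported (monomials U) \<subseteq> {0}" "P \<subseteq> J" for J
  proof -
    have "J \<in> A" using that by (simp add: A_def)
    then show ?thesis using PM that(4) by blast
  qed
  have pP: "poly_ideal X P" using P by (simp add: graded_ideal_def)
  have UX: "supported (monomials U) \<subseteq> supported (monomials X)"
    using monomials_mono[OF U] by (auto intro: supported_mono)
  have ext: "\<exists>p h. p \<in> P \<and> h \<in> supported (monomials X) \<and> p + h * f \<in> supported (monomials U) \<and> p + h * f \<noteq> 0"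
    if f: "f \<in> supported (hmons X s)" "f \<notin> P" for f s
  proof (rule ccontr)
    assume no: "\<not> ?thesis"
    have fX: "f \<in> supported (monomials X)" using f(1) by (rule supported_mono) (auto simp: hmons_def)
    note gen = poly_ideal_add_gen[OF pP fX]
    have "add_gen X P f = P"
    proof (rule max)
      show "add_gen X P f \<inter> supported (monomials U) \<subseteq> {0}" using no by (auto simp: add_gen_def)
    qed (use graded_add_gen[OF P(1) f(1)] gen P in auto)
    then show False using gen f by blast
  qed
  have "poly_prime X P"
  proof (rule graded_prime_imp_prime[OF P(1)])
    show "1 \<notin> P" using P(3) supported_one[of U] by fastforce
    fix s t f g assume f: "f \<in> supported (hmons X s)" and g: "g \<in> supported (hmons X t)" and fg: "f * g \<in> P"
    show "f \<in> P \<or> g \<in> P"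
    proof (rule ccontr)
      assume n: "\<not> (f \<in> P \<or> g \<in> P)"
      obtain p h where u: "p \<in> P" "h \<in> supported (monomials X)" "p + h * f \<in> supported (monomials U)" "p + h * f \<noteq> 0"
        using ext[OF f] n by blast
      obtain p' h' where v: "p' \<in> P" "h' \<in> supported (monomials X)" "p' + h' * g \<in> supported (monomials U)" "p' + h' * g \<noteq> 0"
        using ext[OF g] n by blast
      \<comment> \<open>Both factors are nonzero elements of K[U]. Since f g is in \<open>P\<close>,
        so is this product, and it must vanish, although there are no zero divisors.\<close>
      have "(p + h * f) * (p' + h' * g) = p * (p' + h' * g) + ((h * f) * p' + (h * h') * (f * g))"
        by (simp add: algebra_simps)
      also have "\<dots> \<in> P"
      proof (intro poly_idealD(4)[OF pP])
        show "p * (p' + h' * g) \<in> P" using u v UX by (intro poly_idealD(6)[OF pP]) auto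
        have "f \<in> supported (monomials X)" using f by (rule supported_mono) (auto simp: hmons_def)
        then show "(h * f) * p' \<in> P" using u v by (intro poly_idealD(5)[OF pP] supported_mult)
        show "(h * h') * (f * g) \<in> P" by (rule poly_idealD(5)[OF pP fg supported_mult[OF u(2) v(2)]])
      qed
      finally have "(p + h * f) * (p' + h' * g) \<in> {0}" using P(3) supported_mult[OF u(3) v(3)] by blast
      then show False using u(4) v(4) by simp
    qed
  qed
  then show ?thesis using P by blast
qed

text \<open>Behind this is the exact sequence (R/P)_(t-1) -> (R/P)_t -> (R/(P + <x_u>))_t of
  multiplication by the variable and projection, summed over the degrees. In terms of monomials: the
  weight prefers small exponents of \<open>u\<close>, so a standard monomial of \<open>P\<close> is
  either standard for the larger ideal or x_u times a standard monomial of one degree less.\<close>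

lemma hilb_le_add_gen_var:
  fixes P :: "('k::field) mpoly set"
  assumes P: "graded_ideal X P" and u: "u \<in> X" and X: "finite X"
  shows "hilb X P t \<le> (\<Sum>s\<le>t. hilb X (add_gen X P (var u)) s)"
proof -
  let ?J = "add_gen X P (var u)" and ?w = "\<lambda>m::monom. - int (lookup m u)"
  define v :: monom where "v = Poly_Mapping.single u 1"
  have v: "lookup v i = (if i = u then 1 else 0)" "monom_degree v = 1" "v \<in> monomials X" for i
    using u by (auto simp: v_def lookup_single when_def monomials_single)
  have pP: "poly_ideal X P" using P by (simp add: graded_ideal_def)
  have pJ: "poly_ideal X ?J" using poly_ideal_add_gen(1)[OF pP supported_var[OF u]] .
  \<comment> \<open>All terms of a multiple of \<open>var u\<close> contain the variable and so have
    smaller weight than \<open>m\<close>. The leading monomial \<open>m\<close> of \<open>g\<close>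
    therefore already comes from the part in \<open>P\<close>.\<close>
  have low: "m \<in> std_monomials ?w X ?J t" if m: "m \<in> std_monomials ?w X P t" "lookup m u = 0" for m t
  proof (rule ccontr)
    assume "m \<notin> std_monomials ?w X ?J t"
    then have "m \<in> leads ?w (?J \<inter> supported (hmons X t))" using m by (simp add: std_monomials_def)
    then obtain g where g: "g \<in> ?J" "g \<in> supported (hmons X t)" "m \<in> keys g"
      and ge: "\<And>m'. m' \<in> keys g \<Longrightarrow> (?w m', m') \<le> (?w m, m)"
      unfolding leads_def by blast
    obtain p h where ph: "g = p + h * var u" "p \<in> P" using g(1) by (auto simp: add_gen_def)
    let ?q = "hcomp t (h * var u)"
    have q: "lookup m' u \<noteq> 0" if "m' \<in> keys ?q" for m'
    proof -
      have "m' \<in> keys (h * var u)" using that by simp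
      then obtain a b where "m' = a + b" "b \<in> keys (var u :: 'k mpoly)"
        using Poly_Mapping.keys_mult[of h "var u"] by blast
      then show ?thesis by (simp add: var_def lookup_add)
    qed
    have "hcomp t g = g" using g(2) by (intro restrict_terms_id) (auto simp: supported_def hmons_def)
    then have gp: "g = hcomp t p + ?q" by (simp add: ph restrict_terms_add)
    have lg: "lookup g m' = lookup (hcomp t p) m' + lookup ?q m'" for m'
      using arg_cong[OF gp, of "\<lambda>f. lookup f m'"] lookup_add[of "hcomp t p" ?q m'] by (rule trans)
    have pt: "hcomp t p \<in> P \<inter> supported (hmons X t)"
      using P ph(2) poly_idealD(2)[OF pP ph(2)] by (auto simp: graded_ideal_def supported_def hmons_def)
    have "lookup ?q m = 0" using q[of m] m(2) by (meson in_keys_iff)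
    then have "lookup (hcomp t p) m \<noteq> 0" using g(3) lg[of m]
      by (simp add: in_keys_iff del: lookup_restrict_terms)
    then have "m \<in> keys (hcomp t p)" by (simp only: in_keys_iff not_False_eq_True)
    moreover have "(?w m', m') \<le> (?w m, m)" if "m' \<in> keys (hcomp t p)" for m'
    proof (cases "m' \<in> keys g")
      case True
      then show ?thesis by (rule ge)
    next
      case False
      then have "lookup (hcomp t p) m' + lookup ?q m' = 0" using lg[of m']
        by (simp add: in_keys_iff del: lookup_restrict_terms)
      moreover have "lookup (hcomp t p) m' \<noteq> 0" using that by (simp only: in_keys_iff not_False_eq_True)
      ultimately have "lookup ?q m' \<noteq> 0"
        by (auto simp del: lookup_restrict_terms)
      then have "m' \<in> keys ?q" by (simp only: in_keys_iff not_False_eq_True)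
      then show ?thesis using q[of m'] m(2) by simp
    qed
    ultimately have "m \<in> leads ?w (P \<inter> supported (hmons X t))"
      using pt unfolding leads_def by blast
    then show False using m(1) by (simp add: std_monomials_def)
  qed
  \<comment> \<open>Dividing a standard monomial by the variable leaves a standard one. The conjunct
    \<open>t \<noteq> 0\<close> matters because \<open>t - 1\<close> is truncated: it rules out this
    case in degree 0.\<close>
  have high: "\<exists>m'\<in>std_monomials ?w X P (t - 1). t \<noteq> 0 \<and> m = v + m'"
    if m: "m \<in> std_monomials ?w X P t" "lookup m u \<noteq> 0" for m t
  proof -
    have "\<forall>i. lookup v i \<le> lookup m i" using m(2) by (simp add: v)
    then obtain m' where m': "m = v + m'" using monom_le_iff by blast
    have deg: "m' \<in> hmons X (t - 1)" "t \<noteq> 0" using m(1) unfolding m' by (auto simp: std_monomials_def hmons_def v)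
    have "m' \<notin> leads ?w (P \<inter> supported (hmons X (t - 1)))"
    proof
      assume "m' \<in> leads ?w (P \<inter> supported (hmons X (t - 1)))"
      then obtain f where f: "f \<in> P" "f \<in> supported (hmons X (t - 1))" "m' \<in> keys f"
        and ge: "\<And>a. a \<in> keys f \<Longrightarrow> (?w a, a) \<le> (?w m', m')"
        unfolding leads_def by blast
      let ?f = "Poly_Mapping.single v 1 * f"
      have k: "keys ?f = (+) v ` keys f" by (rule keys_single_times) simp
      have "?f \<in> P" by (intro poly_idealD(5)[OF pP f(1)] supported_single v)
      moreover have "?f \<in> supported (hmons X t)"
        using f(2) deg(2) unfolding supported_def mem_Collect_eq k by (auto simp: hmons_def v subset_iff)
      moreover have "m \<in> keys ?f" using f(3) unfolding m' k by (rule imageI)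
      moreover have "(?w b, b) \<le> (?w m, m)" if b: "b \<in> keys ?f" for b
      proof -
        obtain a where "b = v + a" "a \<in> keys f" using b unfolding k by blast
        then show ?thesis using ge[of a] by (simp add: m' lookup_add v)
      qed
      ultimately have "m \<in> leads ?w (P \<inter> supported (hmons X t))" unfolding leads_def by blast
      then show False using m(1) by (simp add: std_monomials_def)
    qed
    then have "m' \<in> std_monomials ?w X P (t - 1)" using deg(1) unfolding std_monomials_def by (rule DiffI[rotated])
    then show ?thesis using deg(2) m' by blast
  qed
  have fin: "finite (std_monomials ?w X K t)" for K :: "'k mpoly set" and t
    using X by (simp add: std_monomials_def)
  show ?thesis
  proof (induction t)
    case 0
    have "std_monomials ?w X P 0 \<subseteq> std_monomials ?w X ?J 0"
    proof
      fix m assume m: "m \<in> std_monomials ?w X P 0"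
      show "m \<in> std_monomials ?w X ?J 0"
      proof (cases "lookup m u = 0")
        case True
        then show ?thesis by (rule low[OF m])
      next
        case False
        then show ?thesis using high[OF m False] by blast
      qed
    qed
    then have "card (std_monomials ?w X P 0) \<le> card (std_monomials ?w X ?J 0)" by (rule card_mono[OF fin])
    then show ?case unfolding hilb_eq_card[OF pP X, of _ ?w] hilb_eq_card[OF pJ X, of _ ?w] by simp
  next
    case (Suc t)
    have "std_monomials ?w X P (Suc t) \<subseteq> std_monomials ?w X ?J (Suc t) \<union> (+) v ` std_monomials ?w X P t"
    proof
      fix m assume m: "m \<in> std_monomials ?w X P (Suc t)"
      show "m \<in> std_monomials ?w X ?J (Suc t) \<union> (+) v ` std_monomials ?w X P t"
      proof (cases "lookup m u = 0")
        case True
        then show ?thesis using low[OF m] by blast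
      next
        case False
        then obtain m' where "m' \<in> std_monomials ?w X P t" "m = v + m'"
          using high[OF m False] unfolding diff_Suc_1 by blast
        then show ?thesis by blast
      qed
    qed
    then have "card (std_monomials ?w X P (Suc t)) \<le>
        card (std_monomials ?w X ?J (Suc t) \<union> (+) v ` std_monomials ?w X P t)"
      by (rule card_mono[rotated]) (simp add: fin)
    also have "\<dots> \<le> card (std_monomials ?w X ?J (Suc t)) + card ((+) v ` std_monomials ?w X P t)"
      by (rule card_Un_le)
    also have "card ((+) v ` std_monomials ?w X P t) \<le> card (std_monomials ?w X P t)"
      by (rule card_image_le[OF fin])
    finally have "hilb X P (Suc t) \<le> hilb X ?J (Suc t) + hilb X P t"
      unfolding hilb_eq_card[OF pP X, of _ ?w] hilb_eq_card[OF pJ X, of _ ?w] by simp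
    then show ?case using Suc by simp
  qed
qed

text \<open>The weight is the degree outside \<open>U\<close> and vanishes exactly on the monomials
  in \<open>U\<close>. If such a monomial led a form in \<open>P\<close>, all terms of the form
  would have weight 0, and the form would lie in K[U].\<close>

lemma card_hmons_le_hilb:
  fixes P :: "('k::field) mpoly set"
  assumes P: "poly_ideal X P" and X: "finite X" and U: "U \<subseteq> X" and PU: "P \<inter> supported (monomials U) \<subseteq> {0}"
  shows "card (hmons U t) \<le> hilb X P t"
proof -
  let ?w = "\<lambda>m::monom. int (\<Sum>i\<in>X - U. lookup m i)"
  have w0: "?w m = 0 \<longleftrightarrow> m \<in> monomials U" if m: "m \<in> monomials X" for m
  proof -
    have "?w m = 0 \<longleftrightarrow> (\<forall>i\<in>X - U. lookup m i = 0)" using X by (simp only: of_nat_eq_0_iff sum_eq_0_iff finite_Diff)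
    also have "\<dots> \<longleftrightarrow> m \<in> monomials U" using m by (auto simp: monomials_def in_keys_iff)
    finally show ?thesis .
  qed
  have "hmons U t \<subseteq> std_monomials ?w X P t"
  proof
    fix m assume m: "m \<in> hmons U t"
    then have mX: "m \<in> hmons X t" and mU: "m \<in> monomials U"
      using monomials_mono[OF U] by (auto simp: hmons_def)
    have "m \<notin> leads ?w (P \<inter> supported (hmons X t))"
    proof
      assume "m \<in> leads ?w (P \<inter> supported (hmons X t))"
      then obtain f where f: "f \<in> P" "f \<in> supported (hmons X t)" "m \<in> keys f"
        and ge: "\<And>m'. m' \<in> keys f \<Longrightarrow> (?w m', m') \<le> (?w m, m)"
        unfolding leads_def by blast
      have wm: "?w m = 0" using w0[of m] mX mU by (simp add: hmons_def)
      have "m' \<in> monomials U" if m': "m' \<in> keys f" for m'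
      proof -
        have "m' \<in> monomials X" using f(2) m' by (auto simp: supported_def hmons_def)
        moreover have "?w m' \<le> ?w m" using ge[OF m'] by (auto simp: less_le)
        then have "?w m' = 0" unfolding wm using of_nat_0_le_iff[of "\<Sum>i\<in>X - U. lookup m' i"] by linarith
        ultimately show ?thesis using w0 by blast
      qed
      then have "f \<in> supported (monomials U)" by (auto simp: supported_def)
      then have "f = 0" using PU f(1) by blast
      then show False using f(3) by simp
    qed
    then show "m \<in> std_monomials ?w X P t" using mX by (simp add: std_monomials_def)
  qed
  then have "card (hmons U t) \<le> card (std_monomials ?w X P t)"
    using X by (intro card_mono) (simp_all add: std_monomials_def)
  then show ?thesis by (simp only: hilb_eq_card[OF P X, of t ?w])
qed

text \<open>Take the monomials in all variables but one with exponents up to \<open>s\<close>; their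
  degree is at most v s, and a power of the remaining variable fills it up.\<close>

lemma hmons_card_ge:
  assumes "finite U" "card U = Suc v"
  shows "Suc s ^ v \<le> card (hmons U (v * s))"
proof -
  obtain u where u: "u \<in> U" using assms by fastforce
  define U' where "U' = U - {u}"
  have U': "finite U'" "card U' = v" using assms u by (auto simp: U'_def)
  let ?B = "{m \<in> monomials U'. \<forall>i\<in>U'. lookup m i \<le> s}"
  let ?f = "\<lambda>m. m + Poly_Mapping.single u (v * s - monom_degree m)"
  have u0: "lookup m u = 0" if "m \<in> monomials U'" for m
    using that by (simp add: U'_def monomials_minus_iff)
  have "inj_on ?f ?B"
  proof (rule inj_onI)
    fix a b assume ab: "a \<in> ?B" "b \<in> ?B" "?f a = ?f b"
    then have "lookup (?f a) u = lookup (?f b) u" by simp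
    then have "v * s - monom_degree a = v * s - monom_degree b" using ab(1,2) u0 by (simp add: lookup_add)
    then show "a = b" using ab(3) by simp
  qed
  moreover have "?f ` ?B \<subseteq> hmons U (v * s)"
  proof
    fix x assume "x \<in> ?f ` ?B"
    then obtain m where m: "m \<in> monomials U'" "\<forall>i\<in>U'. lookup m i \<le> s" "x = ?f m" by blast
    have "monom_degree m = (\<Sum>i\<in>U'. lookup m i)"
      using m(1) U' by (intro monom_degree_eq_sum) (auto simp: monomials_def)
    also have "\<dots> \<le> v * s" using sum_bounded_above[of U' "lookup m" s] m(2) U' by simp
    finally show "x \<in> hmons U (v * s)"
      using m(1) monomials_mono[of U' U] u unfolding m(3)
      by (auto simp: hmons_def U'_def monomials_single)
  qed
  ultimately have "card ?B \<le> card (hmons U (v * s))"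
    using assms(1) by (intro card_inj_on_le) simp_all
  then show ?thesis using bounded_monomials_card(1)[OF U'(1), of "\<lambda>_. s"] U' by simp
qed

text \<open>
  If every set of \<open>v\<close> variables supports a nonzero element of \<open>J\<close>, then a standard monomial of \<open>J\<close> has
  fewer than \<open>v\<close> large exponents.
\<close>

lemma hilb_sum_le:
  fixes J :: "('k::field) mpoly set"
  assumes J: "graded_ideal X J" and X: "finite X"
    and dep: "\<And>U. U \<subseteq> X \<Longrightarrow> card U = v \<Longrightarrow> \<exists>f\<in>J \<inter> supported (monomials U). f \<noteq> 0"
  shows "\<exists>C. \<forall>t. (\<Sum>s\<le>t. hilb X J s) \<le> (if v = 0 then 0 else C * Suc t ^ (v - 1))"
proof -
  let ?S = "\<lambda>s. std_monomials (\<lambda>_. 0) X J s"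
  have pJ: "poly_ideal X J" using J by (simp add: graded_ideal_def)
  have "\<exists>p\<in>monomials U. \<forall>q s. p + q \<in> hmons X s \<longrightarrow> p + q \<notin> ?S s" if U: "U \<subseteq> X" "card U = v" for U
  proof -
    obtain f where f: "f \<in> J" "f \<in> supported (monomials U)" "f \<noteq> 0" using dep[OF U] by blast
    obtain p where p: "p \<in> keys f" and ge: "\<forall>m\<in>keys f. (0::int, m) \<le> (0, p)"
      using leading_key_exists[OF f(3), of "\<lambda>_. 0"] by blast
    have "p + q \<notin> ?S s" if pq: "p + q \<in> hmons X s" for q s
    proof -
      \<comment> \<open>\<open>f\<close> need not be homogeneous, but its component in the degree of
        \<open>p\<close> still has \<open>p\<close> as leading monomial. Hence no multiple of
        \<open>p\<close> is standard.\<close>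
      let ?g = "Poly_Mapping.single q 1 * hcomp (monom_degree p) f"
      have k: "keys ?g = (+) q ` keys (hcomp (monom_degree p) f)" by (rule keys_single_times) simp
      have q: "q \<in> monomials X" using pq by (simp add: hmons_def)
      have "hcomp (monom_degree p) f \<in> J" using J f by (simp add: graded_ideal_def)
      then have "?g \<in> J" by (rule poly_idealD(5)[OF pJ _ supported_single[OF q]])
      moreover have "?g \<in> supported (hmons X s)"
        using poly_idealD(2)[OF pJ f(1)] pq
        unfolding supported_def mem_Collect_eq k by (auto simp: hmons_def)
      moreover have "p + q \<in> keys ?g" using p unfolding k by (auto simp: add.commute)
      moreover have "\<forall>m\<in>keys ?g. (0::int, m) \<le> (0, p + q)"
        using ge unfolding k by (auto simp: add.commute)
      ultimately have "p + q \<in> leads (\<lambda>_. 0) (J \<inter> supported (hmons X s))"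
        unfolding leads_def by blast
      then show ?thesis by (simp add: std_monomials_def)
    qed
    moreover have "p \<in> monomials U" using f(2) p by (auto simp: supported_def)
    ultimately show ?thesis by blast
  qed
  then have "\<forall>U\<in>{U. U \<subseteq> X \<and> card U = v}. \<exists>p. p \<in> monomials U \<and> (\<forall>q s. p + q \<in> hmons X s \<longrightarrow> p + q \<notin> ?S s)"
    by blast
  from bchoice[OF this] obtain p where p: "\<And>U. U \<subseteq> X \<Longrightarrow> card U = v \<Longrightarrow> p U \<in> monomials U"
      "\<And>U q s. U \<subseteq> X \<Longrightarrow> card U = v \<Longrightarrow> p U + q \<in> hmons X s \<Longrightarrow> p U + q \<notin> ?S s"
    by blast
  \<comment> \<open>\<open>D\<close> bounds every exponent of every chosen \<open>p U\<close>, so a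
    monomial whose exponents reach \<open>D\<close> on all of \<open>U\<close> is a multiple of
    \<open>p U\<close>.\<close>
  define D where "D = Max (insert 0 ((\<lambda>U. monom_degree (p U)) ` Pow X))"
  have D: "monom_degree (p U) \<le> D" if "U \<subseteq> X" for U
    unfolding D_def using that X by (intro Max_ge) auto
  define F where "F = {B. B \<subseteq> X \<and> card B < v}"
  have finF: "finite F" using X by (auto simp: F_def)
  let ?box = "\<lambda>t B. {m \<in> monomials X. \<forall>i\<in>X. lookup m i \<le> (if i \<in> B then t else D)}"
  have sub: "?S s \<subseteq> (\<Union>B\<in>F. ?box t B)" if st: "s \<le> t" for s t
  proof
    fix m assume m: "m \<in> ?S s"
    then have mX: "m \<in> monomials X" and deg: "monom_degree m = s" by (auto simp: std_monomials_def hmons_def)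
    define B where "B = {i \<in> X. D \<le> lookup m i}"
    have "card B < v"
    proof (rule ccontr)
      assume "\<not> card B < v"
      then obtain U where U: "U \<subseteq> B" "card U = v" by (meson not_le obtain_subset_with_card_n)
      have UX: "U \<subseteq> X" using U by (auto simp: B_def)
      have "lookup (p U) i \<le> lookup m i" for i
      proof (cases "i \<in> U")
        case True
        have "lookup (p U) i \<le> D" using lookup_le_monom_degree D[OF UX] by (rule le_trans)
        also have "D \<le> lookup m i" using True U by (auto simp: B_def)
        finally show ?thesis .
      next
        case False
        then have "i \<notin> keys (p U)" using p(1)[OF UX U(2)] by (auto simp: monomials_def)
        then show ?thesis by (simp add: in_keys_iff)
      qed
      then obtain q where "m = p U + q" using monom_le_iff by blast
      then show False using p(2)[OF UX U(2), of q s] m by (simp add: std_monomials_def)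
    qed
    then have "B \<in> F" by (auto simp: F_def B_def)
    moreover have "lookup m i \<le> (if i \<in> B then t else D)" if "i \<in> X" for i
      using lookup_le_monom_degree[of m i] deg st that by (auto simp: B_def)
    ultimately show "m \<in> (\<Union>B\<in>F. ?box t B)" using mX by blast
  qed
  have box: "card (?box t B) \<le> Suc D ^ card X * Suc t ^ (v - 1)" if B: "B \<in> F" for t B
  proof -
    have BX: "B \<subseteq> X" "card B \<le> v - 1" using B by (auto simp: F_def)
    have "card (?box t B) = (\<Prod>i\<in>X. Suc (if i \<in> B then t else D))"
      by (rule bounded_monomials_card(1)[OF X])
    also have "\<dots> = (\<Prod>i\<in>X \<inter> B. Suc t) * (\<Prod>i\<in>X \<inter> - B. Suc D)"
      unfolding if_distrib[of Suc] by (rule prod.If_cases[OF X, of "\<lambda>i. i \<in> B", simplified])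
    also have "\<dots> = Suc t ^ card B * Suc D ^ card (X \<inter> - B)"
      using BX by (simp add: Int_absorb1)
    also have "\<dots> \<le> Suc t ^ (v - 1) * Suc D ^ card X"
      using BX X by (intro mult_mono power_increasing card_mono) auto
    finally show ?thesis by (simp add: mult.commute)
  qed
  \<comment> \<open>For v = 0 the family \<open>F\<close> is empty and the sum is 0; otherwise
    \<open>v - 1\<close> is the true predecessor.\<close>
  have "(\<Sum>s\<le>t. hilb X J s) \<le> (if v = 0 then 0 else card F * Suc D ^ card X * Suc t ^ (v - 1))" for t
  proof -
    have "(\<Sum>s\<le>t. hilb X J s) = card (\<Union>s\<in>{..t}. ?S s)"
      unfolding hilb_def
    proof (rule card_UN_disjoint[symmetric])
      show "\<forall>s\<in>{..t}. finite (?S s)" using X by (simp add: std_monomials_def)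
      show "\<forall>s\<in>{..t}. \<forall>s'\<in>{..t}. s \<noteq> s' \<longrightarrow> ?S s \<inter> ?S s' = {}"
        by (auto simp: std_monomials_def hmons_def)
    qed simp
    also have "\<dots> \<le> card (\<Union>B\<in>F. ?box t B)"
      using sub finF bounded_monomials_card(2)[OF X] by (intro card_mono) (auto simp: UN_subset_iff)
    also have "\<dots> \<le> (\<Sum>B\<in>F. card (?box t B))" by (rule card_UN_le[OF finF])
    also have "\<dots> \<le> (\<Sum>B\<in>F. Suc D ^ card X * Suc t ^ (v - 1))" by (intro sum_mono box)
    finally show ?thesis by (auto simp: F_def)
  qed
  then show ?thesis by blast
qed

text \<open>Otherwise \<open>hilb_sum_le\<close> bounds the sums for P + <x_u> by order v - 1, while
  the forms in K[U] make the Hilbert function of \<open>P\<close> grow with order \<open>v\<close>.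
  The count yields some set of the right size, which need not lie in \<open>U\<close>.\<close>

lemma independent_set_add_gen_var:
  fixes P :: "('k::field) mpoly set"
  assumes P: "graded_ideal X P" and X: "finite X" and U: "U \<subseteq> X" "card U = Suc v" "u \<in> U"
    and PU: "P \<inter> supported (monomials U) \<subseteq> {0}"
  shows "\<exists>U'\<subseteq>X. card U' = v \<and> add_gen X P (var u) \<inter> supported (monomials U') \<subseteq> {0}"
proof (rule ccontr)
  assume no: "\<not> ?thesis"
  let ?J = "add_gen X P (var u)"
  have uX: "u \<in> X" and pP: "poly_ideal X P" using U P by (auto simp: graded_ideal_def)
  have "(var u :: 'k mpoly) \<in> supported (hmons X 1)"
    using uX by (simp add: var_def supported_def hmons_def monomials_single)
  then have gJ: "graded_ideal X ?J" by (rule graded_add_gen[OF P])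
  have "\<exists>f\<in>?J \<inter> supported (monomials U'). f \<noteq> 0" if "U' \<subseteq> X" "card U' = v" for U'
    using no that by blast
  from hilb_sum_le[OF gJ X this] obtain C
    where C: "\<And>t. (\<Sum>s\<le>t. hilb X ?J s) \<le> (if v = 0 then 0 else C * Suc t ^ (v - 1))" by blast
  have bound: "Suc s ^ v \<le> (if v = 0 then 0 else C * Suc (v * s) ^ (v - 1))" for s
  proof -
    have "Suc s ^ v \<le> card (hmons U (v * s))" using hmons_card_ge[of U v s] U X finite_subset by blast
    also have "\<dots> \<le> hilb X P (v * s)" by (rule card_hmons_le_hilb[OF pP X U(1) PU])
    also have "\<dots> \<le> (\<Sum>r\<le>v * s. hilb X ?J r)" by (rule hilb_le_add_gen_var[OF P uX X])
    also have "\<dots> \<le> (if v = 0 then 0 else C * Suc (v * s) ^ (v - 1))" by (rule C)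
    finally show ?thesis .
  qed
  show False
  proof (cases v)
    case 0
    then show False using bound[of 0] by simp
  next
    case (Suc w)
    \<comment> \<open>With v = w + 1, the estimate v s + 1 <= (v + 1)(s + 1) turns the bound into (s
      + 1)^(w + 1) <= C (v + 1)^w (s + 1)^w, and this choice makes it s + 1 <= s.\<close>
    define s where "s = C * Suc v ^ w"
    have "Suc s * Suc s ^ w \<le> C * Suc (v * s) ^ w" using bound[of s] Suc by simp
    also have "\<dots> \<le> C * (Suc v * Suc s) ^ w" by (intro mult_left_mono power_mono) auto
    also have "\<dots> = s * Suc s ^ w" by (simp only: power_mult_distrib s_def mult.assoc)
    finally have "Suc s \<le> s" by (simp only: mult_le_cancel2) simp
    then show False by simp
  qed
qed

text \<open>Each step replaces \<open>I\<close> by P + <x_u> and \<open>U\<close> by another set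
  with one element less, so both vary in the induction. The inclusion of \<open>P\<close> in the
  next prime is strict because the variable is a nonzero element of K[U] and hence outside
  \<open>P\<close>.\<close>

lemma exists_prime_chain:
  fixes I :: "('k::field) mpoly set"
  assumes X: "finite X"
  shows "graded_ideal X I \<Longrightarrow> U \<subseteq> X \<Longrightarrow> card U = v \<Longrightarrow> I \<inter> supported (monomials U) \<subseteq> {0} \<Longrightarrow>
    \<exists>P. (\<forall>i\<le>v. poly_prime X (P i)) \<and> (\<forall>i<v. P i \<subset> P (Suc i)) \<and> I \<subseteq> P 0"
proof (induction v arbitrary: I U)
  case 0
  then obtain P where "poly_prime X P" "I \<subseteq> P" using exists_graded_prime by blast
  then show ?case by (intro exI[of _ "\<lambda>_. P"]) simp
next
  case (Suc v)
  obtain P where P: "poly_prime X P" "graded_ideal X P" "I \<subseteq> P" "P \<inter> supported (monomials U) \<subseteq> {0}"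
    using exists_graded_prime[OF Suc.prems(1,2,4)] by blast
  obtain u where u: "u \<in> U" using Suc.prems(3) by fastforce
  then have uX: "u \<in> X" using Suc.prems by blast
  let ?J = "add_gen X P (var u)"
  obtain U' where U': "U' \<subseteq> X" "card U' = v" "?J \<inter> supported (monomials U') \<subseteq> {0}"
    using independent_set_add_gen_var[OF P(2) X Suc.prems(2,3) u P(4)] by blast
  have "(var u :: 'k mpoly) \<in> supported (hmons X 1)"
    using uX by (simp add: var_def supported_def hmons_def monomials_single)
  then have gJ: "graded_ideal X ?J" by (rule graded_add_gen[OF P(2)])
  obtain Q where Q: "\<forall>i\<le>v. poly_prime X (Q i)" "\<forall>i<v. Q i \<subset> Q (Suc i)" "?J \<subseteq> Q 0"
    using Suc.IH[OF gJ U'] by blast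
  note gen = poly_ideal_add_gen[OF poly_primeD(1)[OF P(1)] supported_var[OF uX]]
  have "(var u :: 'k mpoly) \<notin> P"
  proof
    assume "(var u :: 'k mpoly) \<in> P"
    then have "var u = (0 :: 'k mpoly)" using P(4) supported_var[OF u] by blast
    then show False by (metis keys_eq_empty keys_single insert_not_empty one_neq_zero var_def)
  qed
  then have "P \<subset> Q 0" using gen Q(3) by blast
  then show ?case
    using P Q by (intro exI[of _ "\<lambda>i. case i of 0 \<Rightarrow> P | Suc j \<Rightarrow> Q j"]) (auto split: nat.splits)
qed

section \<open>Rational Hilbert series and Hilbert polynomials\<close>

text \<open>The polynomial (t + 1)...(t + u)/u!, that is, the binomial coefficient
  \<open>t + u\<close> over \<open>u\<close> as a function of t.\<close>

definition binomial_poly :: "nat \<Rightarrow> rat poly" where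
  "binomial_poly u = smult (inverse (fact u)) (\<Prod>k\<in>{1..u}. [:of_nat k, 1:])"

lemma poly_binomial_poly: "poly (binomial_poly u) (of_nat t) = of_nat ((t + u) choose u)"
proof (induction u)
  case (Suc u)
  have "Suc u * ((t + Suc u) choose Suc u) = (t + Suc u) * ((t + u) choose u)"
    using Suc_times_binomial[of u "t + u"] by simp
  then have "of_nat (Suc u) * (of_nat ((t + Suc u) choose Suc u) :: rat) = of_nat (t + Suc u) * of_nat ((t + u) choose u)"
    by (metis of_nat_mult)
  moreover have "of_nat (Suc u) * poly (binomial_poly (Suc u)) (of_nat t) =
      of_nat (t + Suc u) * poly (binomial_poly u) (of_nat t)"
  proof -
    have "(\<Prod>k\<in>{1..Suc u}. [:of_nat k, 1 :: rat:]) = (\<Prod>k\<in>{1..u}. [:of_nat k, 1:]) * [:of_nat (Suc u), 1:]"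
      by (simp add: mult.commute)
    then have "poly (binomial_poly (Suc u)) (of_nat t) =
        inverse (of_nat (Suc u)) * (of_nat (t + Suc u) * poly (binomial_poly u) (of_nat t))"
      by (simp only: binomial_poly_def poly_smult poly_mult fact_Suc inverse_mult_distrib poly_pCons of_nat_add) simp
    then show ?thesis by (simp del: of_nat_Suc)
  qed
  ultimately have "of_nat (Suc u) * poly (binomial_poly (Suc u)) (of_nat t) =
      of_nat (Suc u) * (of_nat ((t + Suc u) choose Suc u) :: rat)"
    using Suc.IH by simp
  then show ?case by (simp del: of_nat_Suc binomial_Suc_Suc)
qed (simp add: binomial_poly_def)

text \<open>The argument is one of the roots -1, ..., -u. A convolution with binomial coefficients
  can therefore be extended beyond index \<open>t\<close> without changing its value.\<close>

lemma poly_binomial_poly_neg: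
  assumes "t < j" "j \<le> t + u"
  shows "poly (binomial_poly u) (of_nat t - of_nat j) = 0"
proof -
  have "j - t \<in> {1..u}" using assms by auto
  moreover have "of_nat t - of_nat j + (of_nat (j - t) :: rat) = 0" using assms by (simp add: of_nat_diff)
  ultimately have "(\<Prod>k\<in>{1..u}. of_nat t - of_nat j + (of_nat k :: rat)) = 0"
    by (intro prod_zero) auto
  then show ?thesis by (simp add: binomial_poly_def poly_prod add.commute)
qed

text \<open>By Pascal's rule, multiplication by 1 - x lowers \<open>u\<close> by one.\<close>

lemma fps_binomial: "Abs_fps (\<lambda>t. of_nat ((t + u) choose u)) * (1 - fps_X) ^ Suc u = (1 :: rat fps)"
proof (induction u)
  case 0
  show ?case
  proof (rule fps_ext)
    fix n
    show "fps_nth (Abs_fps (\<lambda>t. of_nat ((t + 0) choose 0)) * (1 - fps_X) ^ Suc 0) n = fps_nth (1 :: rat fps) n"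
      by (cases n) (simp_all add: right_diff_distrib)
  qed
next
  case (Suc u)
  have "Abs_fps (\<lambda>t. of_nat ((t + Suc u) choose Suc u)) * (1 - fps_X) = (Abs_fps (\<lambda>t. of_nat ((t + u) choose u)) :: rat fps)"
  proof (rule fps_ext)
    fix n
    show "fps_nth (Abs_fps (\<lambda>t. of_nat ((t + Suc u) choose Suc u)) * (1 - fps_X)) n =
        fps_nth (Abs_fps (\<lambda>t. of_nat ((t + u) choose u)) :: rat fps) n"
      by (cases n) (simp_all add: right_diff_distrib)
  qed
  moreover have "Abs_fps (\<lambda>t. of_nat ((t + Suc u) choose Suc u)) * (1 - fps_X) ^ Suc (Suc u) =
      (Abs_fps (\<lambda>t. of_nat ((t + Suc u) choose Suc u)) * (1 - fps_X)) * (1 - fps_X :: rat fps) ^ Suc u"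
    by (simp only: power_Suc mult.assoc)
  ultimately show ?case using Suc by (simp only:)
qed

text \<open>For a numerator of degree below \<open>u\<close> the coefficients are a combination of
  shifted binomial polynomials. Degree exactly \<open>u\<close> adds a constant to the series, which
  shows only at t = 0.\<close>

lemma rational_series_polynomial:
  fixes F :: "rat fps"
  assumes P: "degree P \<le> u" and F: "F * (1 - fps_X) ^ u = fps_of_poly P"
  shows "\<exists>p. \<forall>t\<ge>1. poly p (of_nat t) = fps_nth F t"
proof (cases u)
  case 0
  then obtain c where "P = [:c:]" using P by (metis degree_0_id le_zero_eq)
  then have "F = fps_const c" using F 0 by (simp add: fps_of_poly_const)
  then show ?thesis by (intro exI[of _ 0]) auto
next
  case (Suc v)
  let ?z = "[:1, -1 :: rat:]"
  \<comment> \<open>(1 - x)^u has the coefficient (-1)^u at index \<open>u\<close>, so this multiple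
    of it cancels the coefficient of \<open>P\<close> there.\<close>
  define c where "c = coeff P u * (-1) ^ u"
  define P' where "P' = P - smult c (?z ^ u)"
  have zd: "degree (?z ^ u) \<le> u" using degree_power_le[of ?z u] by simp
  have zc: "coeff (?z ^ u) u = (-1) ^ u"
    using lead_coeff_power[of ?z u] degree_power_eq[of ?z u] by simp
  have P': "coeff P' j = 0" if "j \<ge> u" for j
  proof (cases "j = u")
    case True
    then show ?thesis by (simp add: P'_def zc c_def mult.assoc power_mult_distrib[symmetric])
  next
    case False
    then show ?thesis using that P zd by (simp add: P'_def coeff_eq_0)
  qed
  define F' where "F' = F - fps_const c"
  let ?S = "Abs_fps (\<lambda>t. of_nat ((t + v) choose v)) :: rat fps"
  have P'z: "F' * (1 - fps_X) ^ u = fps_of_poly P'"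
    by (simp add: F'_def P'_def left_diff_distrib F fps_of_poly_diff fps_of_poly_smult fps_of_poly_power one_coeff_fps)
  have "F' = F' * (?S * (1 - fps_X) ^ u)" using fps_binomial[of v] Suc by (simp only: mult_1_right)
  also have "\<dots> = (F' * (1 - fps_X) ^ u) * ?S" by (simp only: mult_ac)
  finally have F': "F' = fps_of_poly P' * ?S" unfolding P'z .
  let ?p = "\<Sum>j\<le>v. smult (coeff P' j) (binomial_poly v \<circ>\<^sub>p [:- of_nat j, 1:])"
  have "poly ?p (of_nat t) = fps_nth F t" if t: "t \<ge> 1" for t
  proof -
    let ?g = "\<lambda>j. coeff P' j * poly (binomial_poly v) (of_nat t - of_nat j)"
    have "fps_nth F t = fps_nth F' t" using t by (simp add: F'_def)
    also have "\<dots> = (\<Sum>j=0..t. coeff P' j * of_nat ((t - j + v) choose v))"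
      by (simp add: F' fps_mult_nth)
    also have "\<dots> = (\<Sum>j=0..t. ?g j)"
    proof (intro sum.cong refl)
      fix j assume "j \<in> {0..t}"
      then have eq: "(of_nat t - of_nat j :: rat) = of_nat (t - j)" by (simp add: of_nat_diff)
      show "coeff P' j * of_nat ((t - j + v) choose v) = ?g j" by (simp only: eq poly_binomial_poly)
    qed
    \<comment> \<open>The added terms vanish because \<open>t - j\<close> runs through roots of the
      binomial polynomial. The range can then be cut to j <= v, independently of \<open>t\<close>,
      since \<open>P'\<close> has no coefficients from u = v + 1 on.\<close>
    also have "\<dots> = (\<Sum>j\<le>t + v. ?g j)"
    proof (rule sum.mono_neutral_left)
      show "\<forall>j\<in>{..t + v} - {0..t}. ?g j = 0"
        using poly_binomial_poly_neg[of t _ v] by auto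
    qed auto
    also have "\<dots> = (\<Sum>j\<le>v. ?g j)"
      using P' Suc by (intro sum.mono_neutral_right) auto
    also have "\<dots> = poly ?p (of_nat t)" by (simp add: poly_sum poly_pcompose algebra_simps)
    finally show ?thesis by simp
  qed
  then show ?thesis by blast
qed

section \<open>Uniqueness of the Hilbert polynomial and of the h-polynomial\<close>

lemma poly_eqI_eventually_nat:
  fixes p q :: "rat poly"
  assumes "\<forall>\<^sub>F t in sequentially. poly p (of_nat t) = poly q (of_nat t)"
  shows "p = q"
proof (rule ccontr)
  assume "p \<noteq> q"
  then have fin: "finite {x. poly (p - q) x = 0}" by (intro poly_roots_finite) simp
  obtain N where N: "\<And>t. t \<ge> N \<Longrightarrow> poly p (of_nat t) = poly q (of_nat t)"
    using assms unfolding eventually_sequentially by blast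
  have "of_nat ` {N..} \<subseteq> {x :: rat. poly (p - q) x = 0}" using N by auto
  then have "finite (of_nat ` {N..} :: rat set)" using fin finite_subset by blast
  then have "finite {N..}" by (rule finite_imageD) (simp add: inj_on_def)
  then show False by (simp add: infinite_Ici)
qed

lemma hilbert_polynomial_eqI:
  assumes "\<And>t. t \<ge> N \<Longrightarrow> poly p (of_nat t) = of_nat (hilbert_function X I t)"
  shows "hilbert_polynomial X I = p"
proof -
  have ev: "\<forall>\<^sub>F t in sequentially. poly p (of_nat t) = of_nat (hilbert_function X I t)"
    using assms unfolding eventually_sequentially by blast
  show ?thesis
    unfolding hilbert_polynomial_def
  proof (rule the_equality, rule ev)
    fix q :: "rat poly"
    assume "\<forall>\<^sub>F t in sequentially. poly q (of_nat t) = of_nat (hilbert_function X I t)"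
    with ev have "\<forall>\<^sub>F t in sequentially. poly q (of_nat t) = poly p (of_nat t)"
      by eventually_elim simp
    then show "q = p" by (rule poly_eqI_eventually_nat)
  qed
qed

text \<open>A power of 1 - x is a unit among power series, so the division in the definition is
  exact and the defining equation has one solution.\<close>

lemma h_polynomial_eqI:
  assumes "hilbert_series X I * (1 - fps_X) ^ quot_dim X I = fps_of_poly h"
  shows "h_polynomial X I = h"
proof -
  have unit: "is_unit ((1 - fps_X :: rat fps) ^ quot_dim X I)" by simp
  have iff: "hilbert_series X I = fps_of_poly h' / (1 - fps_X) ^ quot_dim X I \<longleftrightarrow> h' = h" for h'
    using unit_eq_div2[OF unit, of "hilbert_series X I" "fps_of_poly h'"] assms
    by (auto simp: fps_of_poly_eq_iff)
  show ?thesis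
    unfolding h_polynomial_def iff by (rule the_eq_trivial)
qed

theorem theorem1p2:
  fixes n :: nat
    and I :: "('k::{alg_closed_field, field_char_0}) mpoly set"
  assumes "ideal I (poly_ring {1..n})"
    and "I \<noteq> carrier (poly_ring {1..n})"
    and "homogeneous_ideal {1..n} I"
    and "gvd {1..n} I"
  shows "a_invariant {1..n} I \<le> 0 \<and>
    (\<forall>t::nat. 1 \<le> t \<longrightarrow> of_nat (hilbert_function {1..n} I t) = poly (hilbert_polynomial {1..n} I) (of_nat t))"
proof -
  define X where "X = {1..n}"
  have X: "finite X" by (simp add: X_def)
  have I: "poly_ideal X I" using assms(1) by (simp add: X_def ideal_iff_poly_ideal)
  have one: "1 \<notin> I" using assms(2) poly_ideal_one_iff[OF I] by (simp add: X_def carrier_poly_ring)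
  have graded: "graded_ideal X I" using assms(3) homogeneous_ideal_imp_graded by (simp add: X_def)
  obtain U P where U: "U \<subseteq> X" "I \<inter> supported (monomials U) \<subseteq> {0}" and P: "degree P \<le> card U"
      "hseries X I * (1 - fps_X) ^ card U = fps_of_poly P"
    using gvd_hilbert_series[OF assms(4)[folded X_def] graded X one] by blast
  obtain C where "\<forall>i\<le>card U. poly_prime X (C i)" "\<forall>i<card U. C i \<subset> C (Suc i)" "I \<subseteq> C 0"
    using exists_prime_chain[OF X graded U(1) refl U(2)] by blast
  then have d: "card U \<le> quot_dim X I" by (intro krull_dim_quotient_bounds[OF I X, of _ C]) auto
  have hf: "hilbert_function X I t = hilb X I t" for t
    by (rule hilbert_function_eq_hilb[OF I one X])
  then have hs: "hilbert_series X I = hseries X I" by (simp add: hilbert_series_def hseries_def)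
  \<comment> \<open>The numerator over the true dimension is \<open>P\<close> times (1 - x)^k. Its
    degree is at most \<open>card U\<close> plus k, which equals the dimension by
    \<open>d\<close>.\<close>
  let ?k = "quot_dim X I - card U" and ?z = "[:1, -1 :: rat:]"
  have "hilbert_series X I * (1 - fps_X) ^ quot_dim X I =
      (hseries X I * (1 - fps_X) ^ card U) * (1 - fps_X) ^ ?k"
    using d by (simp add: hs mult.assoc power_add[symmetric])
  also have "\<dots> = fps_of_poly (P * ?z ^ ?k)"
    by (simp add: P(2) fps_of_poly_mult fps_of_poly_power one_coeff_fps)
  finally have "h_polynomial X I = P * ?z ^ ?k" by (rule h_polynomial_eqI)
  moreover have "degree (P * ?z ^ ?k) \<le> quot_dim X I"
    using degree_mult_le[of P "?z ^ ?k"] degree_power_le[of ?z ?k] P(1) d by simp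
  ultimately have a: "a_invariant X I \<le> 0" by (simp add: a_invariant_def)
  obtain p where p: "\<forall>t\<ge>1. poly p (of_nat t) = fps_nth (hseries X I) t"
    using rational_series_polynomial[OF P] by blast
  then have p': "poly p (of_nat t) = of_nat (hilbert_function X I t)" if "1 \<le> t" for t
    using that by (simp add: hf hseries_def)
  then have "hilbert_polynomial X I = p" by (rule hilbert_polynomial_eqI)
  then show ?thesis using a p' by (simp add: X_def)
qed



end
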